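(* Let $0<\alpha<1$, $T>0$, and let $a,b,f:[0,T]\to\mathbb{R}$ be continuous. Let $y:[0,T]\to\mathbb{R}$ be the (continuous) exact solution of the fractional integral equation $$y(x)=\frac{a(x)}{\Gamma(\alpha)}\int_0^x (x-s)^{\alpha-1}\,b(s)\,y(s)\,ds+f(x),\qquad x\in[0,T].$$ For $t\in[-1,1]$ put $Y(t)=y\left(\tfrac{T}{2}(t+1)\right)$, $A(t)=a\left(\tfrac{T}{2}(t+1)\right)$, $B(t)=b\left(\tfrac{T}{2}(t+1)\right)$, $F(t)=f\left(\tfrac{T}{2}(t+1)\right)$. For all sufficiently large $N$, let $U=U_N$ be the Legendre spectral-collocation approximation, that is, a polynomial of degree at most $N$ satisfying $$U_N(t)=\frac{T^\alpha}{4^\alpha\,\Gamma(\alpha)}\,p_{t,N}\left\{(t+1)^\alpha A(t)\int_{-1}^{1}(1-\theta)^{\alpha-1}\,p_{\theta,N}^{\alpha-1,0}\Big(B(\mu(t,\theta))\,U_N(\mu(t,\theta))\Big)\,d\theta\right\}+p_{t,N}\big(F(t)\big),\qquad t\in[-1,1],$$ where $\mu(t,\theta)=\frac{t+1}{2}\theta+\frac{t-1}{2}$, and $p_{t,N}$, $p_{\theta,N}^{\alpha-1,0}$ are the interpolation operators (in the variables $t$ and $\theta$, respectively) defined in the context. Then the Legendre spectral-collocation approximation converges to the exact solution in the $L^2$-norm: $$\|e_N\|_2=\|Y-U_N\|_{L^2(-1,1)}\to 0\qquad\text{as } N\to\infty.$$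
   Context: Notation. $\Gamma$ is the Gamma function. $S_N$ denotes the set of real polynomials of degree at most $N$ on $[-1,1]$, and $e_N=Y-U_N$. $\|\cdot\|_2$ is the usual (unweighted) norm of $L^2(-1,1)$. Legendre interpolation. $L_N$ is the Legendre polynomial of degree $N$ (normalized by $L_0=1$, $L_1(x)=x$, $L_{i+1}(x)=\frac{2i+1}{i+1}xL_i(x)-\frac{i}{i+1}L_{i-1}(x)$). For $N\ge 1$, the Legendre-Gauss-Lobatto nodes $x_0,\dots,x_N$ are the $N+1$ zeros of $(1-x^2)L_N'(x)$. For a continuous function $u$ of $t\in[-1,1]$, $p_{t,N}u\in S_N$ is the unique polynomial of degree at most $N$ with $p_{t,N}u(x_j)=u(x_j)$ for $0\le j\le N$. Jacobi interpolation. For $q_1,q_2>-1$, the Jacobi polynomials $J_n^{q_1,q_2}$ ($n\ge 0$, degree $n$) are the polynomials orthogonal on $(-1,1)$ with respect to the weight $\omega^{q_1,q_2}(x)=(1-x)^{q_1}(1+x)^{q_2}$. The Jacobi-Gauss nodes $x_0^{q_1,q_2},\dots,x_N^{q_1,q_2}$ are the $N+1$ zeros of $J_{N+1}^{q_1,q_2}$. For a continuous function $u$ of $\theta\in[-1,1]$, $p_{\theta,N}^{q_1,q_2}u\in S_N$ is the unique polynomial of degree at most $N$ with $p_{\theta,N}^{q_1,q_2}u(x_j^{q_1,q_2})=u(x_j^{q_1,q_2})$ for $0\le j\le N$. In the scheme this is used with $q_1=\alpha-1$, $q_2=0$, applied to $\theta\mapsto B(\mu(t,\theta))U_N(\mu(t,\theta))$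 for each fixed $t$. Origin of the scheme. The substitutions $x=\frac T2(t+1)$, $s=\frac T2(\mu+1)$ and $\mu=\mu(t,\theta)$ turn the integral equation into the equivalent equation $$Y(t)=\left(\frac T2\right)^\alpha\left(\frac{t+1}{2}\right)^\alpha\frac{A(t)}{\Gamma(\alpha)}\int_{-1}^1 (1-\theta)^{\alpha-1}B(\mu(t,\theta))\,Y(\mu(t,\theta))\,d\theta+F(t),\qquad t\in[-1,1].$$ *)

theory Defs
  imports "HOL-Analysis.Analysis" "HOL-Computational_Algebra.Polynomial"
begin

definition interp_poly :: "real set \<Rightarrow> nat \<Rightarrow> (real \<Rightarrow> real) \<Rightarrow> real poly" where
  "interp_poly X N u = (THE p. degree p \<le> N \<and> (\<forall>x\<in>X. poly p x = u x))"

fun legendre :: "nat \<Rightarrow> real poly" where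
  "legendre 0 = 1"
| "legendre (Suc 0) = [:0, 1:]"
| "legendre (Suc (Suc n)) =
     (let i = real (Suc n)
      in smult ((2 * i + 1) / (i + 1)) ([:0, 1:] * legendre (Suc n)) - smult (i / (i + 1)) (legendre n))"

text \<open>Meaningful for \<open>N \<ge> 1\<close> only: \<open>lgl_nodes 0\<close> is all of the real line.\<close>

definition lgl_nodes :: "nat \<Rightarrow> real set" where
  "lgl_nodes N = {x. (1 - x\<^sup>2) * poly (pderiv (legendre N)) x = 0}"

definition lgl_interp :: "nat \<Rightarrow> (real \<Rightarrow> real) \<Rightarrow> real poly" where
  "lgl_interp N u = interp_poly (lgl_nodes N) N u"

definition jacobi_weight :: "real \<Rightarrow> real \<Rightarrow> real \<Rightarrow> real" where
  "jacobi_weight q1 q2 x = (1 - x) powr q1 * (1 + x) powr q2"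

text \<open>Orthogonality fixes the Jacobi polynomials only up to nonzero scalar factors, on which
  their zeros do not depend; no normalization is imposed.\<close>

definition jacobi_family :: "real \<Rightarrow> real \<Rightarrow> (nat \<Rightarrow> real poly) \<Rightarrow> bool" where
  "jacobi_family q1 q2 J \<longleftrightarrow>
     (\<forall>n. J n \<noteq> 0 \<and> degree (J n) = n) \<and>
     (\<forall>m n. m \<noteq> n \<longrightarrow>
        (LBINT x:{-1<..<1}. jacobi_weight q1 q2 x * poly (J m) x * poly (J n) x) = 0)"

definition jacobi :: "real \<Rightarrow> real \<Rightarrow> nat \<Rightarrow> real poly" where
  "jacobi q1 q2 = (SOME J. jacobi_family q1 q2 J)"

definition jacobi_gauss_nodes :: "real \<Rightarrow> real \<Rightarrow> nat \<Rightarrow> real set" where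
  "jacobi_gauss_nodes q1 q2 N = {x. poly (jacobi q1 q2 (N + 1)) x = 0}"

definition jacobi_interp :: "real \<Rightarrow> real \<Rightarrow> nat \<Rightarrow> (real \<Rightarrow> real) \<Rightarrow> real poly" where
  "jacobi_interp q1 q2 N u = interp_poly (jacobi_gauss_nodes q1 q2 N) N u"

definition fractional_solution ::
  "real \<Rightarrow> real \<Rightarrow> (real \<Rightarrow> real) \<Rightarrow> (real \<Rightarrow> real) \<Rightarrow> (real \<Rightarrow> real) \<Rightarrow> (real \<Rightarrow> real) \<Rightarrow> bool" where
  "fractional_solution \<alpha> T a b f y \<longleftrightarrow>
     (\<forall>x\<in>{0..T}. y x = a x / Gamma \<alpha> * (LBINT s:{0..x}. (x - s) powr (\<alpha> - 1) * b s * y s) + f x)"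

definition to_ref :: "real \<Rightarrow> (real \<Rightarrow> real) \<Rightarrow> real \<Rightarrow> real" where
  "to_ref T u t = u (T / 2 * (t + 1))"

definition mu :: "real \<Rightarrow> real \<Rightarrow> real" where
  "mu t \<theta> = (t + 1) / 2 * \<theta> + (t - 1) / 2"

definition collocation_solution ::
  "real \<Rightarrow> real \<Rightarrow> (real \<Rightarrow> real) \<Rightarrow> (real \<Rightarrow> real) \<Rightarrow> (real \<Rightarrow> real) \<Rightarrow> nat \<Rightarrow> real poly \<Rightarrow> bool" where
  "collocation_solution \<alpha> T a b f N U \<longleftrightarrow>
     degree U \<le> N \<and>
     (\<forall>t\<in>{-1..1}.
        poly U t =
          T powr \<alpha> / (4 powr \<alpha> * Gamma \<alpha>) *
          poly (lgl_interp N (\<lambda>\<tau>. (\<tau> + 1) powr \<alpha> * to_ref T a \<tau> *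
            (LBINT \<theta>:{-1..1}. (1 - \<theta>) powr (\<alpha> - 1) *
               poly (jacobi_interp (\<alpha> - 1) 0 N (\<lambda>\<theta>. to_ref T b (mu \<tau> \<theta>) * poly U (mu \<tau> \<theta>))) \<theta>))) t
          + poly (lgl_interp N (to_ref T f)) t)"

definition L2_norm :: "(real \<Rightarrow> real) \<Rightarrow> real" where
  "L2_norm u = sqrt (LBINT t:{-1<..<1}. (u t)\<^sup>2)"

end

theory Submission imports Defs begin

text \<open>
  Write \<open>K\<close> for the Volterra operator of the equation on the reference interval, \<open>K\<^sub>N\<close> for the same
  operator with the \<open>\<theta>\<close>-integral replaced by the Gauss-Jacobi rule, and \<open>p\<^sub>N\<close> for Lobatto
  interpolation. Then \<open>Y = K Y + F\<close> and \<open>U\<^sub>N = p\<^sub>N K\<^sub>N U\<^sub>N + p\<^sub>N F\<close>, so the error \<open>e = Y - U\<^sub>N\<close> solves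
  \<open>e = K e + (K U\<^sub>N - p\<^sub>N K\<^sub>N U\<^sub>N) + (F - p\<^sub>N F)\<close>. In an exponentially weighted \<open>L\<^sup>2\<close> norm \<open>K\<close> is a
  contraction, so the norm of \<open>e\<close> is at most a constant times that of the last two terms
  (\<open>volterra_stability\<close>). The term \<open>F - p\<^sub>N F\<close> tends to zero for every continuous \<open>F\<close>
  (\<open>lgl_interp_convergence\<close>). The heart of the proof is \<open>consistency\<close>: for every \<open>\<epsilon>\<close> and all large \<open>N\<close>, the norm of
  \<open>p\<^sub>N K\<^sub>N U - K U\<close> is at most \<open>C \<epsilon>\<close> times that of \<open>U\<close>, for all polynomials \<open>U\<close> of degree at
  most \<open>N\<close>. As the norm of \<open>U\<^sub>N\<close> is at most that of \<open>e\<close> plus that of \<open>Y\<close>, a small \<open>\<epsilon>\<close> lets the left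
  side absorb the unknown norm; no a priori bound on \<open>U\<^sub>N\<close> is needed.

  The difficulty in \<open>consistency\<close> is that \<open>K\<close> does not map \<open>L\<^sup>2\<close> into continuous functions when
  \<open>\<alpha> \<le> 1/2\<close>, while interpolation needs point values. The polynomial structure of \<open>U\<close> replaces
  continuity. Let \<open>Q\<^sub>N\<close> be the Lobatto quadrature rule. For polynomials of degree at most \<open>N\<close> the
  value of \<open>Q\<^sub>N\<close> at a square lies between one and three times its integral (\<open>lgl_norm_equiv\<close>), and for fixed \<open>\<theta>\<close>
  the function \<open>t \<mapsto> U(\<mu>(t,\<theta>))\<close> is again such a polynomial, whose squared norm is at most
  \<open>2/(1+\<theta>)\<close> times that of \<open>U\<close>. The Cauchy-Schwarz inequality in \<open>\<theta>\<close> with the weights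
  \<open>(1+\<theta>)\<^bsup>\<plusminus>1/2\<^esup>\<close> then bounds the \<open>\<theta>\<close>-integral of \<open>U(\<mu>(t,\<theta>))\<close> at the Lobatto nodes, for
  every measure that integrates \<open>(1+\<theta>)\<^bsup>-1/2\<^esup>\<close> (\<open>lgl_hardy\<close>). It is applied to the Abel weights and
  to the Gauss-Jacobi rules; for the latter the required bound, uniform in \<open>N\<close>, holds because
  a Gauss rule underestimates the integral of \<open>1/(x+c)\<close>, and \<open>(1+x)\<^bsup>-1/2\<^esup>\<close> is a mixture of such
  functions (\<open>gauss_sum_inverse_sqrt\<close>).

  With these bounds one may replace the kernel of \<open>K\<close> by a kernel that is a polynomial in both
  variables, up to an error \<open>\<epsilon> (1 + (t-s)\<^bsup>\<alpha>/2-1\<^esup>)\<close> (\<open>kernel_approximation\<close>), and the coefficient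
  \<open>B\<close> by a polynomial, for which the Gauss-Jacobi rule is exact. The operator with polynomial
  kernel has its range in a fixed space of polynomials, which \<open>p\<^sub>N\<close> reproduces for large \<open>N\<close>.
\<close>

section \<open>Lagrange interpolation\<close>

text \<open>The Lagrange basis polynomial of the node \<open>x\<close> for the finite node set \<open>X\<close>.\<close>

definition lagrange :: "real set \<Rightarrow> real \<Rightarrow> real poly" where
  "lagrange X x = smult (inverse (\<Prod>y\<in>X-{x}. x - y)) (\<Prod>y\<in>X-{x}. [:-y, 1:])"

lemma poly_lagrange:
  assumes "finite X" "x \<in> X" "z \<in> X"
  shows "poly (lagrange X x) z = (if z = x then 1 else 0)"
proof -
  have nz: "(\<Prod>y\<in>X-{x}. x - y) \<noteq> 0"
    using assms by auto
  show ?thesis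
    using assms nz by (auto simp: lagrange_def poly_prod)
qed

lemma degree_prod_linear: "degree (\<Prod>z\<in>Z. [:- z, 1::real:]) = card Z"
proof -
  have "degree (\<Prod>z\<in>Z. [:- z, 1::real:]) = (\<Sum>z\<in>Z. degree [:- z, 1::real:])"
    by (rule degree_prod_eq_sum_degree) auto
  thus ?thesis by simp
qed

lemma degree_lagrange:
  assumes "finite X" "x \<in> X"
  shows "degree (lagrange X x) < card X"
proof -
  have "degree (lagrange X x) \<le> card (X - {x})"
    unfolding lagrange_def by (metis degree_smult_le degree_prod_linear)
  thus ?thesis using assms
    by (metis card_Diff1_less order_le_less_trans)
qed

lemma poly_eq_on_nodes:
  fixes p q :: "real poly"
  assumes "finite X" "degree p < card X" "degree q < card X"
    and "\<And>x. x \<in> X \<Longrightarrow> poly p x = poly q x"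
  shows "p = q"
proof (rule ccontr)
  assume "p \<noteq> q"
  hence nz: "p - q \<noteq> 0" by simp
  have "card X \<le> card {x. poly (p - q) x = 0}"
    using assms poly_roots_finite[OF nz] by (intro card_mono) auto
  also have "\<dots> \<le> degree (p - q)"
    by (rule card_poly_roots_bound[OF nz])
  also have "\<dots> < card X"
    using assms(2,3) by (rule degree_diff_less)
  finally show False by simp
qed

lemma degree_sum_lagrange:
  assumes "finite X" "X \<noteq> {}"
  shows "degree (\<Sum>x\<in>X. smult (u x) (lagrange X x)) < card X"
proof -
  have "degree (\<Sum>x\<in>X. smult (u x) (lagrange X x)) \<le> card X - 1"
  proof (rule degree_sum_le)
    fix x assume "x \<in> X"
    thus "degree (smult (u x) (lagrange X x)) \<le> card X - 1"
      using degree_lagrange[of X x] assms degree_smult_le[of "u x" "lagrange X x"] by linarith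
  qed (use assms in auto)
  moreover have "card X > 0" using assms by (simp add: card_gt_0_iff)
  ultimately show ?thesis by linarith
qed

lemma poly_sum_lagrange:
  assumes "finite X" "z \<in> X"
  shows "poly (\<Sum>x\<in>X. smult (u x) (lagrange X x)) z = u z"
proof -
  have "poly (\<Sum>x\<in>X. smult (u x) (lagrange X x)) z = (\<Sum>x\<in>X. if z = x then u x else 0)"
    unfolding poly_sum by (rule sum.cong) (use assms in \<open>auto simp: poly_lagrange\<close>)
  also have "\<dots> = u z" using assms by simp
  finally show ?thesis .
qed

lemma interp_poly_eq_lagrange:
  assumes "finite X" "card X = Suc N"
  shows "interp_poly X N u = (\<Sum>x\<in>X. smult (u x) (lagrange X x))"
  unfolding interp_poly_def
proof (rule the_equality)
  have ne: "X \<noteq> {}" using assms by auto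
  show *: "degree (\<Sum>x\<in>X. smult (u x) (lagrange X x)) \<le> N \<and>
    (\<forall>z\<in>X. poly (\<Sum>x\<in>X. smult (u x) (lagrange X x)) z = u z)"
    using degree_sum_lagrange[OF assms(1) ne, of u] poly_sum_lagrange[OF assms(1)] assms(2) by auto
  fix p assume "degree p \<le> N \<and> (\<forall>x\<in>X. poly p x = u x)"
  thus "p = (\<Sum>x\<in>X. smult (u x) (lagrange X x))"
    using * assms by (intro poly_eq_on_nodes[of X]) auto
qed

section \<open>Orthogonal polynomials and quadrature for a positive functional\<close>

text \<open>\<open>Z\<close> consists of the zeros of odd multiplicity in the open interval.\<close>

lemma poly_sign_factorization:
  fixes P :: "real poly"
  assumes "P \<noteq> 0"
  shows "\<exists>Z s. finite Z \<and> Z \<subseteq> {-1<..<1} \<and> P = (\<Prod>z\<in>Z. [:- z, 1:]) * s \<and>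
    ((\<forall>x\<in>{-1<..<1}. 0 \<le> poly s x) \<or> (\<forall>x\<in>{-1<..<1}. poly s x \<le> 0))"
  using assms
proof (induction "degree P" arbitrary: P rule: less_induct)
  case less
  show ?case
  proof (cases "\<exists>a\<in>{-1<..<1}. poly P a = 0")
    case False
    have "(\<forall>x\<in>{-1<..<1}. 0 \<le> poly P x) \<or> (\<forall>x\<in>{-1<..<1}. poly P x \<le> 0)"
    proof (rule ccontr)
      assume "\<not> ?thesis"
      then obtain x y where xy: "x \<in> {-1<..<1}" "y \<in> {-1<..<1}" "poly P x < 0" "0 < poly P y"
        by force
      have "\<exists>z. (x < z \<and> z < y \<or> y < z \<and> z < x) \<and> poly P z = 0"
      proof (cases x y rule: linorder_cases)
        case less
        thus ?thesis using poly_IVT_pos[of x y P] xy by auto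
      next
        case equal
        thus ?thesis using xy by simp
      next
        case greater
        thus ?thesis using poly_IVT_neg[of y x P] xy by auto
      qed
      thus False using False xy by force
    qed
    thus ?thesis by (intro exI[of _ "{}"] exI[of _ P]) auto
  next
    case True
    then obtain a where a: "a \<in> {-1<..<1}" "poly P a = 0" by blast
    then obtain P1 where P1: "P = [:-a, 1:] * P1"
      by (metis dvdE poly_eq_0_iff_dvd)
    have nz: "P1 \<noteq> 0" using less.prems P1 by auto
    hence "degree P = Suc (degree P1)"
      unfolding P1 by (subst degree_mult_eq) auto
    then obtain Z s where Zs: "finite Z" "Z \<subseteq> {-1<..<1}" "P1 = (\<Prod>z\<in>Z. [:- z, 1:]) * s"
      "(\<forall>x\<in>{-1<..<1}. 0 \<le> poly s x) \<or> (\<forall>x\<in>{-1<..<1}. poly s x \<le> 0)"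
      using less.hyps[of P1] nz by auto
    show ?thesis
    proof (cases "a \<in> Z")
      case True
      hence "(\<Prod>z\<in>Z. [:- z, 1:]) = [:-a, 1:] * (\<Prod>z\<in>Z-{a}. [:- z, 1:])"
        using Zs(1) by (subst prod.remove[of _ a]) auto
      hence "P = (\<Prod>z\<in>Z-{a}. [:- z, 1:]) * ([:-a, 1:]^2 * s)"
        unfolding P1 Zs(3) by (simp only: power2_eq_square ac_simps)
      moreover have "(\<forall>x\<in>{-1<..<1}. 0 \<le> poly ([:-a, 1:]^2 * s) x) \<or>
          (\<forall>x\<in>{-1<..<1}. poly ([:-a, 1:]^2 * s) x \<le> 0)"
        using Zs(4) by (auto simp: mult_nonneg_nonneg mult_nonneg_nonpos)
      ultimately show ?thesis using Zs(1,2)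
        by (intro exI[of _ "Z-{a}"] exI[of _ "[:-a, 1:]^2 * s"]) auto
    next
      case False
      hence "(\<Prod>z\<in>insert a Z. [:- z, 1:]) = [:-a, 1:] * (\<Prod>z\<in>Z. [:- z, 1:])"
        using Zs(1) by simp
      hence "P = (\<Prod>z\<in>insert a Z. [:- z, 1:]) * s"
        unfolding P1 Zs(3) by (simp only: ac_simps)
      thus ?thesis using Zs a
        by (intro exI[of _ "insert a Z"] exI[of _ s]) auto
    qed
  qed
qed

text \<open>Integration against a positive weight on \<open>(-1, 1)\<close>, reduced to the algebraic properties that
  the theory of orthogonal polynomials and Gauss quadrature uses.\<close>

locale pos_functional =
  fixes I :: "real poly \<Rightarrow> real"
  assumes I_add: "I (p + q) = I p + I q"
    and I_smult: "I (smult c p) = c * I p"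
    and I_pos: "p \<noteq> 0 \<Longrightarrow> (\<And>x. x \<in> {-1<..<1} \<Longrightarrow> 0 \<le> poly p x) \<Longrightarrow> 0 < I p"
begin

lemma I_0 [simp]: "I 0 = 0"
  using I_smult[of 0 0] by simp

lemma I_minus: "I (- p) = - I p"
  using I_smult[of "-1" p] by simp

lemma I_diff: "I (p - q) = I p - I q"
  using I_add[of p "- q"] I_minus[of q] by simp

lemma I_sum: "I (\<Sum>x\<in>X. f x) = (\<Sum>x\<in>X. I (f x))"
  by (induction X rule: infinite_finite_induct) (auto simp: I_add)

text \<open>Otherwise the product of \<open>P\<close> with the linear factors of its sign changes would have one sign and
  yet be annihilated by \<open>I\<close>.\<close>

lemma orthogonal_roots:
  assumes "P \<noteq> 0" "degree P = n"
    and orth: "\<And>q. degree q < n \<Longrightarrow> I (P * q) = 0"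
  shows "card {x. poly P x = 0} = n" "{x. poly P x = 0} \<subseteq> {-1<..<1}"
proof -
  obtain Z s where Z: "finite Z" "Z \<subseteq> {-1<..<1}" "P = (\<Prod>z\<in>Z. [:- z, 1:]) * s"
    "(\<forall>x\<in>{-1<..<1}. 0 \<le> poly s x) \<or> (\<forall>x\<in>{-1<..<1}. poly s x \<le> 0)"
    using poly_sign_factorization[OF assms(1)] by blast
  define q where "q = (\<Prod>z\<in>Z. [:- z, 1::real:])"
  have q0: "q \<noteq> 0" and s0: "s \<noteq> 0" using assms(1) Z(3) by (auto simp: q_def)
  have dq: "degree q = card Z" by (simp add: q_def degree_prod_linear)
  have "degree P = degree q + degree s"
    using q0 s0 Z(3) by (simp add: degree_mult_eq q_def)
  hence le: "card Z \<le> n" using dq assms(2) by simp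
  have eq: "card Z = n"
  proof (rule ccontr)
    assume "card Z \<noteq> n"
    hence z: "I (P * q) = 0" using le dq by (intro orth) auto
    have Pq: "P * q = q^2 * s" unfolding Z(3) q_def[symmetric] by (simp add: power2_eq_square ac_simps)
    from Z(4) show False
    proof
      assume "\<forall>x\<in>{-1<..<1}. 0 \<le> poly s x"
      hence "0 < I (P * q)" using q0 s0 by (intro I_pos) (auto simp: Pq)
      thus False using z by simp
    next
      assume "\<forall>x\<in>{-1<..<1}. poly s x \<le> 0"
      hence "0 < I (- (P * q))" using q0 s0 by (intro I_pos) (auto simp: Pq mult_nonneg_nonpos)
      thus False using z by (simp add: I_minus)
    qed
  qed
  have sub: "Z \<subseteq> {x. poly P x = 0}" using Z(1) by (auto simp: Z(3) poly_prod)
  have fin: "finite {x. poly P x = 0}" by (rule poly_roots_finite[OF assms(1)])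
  have "card {x. poly P x = 0} \<le> n" using card_poly_roots_bound[OF assms(1)] assms(2) by simp
  moreover have "n \<le> card {x. poly P x = 0}" using card_mono[OF fin sub] eq by simp
  ultimately show c: "card {x. poly P x = 0} = n" by simp
  have "Z = {x. poly P x = 0}" by (rule card_subset_eq[OF fin sub]) (simp add: c eq)
  thus "{x. poly P x = 0} \<subseteq> {-1<..<1}" using Z(2) by simp
qed

text \<open>The interpolatory quadrature rule with node set \<open>X\<close>.\<close>

definition quad :: "real set \<Rightarrow> (real \<Rightarrow> real) \<Rightarrow> real" where
  "quad X g = (\<Sum>x\<in>X. I (lagrange X x) * g x)"

lemma quad_add: "quad X (\<lambda>x. f x + g x) = quad X f + quad X g"
  by (simp add: quad_def algebra_simps sum.distrib)

lemma quad_cmult: "quad X (\<lambda>x. c * g x) = c * quad X g"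
  by (simp add: quad_def algebra_simps sum_distrib_left)

lemma quad_interp: "I (\<Sum>x\<in>X. smult (g x) (lagrange X x)) = quad X g"
  by (simp add: quad_def I_sum I_smult mult.commute)

text \<open>Each degree of orthogonality of the node polynomial \<open>V\<close> adds one degree of exactness.\<close>

lemma quad_exact:
  assumes "finite X" "X \<noteq> {}" and V: "V \<noteq> 0" "degree V = card X" "\<And>x. x \<in> X \<Longrightarrow> poly V x = 0"
    and orth: "\<And>q. degree q < k \<Longrightarrow> I (V * q) = 0"
    and p: "degree p < card X + k"
  shows "quad X (poly p) = I p"
proof -
  define d r where "d = p div V" and "r = p mod V"
  have p_eq: "p = V * d + r" by (simp add: d_def r_def)
  have cpos: "card X > 0" using assms by (simp add: card_gt_0_iff)
  have dr: "degree r < card X"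
    using degree_mod_less[OF V(1), of p] V(2) cpos by (auto simp: r_def)
  have Ivd: "I (V * d) = 0"
  proof (cases "d = 0")
    case False
    have "degree (V * d) = card X + degree d" using False V by (simp add: degree_mult_eq)
    moreover have "degree p = degree (V * d)"
      unfolding p_eq using dr calculation by (intro degree_add_eq_left) simp
    ultimately show ?thesis using p by (intro orth) simp
  qed simp
  have "r = (\<Sum>x\<in>X. smult (poly r x) (lagrange X x))"
    using assms(1,2) dr by (intro poly_eq_on_nodes[of X] degree_sum_lagrange) (auto simp: poly_sum_lagrange)
  hence "I r = quad X (poly r)" using quad_interp[where g = "poly r" and X = X] by simp
  also have "\<dots> = quad X (poly p)"
    unfolding quad_def by (rule sum.cong) (auto simp: p_eq V(3))
  finally have "I r = quad X (poly p)" .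
  moreover have "I p = I (V * d) + I r" by (subst p_eq) (rule I_add)
  ultimately show ?thesis using Ivd by simp
qed

lemma gauss_quad:
  assumes P: "P \<noteq> 0" "degree P = Suc n"
    and orth: "\<And>q. degree q < Suc n \<Longrightarrow> I (P * q) = 0"
  defines "X \<equiv> {x. poly P x = 0}"
  shows "finite X" "card X = Suc n" "X \<subseteq> {-1<..<1}"
    and "\<And>p. degree p < 2 * Suc n \<Longrightarrow> quad X (poly p) = I p"
    and "\<And>x. x \<in> X \<Longrightarrow> 0 < I (lagrange X x)"
proof -
  show fin: "finite X" unfolding X_def by (rule poly_roots_finite[OF P(1)])
  show card: "card X = Suc n" and "X \<subseteq> {-1<..<1}"
    using orthogonal_roots[OF P orth] by (auto simp: X_def)
  have ne: "X \<noteq> {}" using card by auto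
  show exact: "quad X (poly p) = I p" if "degree p < 2 * Suc n" for p
    using that card P by (intro quad_exact[OF fin ne P(1) _ _ orth]) (auto simp: X_def)
  fix x assume x: "x \<in> X"
  have d: "degree (lagrange X x) \<le> n" using degree_lagrange[OF fin x] card by simp
  have nz: "lagrange X x \<noteq> 0" using poly_lagrange[OF fin x x] by auto
  have "I ((lagrange X x)^2) = quad X (poly ((lagrange X x)^2))"
    by (subst exact) (use d in \<open>auto intro!: le_less_trans[OF degree_power_le]\<close>)
  also have "\<dots> = (\<Sum>y\<in>X. if y = x then I (lagrange X x) else 0)"
    unfolding quad_def by (rule sum.cong) (auto simp: poly_lagrange fin x)
  also have "\<dots> = I (lagrange X x)" using fin x by simp
  finally have "I (lagrange X x) = I ((lagrange X x)^2)" by simp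
  also have "\<dots> > 0" using nz by (intro I_pos) auto
  finally show "0 < I (lagrange X x)" .
qed

text \<open>The condition on coefficients says that the degree is below \<open>n\<close>, and for \<open>n = 0\<close>
  that the polynomial vanishes.\<close>

lemma orthogonal_projection:
  "\<exists>r. (\<forall>k\<ge>n. coeff r k = 0) \<and> (\<forall>q. (\<forall>k\<ge>n. coeff q k = 0) \<longrightarrow> I ((p - r) * q) = 0)"
proof (induction n arbitrary: p)
  case 0
  have *: "q = 0" if "\<forall>k\<ge>0. coeff q k = 0" for q :: "real poly"
    using that by (intro poly_eqI) auto
  have "I ((p - 0) * q) = 0" if "\<forall>k\<ge>0. coeff q k = 0" for q
    using *[OF that] by simp
  thus ?case by (intro exI[of _ 0]) auto
next
  case (Suc n)
  obtain r0 where r0: "\<forall>k\<ge>n. coeff r0 k = 0"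
    "\<forall>q. (\<forall>k\<ge>n. coeff q k = 0) \<longrightarrow> I ((monom 1 n - r0) * q) = 0" using Suc by blast
  define P where "P = monom 1 n - r0"
  have cP: "coeff P n = 1" "\<forall>k\<ge>Suc n. coeff P k = 0" using r0(1) by (auto simp: P_def)
  have orthP: "I (P * q) = 0" if "\<forall>k\<ge>n. coeff q k = 0" for q using r0(2) that by (simp add: P_def)
  have PP: "0 < I (P * P)" using cP(1) by (intro I_pos) auto
  obtain r1 where r1: "\<forall>k\<ge>n. coeff r1 k = 0"
    "\<forall>q. (\<forall>k\<ge>n. coeff q k = 0) \<longrightarrow> I ((p - r1) * q) = 0" using Suc by blast
  define c where "c = I ((p - r1) * P) / I (P * P)"
  have "I ((p - (r1 + smult c P)) * q) = 0" if q: "\<forall>k\<ge>Suc n. coeff q k = 0" for q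
  proof -
    define q0 where "q0 = q - smult (coeff q n) P"
    have q0: "\<forall>k\<ge>n. coeff q0 k = 0"
    proof (intro allI impI)
      fix k assume "n \<le> k"
      thus "coeff q0 k = 0" using q cP by (cases "k = n") (auto simp: q0_def)
    qed
    have "(p - (r1 + smult c P)) * q = ((p - r1) * q0 - smult c (P * q0)) +
        smult (coeff q n) ((p - r1) * P - smult c (P * P))"
      by (simp add: q0_def algebra_simps smult_diff_right smult_add_right)
    hence "I ((p - (r1 + smult c P)) * q) = (I ((p - r1) * q0) - c * I (P * q0)) +
        coeff q n * (I ((p - r1) * P) - c * I (P * P))"
      by (simp only: I_add I_diff I_smult)
    also have "\<dots> = 0" using r1(2) orthP q0 PP by (simp add: c_def)
    finally show ?thesis .
  qed
  moreover have "\<forall>k\<ge>Suc n. coeff (r1 + smult c P) k = 0" using r1(1) cP(2) by auto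
  ultimately show ?case by blast
qed

lemma orthogonal_family_exists:
  "\<exists>J. (\<forall>n. J n \<noteq> 0 \<and> degree (J n) = n) \<and> (\<forall>m n. m \<noteq> n \<longrightarrow> I (J m * J n) = 0)"
proof -
  have "\<exists>P. degree P = n \<and> P \<noteq> 0 \<and> (\<forall>q. degree q < n \<longrightarrow> I (P * q) = 0)" for n
  proof -
    obtain r where r: "\<forall>k\<ge>n. coeff r k = 0"
      "\<forall>q. (\<forall>k\<ge>n. coeff q k = 0) \<longrightarrow> I ((monom 1 n - r) * q) = 0"
      using orthogonal_projection by blast
    have 1: "coeff (monom 1 n - r) n = 1" using r(1) by simp
    moreover have "degree (monom 1 n - r) \<le> n"
      using r(1) by (intro degree_le) auto
    ultimately have "degree (monom 1 n - r) = n" using le_degree[of "monom 1 n - r" n] by simp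
    moreover have "monom 1 n - r \<noteq> 0" using 1 by (metis coeff_0 zero_neq_one)
    moreover have "I ((monom 1 n - r) * q) = 0" if "degree q < n" for q
      using r(2) that by (auto simp: coeff_eq_0)
    ultimately show ?thesis by blast
  qed
  then obtain J where J: "\<And>n. degree (J n) = n \<and> J n \<noteq> 0 \<and> (\<forall>q. degree q < n \<longrightarrow> I (J n * q) = 0)"
    by metis
  have "I (J m * J n) = 0" if "m \<noteq> n" for m n
  proof (cases "m < n")
    case True
    thus ?thesis using J[of n] J[of m] by (metis mult.commute)
  next
    case False
    thus ?thesis using J[of n] J[of m] that by (metis nat_neq_iff)
  qed
  thus ?thesis using J by blast
qed

lemma orthogonal_family_lower_degree:
  assumes J: "\<And>n. J n \<noteq> 0 \<and> degree (J n) = n" "\<And>m n. m \<noteq> n \<Longrightarrow> I (J m * J n) = 0"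
    and q: "degree q < n"
  shows "I (J n * q) = 0"
  using q
proof (induction "degree q" arbitrary: q rule: less_induct)
  case less
  define k where "k = degree q"
  define c where "c = coeff q k / coeff (J k) k"
  define q0 where "q0 = q - smult c (J k)"
  have lc: "coeff (J k) k \<noteq> 0" using J(1)[of k] leading_coeff_neq_0 by metis
  have c0: "coeff q0 k = 0" using lc by (simp add: q0_def c_def)
  have d0: "degree q0 \<le> k" unfolding q0_def
    by (rule degree_diff_le) (use J(1)[of k] degree_smult_le[of c "J k"] in \<open>auto simp: k_def\<close>)
  have "I (J n * q0) = 0"
  proof (cases "q0 = 0")
    case False
    have "degree q0 < k" using d0 c0 False
      by (metis le_neq_implies_less leading_coeff_0_iff)
    thus ?thesis using less.hyps[of q0] less.prems k_def by auto
  qed simp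
  moreover have "J n * q = J n * q0 + smult c (J n * J k)" by (simp add: q0_def algebra_simps)
  moreover have "I (J n * J k) = 0" using less.prems by (intro J(2)) (auto simp: k_def)
  ultimately show ?case by (simp add: I_add I_smult)
qed

end

section \<open>Legendre polynomials\<close>

declare legendre.simps(3) [simp del]

lemma legendre_rec:
  "smult (real n + 2) (legendre (n + 2)) =
     smult (2 * real n + 3) ([:0, 1:] * legendre (n + 1)) - smult (real n + 1) (legendre n)"
proof -
  have "legendre (n + 2) = smult ((2 * real n + 3) / (real n + 2)) ([:0, 1:] * legendre (n + 1))
      - smult ((real n + 1) / (real n + 2)) (legendre n)"
    by (simp add: legendre.simps(3) Let_def algebra_simps)
  also have "smult (real n + 2) \<dots> = smult (2 * real n + 3) ([:0, 1:] * legendre (n + 1)) - smult (real n + 1) (legendre n)"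
    by (simp add: smult_diff_right)
  finally show ?thesis .
qed

lemma degree_legendre_aux: "degree (legendre n) = n \<and> degree (legendre (Suc n)) = Suc n"
proof (induction n)
  case (Suc n)
  define c d where "c = (2 * real n + 3) / (real n + 2)" and "d = (real n + 1) / (real n + 2)"
  have c0: "c \<noteq> 0" by (simp add: c_def)
  have nz: "legendre (Suc n) \<noteq> 0" using Suc by auto
  have eq: "legendre (Suc (Suc n)) = smult c (pCons 0 (legendre (Suc n))) - smult d (legendre n)"
    by (simp add: legendre.simps(3) Let_def c_def d_def algebra_simps)
  have 1: "degree (smult c (pCons 0 (legendre (Suc n)))) = Suc (Suc n)"
    using Suc nz c0 by simp
  have 2: "degree (- smult d (legendre n)) < Suc (Suc n)"
    using Suc degree_smult_le[of d "legendre n"] by simp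
  have "degree (smult c (pCons 0 (legendre (Suc n))) + - smult d (legendre n)) = Suc (Suc n)"
    using 1 2 by (subst degree_add_eq_left) auto
  thus ?case using Suc eq by simp
qed auto

lemma degree_legendre [simp]: "degree (legendre n) = n"
  using degree_legendre_aux by blast

lemma legendre_nonzero [simp]: "legendre n \<noteq> 0"
proof (cases n)
  case (Suc m)
  thus ?thesis using degree_legendre[of n] by (metis degree_0 nat.distinct(1))
qed simp

text \<open>The two relations between consecutive Legendre polynomials and their derivatives, proved
  together from the three-term recurrence.\<close>

lemma legendre_deriv_aux:
  "poly (pderiv (legendre (Suc n))) x =
     x * poly (pderiv (legendre n)) x + (real n + 1) * poly (legendre n) x \<and>
   x * poly (pderiv (legendre (Suc n))) x - poly (pderiv (legendre n)) x =
     (real n + 1) * poly (legendre (Suc n)) x"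
proof (induction n)
  case 0
  show ?case by (simp add: pderiv_pCons)
next
  case (Suc n)
  define P0 P1 P2 D0 D1 D2 where defs: "P0 = poly (legendre n) x" "P1 = poly (legendre (Suc n)) x"
    "P2 = poly (legendre (Suc (Suc n))) x" "D0 = poly (pderiv (legendre n)) x"
    "D1 = poly (pderiv (legendre (Suc n))) x" "D2 = poly (pderiv (legendre (Suc (Suc n)))) x"
  define k where "k = real n"
  have k: "k \<ge> 0" by (simp add: k_def)
  have A: "D1 = x * D0 + (k + 1) * P0" and B: "x * D1 - D0 = (k + 1) * P1"
    using Suc by (auto simp: defs k_def)
  have R: "(k + 2) * P2 = (2 * k + 3) * (x * P1) - (k + 1) * P0"
    using arg_cong[OF legendre_rec[of n], of "\<lambda>p. poly p x"]
    by (simp add: defs k_def numeral_2_eq_2)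
  have R': "(k + 2) * D2 = (2 * k + 3) * (P1 + x * D1) - (k + 1) * D0"
    using arg_cong[OF legendre_rec[of n], of "\<lambda>p. poly (pderiv p) x"]
    by (simp add: defs k_def pderiv_smult pderiv_diff pderiv_pCons numeral_2_eq_2 algebra_simps)
  have "(k + 2) * D2 = (k + 2) * (x * D1 + (k + 2) * P1)"
    using R' B by algebra
  hence A': "D2 = x * D1 + (k + 2) * P1"
    using k by simp
  have "x * D2 - D1 = (k + 2) * P2"
    using A' A B R by algebra
  thus ?case using A' by (simp add: defs k_def algebra_simps)
qed

text \<open>The polynomial \<open>1 - x\<^sup>2\<close>.\<close>

definition lobw :: "real poly" where "lobw = [:1, 0, -1:]"

lemma lobw_nonzero [simp]: "lobw \<noteq> 0" and degree_lobw [simp]: "degree lobw = 2"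
  and poly_lobw [simp]: "poly lobw x = 1 - x * x"
  and pderiv_lobw: "pderiv lobw = [:0, -2:]"
  by (simp_all add: lobw_def pderiv_pCons algebra_simps)

lemma lobw_mult: "lobw * p = p - pCons 0 (pCons 0 p)"
  by (simp add: lobw_def)

text \<open>The Legendre differential equation; orthogonality is derived from it.\<close>

lemma legendre_ode:
  "pderiv (lobw * pderiv (legendre n)) = smult (- (real n * (real n + 1))) (legendre n)"
proof (cases n)
  case 0
  thus ?thesis by (simp add: pderiv_pCons)
next
  case (Suc m)
  define P Q where "P = legendre m" and "Q = legendre n"
  have D: "poly (pderiv Q) x = x * poly (pderiv P) x + real n * poly P x"
    "x * poly (pderiv Q) x - poly (pderiv P) x = real n * poly Q x" for x
    using legendre_deriv_aux[of m x] by (auto simp: P_def Q_def Suc add.commute)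
  have "poly (lobw * pderiv Q) x = poly (smult (real n) (P - [:0, 1:] * Q)) x" for x
  proof -
    have "(1 - x * x) * poly (pderiv Q) x = real n * (poly P x - x * poly Q x)"
      using D[of x] by algebra
    thus ?thesis by simp
  qed
  hence k: "lobw * pderiv Q = smult (real n) (P - [:0, 1:] * Q)"
    by (metis poly_ext)
  have "poly (pderiv (lobw * pderiv Q)) x =
      poly (smult (- (real n * (real n + 1))) Q) x" for x
  proof -
    have "real n * (poly (pderiv P) x - (poly Q x + x * poly (pderiv Q) x)) =
       - (real n * (real n + 1)) * poly Q x"
      using D[of x] by algebra
    thus ?thesis unfolding k by (simp add: pderiv_smult pderiv_diff pderiv_pCons)
  qed
  thus ?thesis unfolding Q_def by (metis poly_ext)
qed


section \<open>Legendre-Gauss-Lobatto quadrature\<close>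

text \<open>The functional is integration with weight one; the fundamental theorem of calculus
  characterizes it.\<close>

locale unit_weight_functional = pos_functional +
  assumes I_pderiv: "I (pderiv p) = poly p 1 - poly p (-1)"
begin

lemma I_parts:
  assumes "poly p 1 = 0" "poly p (-1) = 0"
  shows "I (pderiv p * q) = - I (p * pderiv q)"
proof -
  have "I (pderiv (p * q)) = 0" using assms by (simp add: I_pderiv)
  thus ?thesis by (simp add: pderiv_mult I_add mult.commute)
qed

text \<open>The Legendre operator is self-adjoint and maps a polynomial of degree \<open>k\<close> to \<open>-k (k + 1)\<close> times
  itself plus terms of lower degree; comparing with the eigenvalue of the Legendre polynomial gives
  the claim by induction on \<open>k\<close>.\<close>

lemma legendre_orthogonal:
  assumes "degree q < n"
  shows "I (legendre n * q) = 0"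
  using assms
proof (induction "degree q" arbitrary: q rule: less_induct)
  case less
  define k where "k = degree q"
  define w where "w = lobw"
  define r where "r = pderiv (w * pderiv q) + smult (real k * (real k + 1)) q"
  have wr: "poly w 1 = 0" "poly w (-1) = 0" by (auto simp: w_def)
  have coeffs: "coeff (pderiv (w * pderiv q)) i =
      (real i + 1) * (real i + 2) * coeff q (i + 2) - real i * (real i + 1) * coeff q i" for i
  proof -
    show ?thesis unfolding w_def lobw_mult
      by (cases i) (auto simp: coeff_pderiv coeff_pCons algebra_simps split: nat.splits)
  qed
  have cr: "coeff r i = 0" if "i \<ge> k" for i
    using that by (cases "i = k") (auto simp: r_def coeffs k_def coeff_eq_0)
  have Ir: "I (legendre n * r) = 0"
  proof (cases "r = 0")
    case False
    have "degree r < k"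
      by (rule ccontr) (use cr[of "degree r"] False in auto)
    thus ?thesis using less.hyps[of r] less.prems by (simp add: k_def)
  qed simp
  have "I (pderiv (w * pderiv q) * legendre n) = - I ((w * pderiv q) * pderiv (legendre n))"
    by (rule I_parts) (auto simp: wr)
  moreover have "I (pderiv (w * pderiv (legendre n)) * q) = - I ((w * pderiv (legendre n)) * pderiv q)"
    by (rule I_parts) (auto simp: wr)
  ultimately have "I (pderiv (w * pderiv q) * legendre n) = I (pderiv (w * pderiv (legendre n)) * q)"
    by (simp add: ac_simps)
  also have "\<dots> = - (real n * (real n + 1)) * I (legendre n * q)"
    unfolding w_def legendre_ode by (simp add: I_smult I_minus)
  finally have "I (legendre n * pderiv (w * pderiv q)) = - (real n * (real n + 1)) * I (legendre n * q)"
    by (simp add: mult.commute)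
  hence "(real k * (real k + 1) - real n * (real n + 1)) * I (legendre n * q) = 0"
    using Ir by (simp add: r_def distrib_left I_add I_smult algebra_simps)
  moreover have "real k * (real k + 1) < real n * (real n + 1)"
    using less.prems by (intro mult_strict_mono) (auto simp: k_def)
  ultimately show ?case by simp
qed

lemma legendre_deriv_energy:
  "I (lobw * pderiv (legendre n) * pderiv (legendre n)) =
     real n * (real n + 1) * I (legendre n * legendre n)"
proof -
  have "I (pderiv (lobw * pderiv (legendre n)) * legendre n) =
      - I (lobw * pderiv (legendre n) * pderiv (legendre n))"
    by (rule I_parts) auto
  thus ?thesis unfolding legendre_ode by (simp add: I_minus I_smult)
qed

text \<open>Integration with weight \<open>1 - x\<^sup>2\<close>, for which the derivatives of the Legendre polynomials are
  orthogonal; hence their zeros, the interior Lobatto nodes, are simple and lie in \<open>(-1, 1)\<close>.\<close>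

lemma interior_functional: "pos_functional (\<lambda>p. I (lobw * p))"
proof
  fix p q :: "real poly" and c
  show "I (lobw * (p + q)) = I (lobw * p) + I (lobw * q)"
    by (simp add: distrib_left I_add)
  show "I (lobw * smult c p) = c * I (lobw * p)"
    by (simp add: I_smult)
  assume p: "p \<noteq> 0" "\<And>x. x \<in> {-1<..<1} \<Longrightarrow> 0 \<le> poly p x"
  show "0 < I (lobw * p)"
  proof (rule I_pos)
    show "lobw * p \<noteq> 0" using p(1) by simp
    fix x :: real assume x: "x \<in> {-1<..<1}"
    hence "0 \<le> (1 - x) * (1 + x)" by simp
    hence "0 \<le> 1 - x * x" by (simp add: algebra_simps)
    moreover have "poly (lobw * p) x = (1 - x * x) * poly p x"
      by (simp add: algebra_simps)
    ultimately show "0 \<le> poly (lobw * p) x" using p(2)[OF x] by simp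
  qed
qed

lemma legendre_deriv_orthogonal:
  assumes "degree q < n - 1"
  shows "I (lobw * (pderiv (legendre n) * q)) = 0"
proof -
  have "I (pderiv (legendre n) * (lobw * q)) = - I (legendre n * pderiv (lobw * q))"
    using I_parts[of "lobw * q" "legendre n"] by (simp add: ac_simps)
  also have "I (legendre n * pderiv (lobw * q)) = 0"
  proof (rule legendre_orthogonal)
    have "degree (lobw * q) \<le> 2 + degree q"
      by (rule order_trans[OF degree_mult_le]) simp
    hence "degree (pderiv (lobw * q)) \<le> 1 + degree q"
      unfolding degree_pderiv by simp
    thus "degree (pderiv (lobw * q)) < n" using assms by linarith
  qed
  finally show ?thesis by (simp add: mult.left_commute)
qed

context
  fixes N :: nat
  assumes N: "1 \<le> N"
begin

text \<open>The Lobatto nodes other than \<open>-1\<close> and \<open>1\<close>.\<close>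

definition lob_interior :: "real set" where
  "lob_interior = {x. poly (pderiv (legendre N)) x = 0}"

lemma pderiv_legendre_nonzero: "pderiv (legendre N) \<noteq> 0"
  using N by (simp add: pderiv_eq_0_iff)

lemma lob_interior: "finite lob_interior" "card lob_interior = N - 1" "lob_interior \<subseteq> {-1<..<1}"
proof -
  interpret int: pos_functional "\<lambda>p. I (lobw * p)" by (rule interior_functional)
  show "finite lob_interior"
    unfolding lob_interior_def by (rule poly_roots_finite[OF pderiv_legendre_nonzero])
  have "degree (pderiv (legendre N)) = N - 1" by (simp add: degree_pderiv)
  from int.orthogonal_roots[OF pderiv_legendre_nonzero this legendre_deriv_orthogonal]
  show "card lob_interior = N - 1" "lob_interior \<subseteq> {-1<..<1}"
    unfolding lob_interior_def by auto
qed

lemma lgl_nodes_eq: "lgl_nodes N = insert (-1) (insert 1 lob_interior)"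
proof -
  have "1 - x^2 = 0 \<longleftrightarrow> x = 1 \<or> x = -1" for x :: real
    by (metis diff_eq_diff_eq diff_self power2_eq_1_iff right_minus_eq)
  thus ?thesis by (auto simp: lgl_nodes_def lob_interior_def)
qed

lemma lgl_nodes: "finite (lgl_nodes N)" "card (lgl_nodes N) = Suc N" "lgl_nodes N \<subseteq> {-1..1}"
proof -
  have "(1::real) \<notin> lob_interior" "(-1::real) \<notin> insert 1 lob_interior" using lob_interior(3) by auto
  thus "finite (lgl_nodes N)" "card (lgl_nodes N) = Suc N" "lgl_nodes N \<subseteq> {-1..1}"
    using lob_interior N unfolding lgl_nodes_eq by (auto simp: card_insert_disjoint)
qed

lemma lgl_nodes_nonempty: "lgl_nodes N \<noteq> {}"
  using lgl_nodes_eq by blast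

lemma lgl_exact:
  assumes "degree p < 2 * N"
  shows "quad (lgl_nodes N) (poly p) = I p"
proof (rule quad_exact[where V = "lobw * pderiv (legendre N)" and k = "N - 1"])
  show "degree (lobw * pderiv (legendre N)) = card (lgl_nodes N)"
    using pderiv_legendre_nonzero N
    by (subst degree_mult_eq) (auto simp: degree_pderiv lgl_nodes)
  show "poly (lobw * pderiv (legendre N)) x = 0" if "x \<in> lgl_nodes N" for x
    using that by (auto simp: lgl_nodes_eq lob_interior_def)
  show "I (lobw * pderiv (legendre N) * q) = 0" if "degree q < N - 1" for q
    using legendre_deriv_orthogonal[OF that] by (simp only: mult.assoc)
qed (use assms N lgl_nodes lgl_nodes_nonempty pderiv_legendre_nonzero in auto)

text \<open>The weight of \<open>x\<close> is positive if some polynomial within the degree of exactness is nonnegative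
  and vanishes at all the other nodes.\<close>

lemma lgl_weight_pos_aux:
  assumes x: "x \<in> lgl_nodes N" and p: "degree p < 2 * N" "p \<noteq> 0"
    and nonneg: "\<And>z. z \<in> {-1<..<1} \<Longrightarrow> 0 \<le> poly p z" and px: "0 \<le> poly p x"
    and zero: "\<And>y. y \<in> lgl_nodes N \<Longrightarrow> y \<noteq> x \<Longrightarrow> poly p y = 0"
  shows "0 < I (lagrange (lgl_nodes N) x)"
proof -
  have "0 < I p" using p nonneg by (intro I_pos)
  also have "I p = quad (lgl_nodes N) (poly p)" using lgl_exact[OF p(1)] by simp
  also have "\<dots> = (\<Sum>y\<in>lgl_nodes N. if y = x then I (lagrange (lgl_nodes N) x) * poly p x else 0)"
    unfolding quad_def by (rule sum.cong) (use zero in auto)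
  also have "\<dots> = I (lagrange (lgl_nodes N) x) * poly p x" using lgl_nodes(1) x by simp
  finally show ?thesis using px by (simp add: zero_less_mult_iff)
qed

lemma lgl_weight_pos:
  assumes x: "x \<in> lgl_nodes N"
  shows "0 < I (lagrange (lgl_nodes N) x)"
proof -
  define r where "r Z = (\<Prod>z\<in>Z. [:- z, 1::real:])" for Z
  have dr: "degree (r Z) = card Z" for Z by (simp add: r_def degree_prod_linear)
  have r0: "finite Z \<Longrightarrow> r Z \<noteq> 0" for Z by (simp add: r_def)
  have rz: "finite Z \<Longrightarrow> poly (r Z) y = 0 \<longleftrightarrow> y \<in> Z" for Z y by (auto simp: r_def poly_prod)
  note int = lob_interior
  consider "x \<in> lob_interior" | "x = 1 \<or> x = -1" using x lgl_nodes_eq by blast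
  thus ?thesis
  proof cases
    case 1
    define p where "p = lobw * (r (lob_interior - {x}))\<^sup>2"
    have pv: "poly p z = ((1 - z) * (1 + z)) * (poly (r (lob_interior - {x})) z)\<^sup>2" for z
      by (simp add: p_def algebra_simps)
    have x1: "x \<in> {-1<..<1}" using 1 int by auto
    have cd: "card (lob_interior - {x}) = N - 2" and N2: "2 \<le> N"
    proof -
      show "card (lob_interior - {x}) = N - 2" using 1 int by simp
      have "card lob_interior > 0" using 1 int(1) by (metis card_gt_0_iff empty_iff)
      thus "2 \<le> N" using int by simp
    qed
    show ?thesis
    proof (rule lgl_weight_pos_aux[OF x])
      have "degree p \<le> 2 + (N - 2) * 2"
        unfolding p_def using dr cd
        by (intro order_trans[OF degree_mult_le] add_mono order_trans[OF degree_power_le]) auto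
      thus "degree p < 2 * N" using N2 by linarith
      show "p \<noteq> 0" unfolding p_def mult_eq_0_iff using r0 int by simp
      show "0 \<le> poly p z" if "z \<in> {-1<..<1}" for z using that by (simp add: pv)
      show "0 \<le> poly p x" using x1 by (simp add: pv)
      show "poly p y = 0" if "y \<in> lgl_nodes N" "y \<noteq> x" for y
        using that rz[of "lob_interior - {x}"] int by (auto simp: lgl_nodes_eq pv)
    qed
  next
    case 2
    define p where "p = [:1, x:] * (r lob_interior)\<^sup>2"
    have pv: "poly p z = (1 + x * z) * (poly (r lob_interior) z)\<^sup>2" for z
      by (simp add: p_def algebra_simps)
    show ?thesis
    proof (rule lgl_weight_pos_aux[OF x])
      have "degree p \<le> 1 + (N - 1) * 2"
        unfolding p_def using dr int
        by (intro order_trans[OF degree_mult_le] add_mono order_trans[OF degree_power_le]) auto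
      thus "degree p < 2 * N" using N by linarith
      show "p \<noteq> 0" unfolding p_def mult_eq_0_iff using r0 int by simp
      show "0 \<le> poly p z" if "z \<in> {-1<..<1}" for z using that 2 by (auto simp: pv)
      show "0 \<le> poly p x" using 2 by (auto simp: pv)
      show "poly p y = 0" if "y \<in> lgl_nodes N" "y \<noteq> x" for y
        using that rz[of lob_interior] int 2 by (auto simp: lgl_nodes_eq pv)
    qed
  qed
qed

text \<open>The square of the Legendre polynomial has degree \<open>2 N\<close>, one more than the rule integrates
  exactly. Adding a multiple of \<open>(1 - x\<^sup>2) L'\<^sup>2\<close>, which vanishes at all nodes, cancels the leading
  term.\<close>

lemma quad_legendre_square:
  "quad (lgl_nodes N) (\<lambda>x. (poly (legendre N) x)\<^sup>2) = (2 + 1 / real N) * I (legendre N * legendre N)"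
proof -
  define L D where "L = legendre N" and "D = pderiv L"
  define l where "l = coeff L N"
  define p where "p = L * L + smult (1 / (real N)\<^sup>2) (lobw * D * D)"
  have dL: "degree L = N" by (simp add: L_def)
  have dD: "degree D = N - 1" by (simp add: D_def degree_pderiv dL)
  have dw: "degree (lobw * D) \<le> Suc N"
    by (rule order_trans[OF degree_mult_le]) (use N dD in auto)
  have le: "degree p \<le> 2 * N" unfolding p_def
  proof (rule degree_add_le)
    show "degree (L * L) \<le> 2 * N"
      by (rule order_trans[OF degree_mult_le]) (simp add: dL)
    show "degree (smult (1 / (real N)\<^sup>2) (lobw * D * D)) \<le> 2 * N"
      by (rule order_trans[OF degree_smult_le], rule order_trans[OF degree_mult_le])
        (use N dD dw in linarith)
  qed
  have cLL: "coeff (L * L) (2 * N) = l * l"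
    using coeff_mult_degree_sum[of L L] by (simp add: dL l_def mult_2)
  have cD: "coeff D (N - 1) = real N * l"
    using N by (simp add: D_def coeff_pderiv l_def)
  have cw: "coeff (lobw * D) (Suc N) = - (real N * l)"
    using N cD dD unfolding lobw_mult by (cases N) (auto simp: coeff_eq_0)
  have "coeff (lobw * D * D) (Suc N + (N - 1)) = coeff (lobw * D) (Suc N) * coeff D (N - 1)"
  proof -
    have dwe: "degree (lobw * D) = Suc N"
      using pderiv_legendre_nonzero N dD by (subst degree_mult_eq) (auto simp: D_def L_def)
    show ?thesis using coeff_mult_degree_sum[of "lobw * D" D] unfolding dwe dD .
  qed
  hence cwD: "coeff (lobw * D * D) (2 * N) = - ((real N)\<^sup>2 * (l * l))"
  proof -
    have "2 * N = Suc N + (N - 1)" using N by simp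
    thus ?thesis using \<open>coeff (lobw * D * D) (Suc N + (N - 1)) = _\<close> cw cD
      by (simp add: power2_eq_square mult_2)
  qed
  have "coeff p (2 * N) = 0"
    using N by (simp add: p_def cLL cwD)
  hence "degree p < 2 * N"
    using le N leading_coeff_0_iff[of p] by (cases "degree p = 2 * N") auto
  hence "I p = quad (lgl_nodes N) (poly p)" by (simp add: lgl_exact)
  also have "\<dots> = quad (lgl_nodes N) (\<lambda>x. (poly L x)\<^sup>2)"
    unfolding quad_def
  proof (rule sum.cong)
    fix x assume "x \<in> lgl_nodes N"
    hence "(1 - x * x) * poly D x = 0" by (auto simp: lgl_nodes_def D_def L_def power2_eq_square)
    moreover have "poly p x = (poly L x)\<^sup>2 + (1 / (real N)\<^sup>2) * ((1 - x * x) * poly D x) * poly D x"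
      by (simp add: p_def power2_eq_square algebra_simps)
    ultimately show "I (lagrange (lgl_nodes N) x) * poly p x = I (lagrange (lgl_nodes N) x) * (poly L x)\<^sup>2"
      by simp
  qed simp
  also have "I p = I (L * L) + (1 / (real N)\<^sup>2) * (real N * (real N + 1) * I (L * L))"
    unfolding p_def I_add I_smult D_def L_def legendre_deriv_energy ..
  also have "\<dots> = (2 + 1 / real N) * I (L * L)"
    using N by (simp add: field_simps power2_eq_square)
  finally show ?thesis by (simp add: L_def)
qed

text \<open>On polynomials of degree at most \<open>N\<close> the discrete and the continuous norm are equivalent;
  only the component along the Legendre polynomial of degree \<open>N\<close> is not integrated exactly.\<close>

lemma lgl_norm_equiv:
  assumes p: "degree p \<le> N"
  shows "I (p * p) \<le> quad (lgl_nodes N) (\<lambda>x. (poly p x)\<^sup>2)"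
    and "quad (lgl_nodes N) (\<lambda>x. (poly p x)\<^sup>2) \<le> 3 * I (p * p)"
proof -
  define L where "L = legendre N"
  define c where "c = coeff p N / coeff L N"
  define q where "q = p - smult c L"
  have lc: "coeff L N \<noteq> 0" unfolding L_def by (metis degree_legendre leading_coeff_0_iff legendre_nonzero)
  have "degree q \<le> N" unfolding q_def
    by (rule degree_diff_le) (use p degree_smult_le[of c L] in \<open>auto simp: L_def\<close>)
  moreover have "coeff q N = 0" using lc by (simp add: q_def c_def)
  ultimately have dq: "degree q < N"
    using N by (metis degree_0 le_neq_implies_less leading_coeff_0_iff less_le_trans zero_less_one)
  have pq: "p = q + smult c L" by (simp add: q_def)
  have LL: "0 < I (L * L)" by (rule I_pos) (auto simp: L_def)
  have qq: "0 \<le> I (q * q)"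
    by (cases "q = 0") (auto intro!: less_imp_le[OF I_pos])
  have Iqq: "quad (lgl_nodes N) (poly (q * q)) = I (q * q)"
    by (rule lgl_exact, rule le_less_trans[OF degree_mult_le]) (use dq in linarith)
  have Lq: "I (L * q) = 0" unfolding L_def by (rule legendre_orthogonal[OF dq])
  have IqL: "quad (lgl_nodes N) (poly (L * q)) = 0"
  proof (subst lgl_exact)
    show "degree (L * q) < 2 * N"
      by (rule le_less_trans[OF degree_mult_le]) (use dq in \<open>simp add: L_def\<close>)
  qed (rule Lq)
  have 1: "I (p * p) = I (q * q) + c\<^sup>2 * I (L * L)"
  proof -
    have "p * p = q * q + (smult (2 * c) (L * q) + smult (c\<^sup>2) (L * L))"
      unfolding pq by (rule poly_ext) (simp add: power2_eq_square algebra_simps)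
    thus ?thesis using Lq by (simp add: I_add I_smult)
  qed
  have "quad (lgl_nodes N) (\<lambda>x. (poly p x)\<^sup>2) =
      quad (lgl_nodes N) (\<lambda>x. poly (q * q) x + ((2 * c) * poly (L * q) x + c\<^sup>2 * (poly L x)\<^sup>2))"
    unfolding pq by (intro arg_cong[where f = "quad (lgl_nodes N)"] ext) (simp add: power2_eq_square algebra_simps)
  also have "\<dots> = I (q * q) + c\<^sup>2 * ((2 + 1 / real N) * I (L * L))"
    unfolding quad_add quad_cmult Iqq IqL using quad_legendre_square by (simp add: L_def)
  finally have 2: "quad (lgl_nodes N) (\<lambda>x. (poly p x)\<^sup>2) = I (q * q) + c\<^sup>2 * ((2 + 1 / real N) * I (L * L))" .
  have a: "1 * I (L * L) \<le> (2 + 1 / real N) * I (L * L)"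
    using LL N by (intro mult_right_mono) auto
  have b: "(2 + 1 / real N) * I (L * L) \<le> 3 * I (L * L)"
    using LL N by (intro mult_right_mono) (auto simp: field_simps)
  show "I (p * p) \<le> quad (lgl_nodes N) (\<lambda>x. (poly p x)\<^sup>2)"
    unfolding 1 2 using mult_left_mono[OF a, of "c\<^sup>2"] by simp
  show "quad (lgl_nodes N) (\<lambda>x. (poly p x)\<^sup>2) \<le> 3 * I (p * p)"
    unfolding 1 2 using mult_left_mono[OF b, of "c\<^sup>2"] qq by simp
qed

end

end

section \<open>The weakly singular weight\<close>

text \<open>The Abel kernel \<open>\<tau>\<^sup>\<beta>\<^sup>-\<^sup>1\<close>, extended by zero to \<open>\<tau> \<le> 0\<close>.\<close>

definition sing :: "real \<Rightarrow> real \<Rightarrow> real" where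
  "sing \<beta> \<tau> = (if 0 < \<tau> then \<tau> powr (\<beta> - 1) else 0)"

lemma sing_nonneg [simp]: "0 \<le> sing \<beta> \<tau>"
  by (simp add: sing_def)

lemma sing_measurable [measurable]: "sing \<beta> \<in> borel_measurable borel"
  unfolding sing_def by measurable

lemma sing_1: "0 < \<tau> \<Longrightarrow> sing 1 \<tau> = 1"
  by (simp add: sing_def)

lemma nn_integral_sing:
  assumes "0 < \<beta>" "0 \<le> c"
  shows "(\<integral>\<^sup>+\<tau>. ennreal (sing \<beta> \<tau>) * indicator {..c} \<tau> \<partial>lborel) = ennreal (c powr \<beta> / \<beta>)"
proof -
  define f where "f = (\<lambda>\<tau>. sing \<beta> \<tau> * indicator {..c} \<tau>)"
  have "((\<lambda>x. x powr (\<beta> - 1)) has_integral (c powr \<beta> / \<beta>)) {0..c}"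
    using has_integral_powr_from_0[of "\<beta> - 1" c] assms by simp
  hence "((\<lambda>x. if x \<in> {0..c} then x powr (\<beta> - 1) else 0) has_integral (c powr \<beta> / \<beta>)) UNIV"
    by (simp only: has_integral_restrict_UNIV)
  also have "(\<lambda>x. if x \<in> {0..c} then x powr (\<beta> - 1) else 0) = f"
    by (auto simp: f_def sing_def fun_eq_iff indicator_def)
  finally have "integral\<^sup>N lborel f = ennreal (c powr \<beta> / \<beta>)"
    by (intro nn_integral_has_integral_lborel) (auto simp: f_def)
  also have "integral\<^sup>N lborel f = (\<integral>\<^sup>+\<tau>. ennreal (sing \<beta> \<tau>) * indicator {..c} \<tau> \<partial>lborel)"
    by (intro nn_integral_cong) (auto simp: f_def indicator_def)
  finally show ?thesis .
qed

lemma nn_integral_sing_reflect: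
  assumes "0 < \<beta>" "-1 \<le> t"
  shows "(\<integral>\<^sup>+s. ennreal (sing \<beta> (t - s)) * indicator {-1..} s \<partial>lborel) = ennreal ((t + 1) powr \<beta> / \<beta>)"
proof -
  have "(\<integral>\<^sup>+\<tau>. ennreal (sing \<beta> \<tau>) * indicator {..t + 1} \<tau> \<partial>lborel) =
      (\<integral>\<^sup>+s. ennreal (sing \<beta> (t + (-1) * s)) * indicator {..t + 1} (t + (-1) * s) \<partial>lborel)"
    by (subst nn_integral_real_affine[where c = "-1" and t = t]) auto
  also have "\<dots> = (\<integral>\<^sup>+s. ennreal (sing \<beta> (t - s)) * indicator {-1..} s \<partial>lborel)"
    by (intro nn_integral_cong) (auto simp: indicator_def)
  finally show ?thesis using nn_integral_sing[of \<beta> "t + 1"] assms by simp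
qed

lemma nn_integral_sing_shift:
  assumes "0 < \<beta>" "s \<le> 1"
  shows "(\<integral>\<^sup>+t. ennreal (sing \<beta> (t - s)) * indicator {..1} t \<partial>lborel) = ennreal ((1 - s) powr \<beta> / \<beta>)"
proof -
  have "(\<integral>\<^sup>+\<tau>. ennreal (sing \<beta> \<tau>) * indicator {..1 - s} \<tau> \<partial>lborel) =
      (\<integral>\<^sup>+t. ennreal (sing \<beta> (- s + 1 * t)) * indicator {..1 - s} (- s + 1 * t) \<partial>lborel)"
    by (subst nn_integral_real_affine[where c = 1 and t = "- s"]) auto
  also have "\<dots> = (\<integral>\<^sup>+t. ennreal (sing \<beta> (t - s)) * indicator {..1} t \<partial>lborel)"
    by (intro nn_integral_cong) (auto simp: indicator_def)
  finally show ?thesis using nn_integral_sing[of \<beta> "1 - s"] assms by simp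
qed

text \<open>The weight \<open>(1 - x)\<^sup>\<beta>\<^sup>-\<^sup>1\<close> on the open reference interval.\<close>

definition jw :: "real \<Rightarrow> real \<Rightarrow> real" where
  "jw \<beta> x = indicator {-1<..<1} x * sing \<beta> (1 - x)"

lemma jw_nonneg [simp]: "0 \<le> jw \<beta> x"
  by (simp add: jw_def)

lemma jw_measurable [measurable]: "jw \<beta> \<in> borel_measurable borel"
  unfolding jw_def by measurable

lemma jw_outside: "x \<notin> {-1<..<1} \<Longrightarrow> jw \<beta> x = 0"
  by (simp add: jw_def)

lemma jw_pos: "x \<in> {-1<..<1} \<Longrightarrow> 0 < jw \<beta> x"
  by (simp add: jw_def sing_def)

lemma nn_integral_jw_finite:
  assumes "0 < \<beta>"
  shows "(\<integral>\<^sup>+x. ennreal (jw \<beta> x) \<partial>lborel) < \<infinity>"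
proof -
  have "(\<integral>\<^sup>+x. ennreal (jw \<beta> x) \<partial>lborel) \<le> (\<integral>\<^sup>+s. ennreal (sing \<beta> (1 - s)) * indicator {-1..} s \<partial>lborel)"
    by (intro nn_integral_mono) (auto simp: jw_def indicator_def)
  also have "\<dots> < \<infinity>" using assms by (subst nn_integral_sing_reflect) auto
  finally show ?thesis .
qed

lemma jw_integrable:
  assumes "0 < \<beta>" and [measurable]: "g \<in> borel_measurable borel"
    and g: "\<And>x. x \<in> {-1<..<1} \<Longrightarrow> \<bar>g x\<bar> \<le> C"
  shows "integrable lborel (\<lambda>x. jw \<beta> x * g x)"
proof (rule Bochner_Integration.integrable_bound)
  have "integrable lborel (jw \<beta>)"
    using nn_integral_jw_finite[OF assms(1)] by (intro integrableI_bounded) auto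
  thus "integrable lborel (\<lambda>x. C * jw \<beta> x)" by simp
  show "AE x in lborel. norm (jw \<beta> x * g x) \<le> norm (C * jw \<beta> x)"
  proof (intro AE_I2)
    fix x
    show "norm (jw \<beta> x * g x) \<le> norm (C * jw \<beta> x)"
    proof (cases "x \<in> {-1<..<1}")
      case True
      have "\<bar>g x\<bar> \<le> \<bar>C\<bar>" using g[OF True] by linarith
      thus ?thesis by (simp add: abs_mult mult.commute mult_right_mono)
    qed (simp add: jw_outside)
  qed
qed measurable

lemma poly_bounded_on_reference: "\<exists>C. \<forall>x\<in>{-1<..<1::real}. \<bar>poly p x\<bar> \<le> C"
proof -
  have "compact {-1..1::real}" "continuous_on {-1..1} (poly p)" by (auto intro: continuous_intros)
  then obtain C where "\<And>x. x \<in> {-1..1} \<Longrightarrow> norm (poly p x) \<le> C"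
    using continuous_on_compact_bound by blast
  thus ?thesis by (intro exI[of _ C]) auto
qed

lemma poly_borel_measurable [measurable]: "poly (p :: real poly) \<in> borel_measurable borel"
  by (intro borel_measurable_continuous_onI continuous_intros)

lemma jw_poly_integrable:
  assumes "0 < \<beta>" shows "integrable lborel (\<lambda>x. jw \<beta> x * poly p x)"
proof -
  obtain C where "\<forall>x\<in>{-1<..<1}. \<bar>poly p x\<bar> \<le> C" using poly_bounded_on_reference by blast
  thus ?thesis by (intro jw_integrable[OF assms, of _ C]) auto
qed

text \<open>Integration of polynomials against \<open>(1 - x)\<^bsup>\<beta>-1\<^esup>\<close>; for \<open>\<beta> = 1\<close> the plain integral.\<close>

definition wint :: "real \<Rightarrow> real poly \<Rightarrow> real" where
  "wint \<beta> p = (\<integral>x. jw \<beta> x * poly p x \<partial>lborel)"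

lemma nn_integral_wint:
  assumes "0 < \<beta>" "\<And>x. x \<in> {-1<..<1} \<Longrightarrow> 0 \<le> poly p x"
  shows "(\<integral>\<^sup>+x. ennreal (jw \<beta> x * poly p x) \<partial>lborel) = ennreal (wint \<beta> p)"
  unfolding wint_def
proof (intro nn_integral_eq_integral jw_poly_integrable assms AE_I2)
  fix x show "0 \<le> jw \<beta> x * poly p x"
    using assms(2)[of x] by (cases "x \<in> {-1<..<1}") (auto simp: jw_outside)
qed

lemma pos_functional_wint:
  assumes "0 < \<beta>" shows "pos_functional (wint \<beta>)"
proof
  note int = jw_poly_integrable[OF assms]
  fix p q :: "real poly" and c :: real
  show "wint \<beta> (p + q) = wint \<beta> p + wint \<beta> q"
    using Bochner_Integration.integral_add[OF int[of p] int[of q]] by (simp add: wint_def algebra_simps)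
  show "wint \<beta> (smult c p) = c * wint \<beta> p"
    by (simp add: wint_def mult.left_commute[of _ c])
  assume p: "p \<noteq> 0" "\<And>x. x \<in> {-1<..<1} \<Longrightarrow> 0 \<le> poly p x"
  have nn: "0 \<le> jw \<beta> x * poly p x" for x
    using p(2)[of x] by (cases "x \<in> {-1<..<1}") (auto simp: jw_outside)
  have "wint \<beta> p \<noteq> 0"
  proof
    assume "wint \<beta> p = 0"
    hence "AE x in lborel. jw \<beta> x * poly p x = 0"
      using integral_nonneg_eq_0_iff_AE[OF int[of p]] nn by (auto simp: wint_def)
    moreover have "AE x in lborel. x \<notin> {x. poly p x = 0}"
      using poly_roots_finite[OF p(1)]
      by (intro AE_not_in finite_imp_null_set_lborel)
    ultimately have "AE x in lborel. x \<notin> {-1<..<1::real}"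
    proof eventually_elim
      case (elim x)
      thus ?case using jw_pos[of x \<beta>] by auto
    qed
    hence "{-1<..<1::real} \<in> null_sets lborel"
      by (subst (asm) AE_iff_null_sets[symmetric]) auto
    thus False by (simp add: null_sets_def)
  qed
  moreover have "0 \<le> wint \<beta> p" unfolding wint_def using nn by (intro Bochner_Integration.integral_nonneg)
  ultimately show "0 < wint \<beta> p" by simp
qed

lemma wint_1: "wint 1 p = (\<integral>x. indicator {-1<..<1} x * poly p x \<partial>lborel)"
  unfolding wint_def by (intro Bochner_Integration.integral_cong) (auto simp: jw_def indicator_def sing_1)

lemma AE_not_endpoints: "AE x in lborel. x \<noteq> -1 \<and> x \<noteq> (1::real)"
proof -
  have "{-1, 1::real} \<in> null_sets lborel" by (intro finite_imp_null_set_lborel) auto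
  from AE_not_in[OF this] show ?thesis by auto
qed

lemma unit_weight_functional_wint: "unit_weight_functional (wint 1)"
proof -
  interpret pos_functional "wint 1" by (rule pos_functional_wint) simp
  show ?thesis
  proof
    fix p :: "real poly"
    have "has_bochner_integral lborel (\<lambda>x. poly (pderiv p) x * indicator {-1..1} x) (poly p 1 - poly p (-1))"
      by (rule has_bochner_integral_FTC_Icc_real) (auto intro!: derivative_eq_intros continuous_intros)
    hence "(\<integral>x. poly (pderiv p) x * indicator {-1..1} x \<partial>lborel) = poly p 1 - poly p (-1)"
      by (rule has_bochner_integral_integral_eq)
    also have "(\<integral>x. poly (pderiv p) x * indicator {-1..1} x \<partial>lborel) = wint 1 (pderiv p)"
      unfolding wint_1
    proof (rule integral_cong_AE)
      show "AE x in lborel. poly (pderiv p) x * indicator {-1..1} x = indicator {-1<..<1} x * poly (pderiv p) x"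
        using AE_not_endpoints by eventually_elim (auto simp: indicator_def)
    qed auto
    finally show "wint 1 (pderiv p) = poly p 1 - poly p (-1)" by simp
  qed
qed

interpretation leg: unit_weight_functional "wint 1"
  by (rule unit_weight_functional_wint)

section \<open>A uniform bound for singular Gauss sums\<close>

text \<open>The inverse square root as a mixture of the resolvents \<open>1 / (y + v\<^sup>2)\<close>.\<close>

lemma nn_integral_inverse_sqrt:
  assumes "0 < y"
  shows "(\<integral>\<^sup>+v. ennreal (1 / (y + v\<^sup>2)) * indicator {0..} v \<partial>lborel) = ennreal (pi / 2 * y powr (-1/2))"
proof -
  define r where "r = sqrt y"
  have r: "r > 0" "r\<^sup>2 = y" using assms by (auto simp: r_def)
  have "(\<integral>\<^sup>+v. ennreal (1 / (y + v\<^sup>2)) * indicator {0..} v \<partial>lborel) =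
      ennreal (pi / 2 / r - arctan (0 / r) / r)"
  proof (rule nn_integral_FTC_atLeast)
    fix v :: real
    have "y + v\<^sup>2 = r * r * (1 + (v / r)\<^sup>2)"
      using r assms by (simp add: field_simps power2_eq_square)
    hence "1 / (y + v\<^sup>2) = inverse (1 + (v / r)\<^sup>2) * (1 / r) / r"
      by (simp add: divide_inverse mult_ac)
    thus "((\<lambda>v. arctan (v / r) / r) has_real_derivative 1 / (y + v\<^sup>2)) (at v)"
      using r by (auto intro!: derivative_eq_intros)
    show "0 \<le> 1 / (y + v\<^sup>2)" using assms by simp
  next
    have "filterlim (\<lambda>v. v / r) at_top at_top"
      using r by real_asymp
    hence "((\<lambda>v. arctan (v / r)) \<longlongrightarrow> pi / 2) at_top"
      by (rule filterlim_compose[OF tendsto_arctan_at_top])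
    thus "((\<lambda>v. arctan (v / r) / r) \<longlongrightarrow> pi / 2 / r) at_top"
      using r by (intro tendsto_divide) auto
  qed auto
  also have "y powr (-1/2) = 1 / r"
    using assms powr_minus_divide[of y "1/2"] by (simp add: r_def powr_half_sqrt)
  hence "pi / 2 / r - arctan (0 / r) / r = pi / 2 * y powr (-1/2)" by simp
  finally show ?thesis by simp
qed

text \<open>The integral of \<open>(1 + x)\<^bsup>-1/2\<^esup>\<close> against the weight, which is the constant of the Hardy-type
  inequalities below.\<close>

definition hardy_const :: "real \<Rightarrow> ennreal" where
  "hardy_const \<beta> = (\<integral>\<^sup>+x. ennreal (jw \<beta> x * (1 + x) powr (-1/2)) \<partial>lborel)"

lemma hardy_const_finite:
  assumes "0 < \<beta>" "\<beta> \<le> 1"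
  shows "hardy_const \<beta> < \<infinity>"
proof -
  have "hardy_const \<beta> \<le> (\<integral>\<^sup>+x. ennreal (sing \<beta> (1 - x)) * indicator {-1..} x +
      ennreal (sing (1/2) (x - (-1))) * indicator {..1} x \<partial>lborel)"
    unfolding hardy_const_def
  proof (rule nn_integral_mono)
    fix x :: real
    show "ennreal (jw \<beta> x * (1 + x) powr (-1/2)) \<le> ennreal (sing \<beta> (1 - x)) * indicator {-1..} x +
      ennreal (sing (1/2) (x - (-1))) * indicator {..1} x"
    proof (cases "x \<in> {-1<..<1}")
      case True
      have "(1 - x) powr (\<beta> - 1) * (1 + x) powr (-1/2) \<le> (1 - x) powr (\<beta> - 1) + (1 + x) powr (-1/2)"
      proof (cases "0 \<le> x")
        case T: True
        hence "(1 + x) powr (-1/2) \<le> (1 + x) powr 0" by (intro powr_mono) auto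
        hence "(1 + x) powr (-1/2) \<le> 1" using T by simp
        hence "(1 - x) powr (\<beta> - 1) * (1 + x) powr (-1/2) \<le> (1 - x) powr (\<beta> - 1) * 1"
          by (intro mult_left_mono) auto
        thus ?thesis by (simp add: add_increasing2)
      next
        case False
        hence "(1 - x) powr (\<beta> - 1) \<le> (1 - x) powr 0" using assms by (intro powr_mono) auto
        hence "(1 - x) powr (\<beta> - 1) \<le> 1" using False by simp
        hence "(1 - x) powr (\<beta> - 1) * (1 + x) powr (-1/2) \<le> 1 * (1 + x) powr (-1/2)"
          by (intro mult_right_mono) auto
        thus ?thesis by (simp add: add_increasing)
      qed
      thus ?thesis using True
        by (auto simp: jw_def sing_def add.commute ennreal_plus[symmetric] simp del: ennreal_plus intro!: ennreal_leI)
    qed (simp add: jw_outside)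
  qed
  also have "\<dots> = ennreal ((1 + 1) powr \<beta> / \<beta>) + ennreal ((1 - (-1)) powr (1/2) / (1/2))"
    using assms nn_integral_sing_reflect[of \<beta> 1] nn_integral_sing_shift[of "1/2" "-1"]
    by (subst nn_integral_add) auto
  also have "\<dots> < \<infinity>" by (simp del: ennreal_plus add: ennreal_plus[symmetric])
  finally show ?thesis .
qed

text \<open>The Gauss rule underestimates the integral of \<open>1 / (x + c)\<close>: the polynomial
  \<open>(1 - P(x)\<^sup>2 / P(-c)\<^sup>2) / (x + c)\<close> agrees with this function at the nodes, lies below it, and is
  integrated exactly.\<close>

lemma gauss_sum_resolvent:
  assumes \<beta>: "0 < \<beta>" and P: "P \<noteq> 0" "degree P = Suc n"
    and orth: "\<And>q. degree q < Suc n \<Longrightarrow> wint \<beta> (P * q) = 0"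
    and c: "1 \<le> c"
  defines "X \<equiv> {x. poly P x = 0}"
  shows "(\<Sum>x\<in>X. ennreal (wint \<beta> (lagrange X x) * (1 / (x + c)))) \<le>
    (\<integral>\<^sup>+x. ennreal (jw \<beta> x * (1 / (x + c))) \<partial>lborel)"
proof -
  interpret pos_functional "wint \<beta>" by (rule pos_functional_wint[OF \<beta>])
  have gauss: "X \<subseteq> {-1<..<1}" "\<And>p. degree p < 2 * Suc n \<Longrightarrow> quad X (poly p) = wint \<beta> p"
    "\<And>x. x \<in> X \<Longrightarrow> 0 < wint \<beta> (lagrange X x)"
    using gauss_quad[OF P] orth unfolding X_def by blast+
  have root: "x > -1" "x < 1" if "x \<in> X" for x using gauss(1) that by auto
  have Pc: "poly P (-c) \<noteq> 0" using root[of "-c"] c by (auto simp: X_def)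
  define S where "S = [:1:] - smult (1 / (poly P (-c))\<^sup>2) (P\<^sup>2)"
  have "poly S (-c) = 0" using Pc by (simp add: S_def)
  then obtain R where R: "S = [:c, 1:] * R" by (metis dvdE minus_minus poly_eq_0_iff_dvd)
  have Rv: "poly R x = (1 - (poly P x / poly P (-c))\<^sup>2) * (1 / (x + c))" if "x > -1" for x
  proof -
    have "(x + c) * poly R x = poly S x" unfolding R by (simp add: algebra_simps)
    also have "\<dots> = 1 - (poly P x / poly P (-c))\<^sup>2" by (simp add: S_def power_divide)
    finally show ?thesis using that c by (simp add: field_simps)
  qed
  have "degree R < 2 * Suc n"
  proof (cases "R = 0")
    case False
    have "degree S \<le> 2 * Suc n" unfolding S_def
      using degree_power_le[of P 2] P(2)
      by (intro degree_diff_le order_trans[OF degree_smult_le]) auto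
    moreover have "degree S = Suc (degree R)" unfolding R using False by (subst degree_mult_eq) auto
    ultimately show ?thesis by simp
  qed simp
  hence "wint \<beta> R = quad X (poly R)" using gauss(2) by simp
  also have "\<dots> = (\<Sum>x\<in>X. wint \<beta> (lagrange X x) * (1 / (x + c)))"
    unfolding quad_def by (rule sum.cong) (use Rv root in \<open>auto simp: X_def\<close>)
  finally have eq: "(\<Sum>x\<in>X. wint \<beta> (lagrange X x) * (1 / (x + c))) = wint \<beta> R" by simp
  have "(\<Sum>x\<in>X. ennreal (wint \<beta> (lagrange X x) * (1 / (x + c)))) =
      ennreal (\<Sum>x\<in>X. wint \<beta> (lagrange X x) * (1 / (x + c)))"
  proof (rule sum_ennreal)
    fix x assume "x \<in> X"
    thus "0 \<le> wint \<beta> (lagrange X x) * (1 / (x + c))"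
      using gauss(3)[of x] root[of x] c by auto
  qed
  also have "\<dots> = ennreal (\<integral>x. jw \<beta> x * poly R x \<partial>lborel)" unfolding eq by (simp add: wint_def)
  also have "\<dots> \<le> (\<integral>\<^sup>+x. ennreal (jw \<beta> x * poly R x) \<partial>lborel)"
  proof -
    have "(\<integral>x. jw \<beta> x * poly R x \<partial>lborel) \<le> (\<integral>x. max 0 (jw \<beta> x * poly R x) \<partial>lborel)"
      by (intro integral_mono jw_poly_integrable \<beta> Bochner_Integration.integrable_max) auto
    also have "ennreal \<dots> = (\<integral>\<^sup>+x. ennreal (max 0 (jw \<beta> x * poly R x)) \<partial>lborel)"
      by (intro nn_integral_eq_integral[symmetric] jw_poly_integrable \<beta> Bochner_Integration.integrable_max) auto
    also have "\<dots> = (\<integral>\<^sup>+x. ennreal (jw \<beta> x * poly R x) \<partial>lborel)"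
      by (intro nn_integral_cong) (auto simp: max_def ennreal_neg)
    finally show ?thesis using ennreal_leI by auto
  qed
  also have "\<dots> \<le> (\<integral>\<^sup>+x. ennreal (jw \<beta> x * (1 / (x + c))) \<partial>lborel)"
  proof (intro nn_integral_mono ennreal_leI)
    fix x
    show "jw \<beta> x * poly R x \<le> jw \<beta> x * (1 / (x + c))"
    proof (cases "x \<in> {-1<..<1}")
      case True
      have "(1 - (poly P x / poly P (-c))\<^sup>2) * (1 / (x + c)) \<le> 1 * (1 / (x + c))"
        using True c by (intro mult_right_mono) auto
      thus ?thesis using Rv[of x] True by (intro mult_left_mono) auto
    qed (simp add: jw_outside)
  qed
  finally show ?thesis .
qed

lemma gauss_sum_inverse_sqrt:
  assumes \<beta>: "0 < \<beta>" and P: "P \<noteq> 0" "degree P = Suc n"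
    and orth: "\<And>q. degree q < Suc n \<Longrightarrow> wint \<beta> (P * q) = 0"
  defines "X \<equiv> {x. poly P x = 0}"
  shows "(\<Sum>x\<in>X. ennreal (wint \<beta> (lagrange X x) * (1 + x) powr (-1/2))) \<le> hardy_const \<beta>"
proof -
  interpret pos_functional "wint \<beta>" by (rule pos_functional_wint[OF \<beta>])
  have gauss: "X \<subseteq> {-1<..<1}" "\<And>x. x \<in> X \<Longrightarrow> 0 < wint \<beta> (lagrange X x)"
    using gauss_quad[OF P] orth unfolding X_def by blast+
  have root: "x > -1" "x < 1" if "x \<in> X" for x using gauss(1) that by auto
  have root': "0 < 1 + x" if "x \<in> X" for x using root(1)[OF that] by simp
  define w where "w x = wint \<beta> (lagrange X x)" for x
  have w: "0 < w x" if "x \<in> X" for x using gauss(2)[OF that] by (simp add: w_def)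
  have "ennreal (pi / 2) * (\<Sum>x\<in>X. ennreal (w x * (1 + x) powr (-1/2))) =
      (\<Sum>x\<in>X. ennreal (w x) * ennreal (pi / 2 * (1 + x) powr (-1/2)))"
    unfolding sum_distrib_left
    by (rule sum.cong) (use w in \<open>auto simp: ennreal_mult'[symmetric] less_imp_le mult_ac\<close>)
  also have "\<dots> = (\<Sum>x\<in>X. ennreal (w x) * (\<integral>\<^sup>+v. ennreal (1 / (1 + x + v\<^sup>2)) * indicator {0..} v \<partial>lborel))"
    by (intro sum.cong refl, subst nn_integral_inverse_sqrt) (use root' in auto)
  also have "\<dots> = (\<integral>\<^sup>+v. (\<Sum>x\<in>X. ennreal (w x) * (ennreal (1 / (1 + x + v\<^sup>2)) * indicator {0..} v)) \<partial>lborel)"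
    by (subst nn_integral_sum) (auto simp: nn_integral_cmult)
  also have "\<dots> = (\<integral>\<^sup>+v. (\<Sum>x\<in>X. ennreal (w x * (1 / (x + (1 + v\<^sup>2))))) * indicator {0..} v \<partial>lborel)"
    unfolding sum_distrib_right
    by (intro nn_integral_cong sum.cong refl)
      (use w in \<open>auto simp: ennreal_mult'[symmetric] less_imp_le indicator_def add_ac\<close>)
  also have "\<dots> \<le> (\<integral>\<^sup>+v. (\<integral>\<^sup>+x. ennreal (jw \<beta> x * (1 / (x + (1 + v\<^sup>2)))) \<partial>lborel) * indicator {0..} v \<partial>lborel)"
    unfolding w_def X_def
    by (intro nn_integral_mono mult_right_mono gauss_sum_resolvent[OF \<beta> P orth]) auto
  also have "\<dots> = (\<integral>\<^sup>+v. (\<integral>\<^sup>+x. ennreal (jw \<beta> x) * (ennreal (1 / (1 + x + v\<^sup>2)) * indicator {0..} v) \<partial>lborel) \<partial>lborel)"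
    by (subst nn_integral_multc[symmetric], measurable)
      (auto intro!: nn_integral_cong simp: ennreal_mult'[symmetric] indicator_def add_ac)
  also have "\<dots> = (\<integral>\<^sup>+x. (\<integral>\<^sup>+v. ennreal (jw \<beta> x) * (ennreal (1 / (1 + x + v\<^sup>2)) * indicator {0..} v) \<partial>lborel) \<partial>lborel)"
    by (rule lborel_pair.Fubini') measurable
  also have "\<dots> = (\<integral>\<^sup>+x. ennreal (pi / 2) * ennreal (jw \<beta> x * (1 + x) powr (-1/2)) \<partial>lborel)"
  proof (rule nn_integral_cong)
    fix x :: real
    show "(\<integral>\<^sup>+v. ennreal (jw \<beta> x) * (ennreal (1 / (1 + x + v\<^sup>2)) * indicator {0..} v) \<partial>lborel) =
      ennreal (pi / 2) * ennreal (jw \<beta> x * (1 + x) powr (-1/2))"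
    proof (cases "x \<in> {-1<..<1}")
      case True
      thus ?thesis
        by (subst nn_integral_cmult, measurable, subst nn_integral_inverse_sqrt)
          (auto simp: ennreal_mult'[symmetric] mult_ac)
    qed (simp add: jw_outside)
  qed
  also have "\<dots> = ennreal (pi / 2) * hardy_const \<beta>"
    unfolding hardy_const_def by (rule nn_integral_cmult) measurable
  finally have "ennreal (pi / 2) * (\<Sum>x\<in>X. ennreal (w x * (1 + x) powr (-1/2))) \<le> ennreal (pi / 2) * hardy_const \<beta>" .
  thus ?thesis unfolding w_def
    by (subst (asm) ennreal_mult_le_mult_iff) auto
qed

section \<open>Hardy-type inequalities at the Lobatto nodes\<close>

text \<open>The weights of the Lobatto rule.\<close>

abbreviation lw :: "nat \<Rightarrow> real \<Rightarrow> real" where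
  "lw N t \<equiv> wint 1 (lagrange (lgl_nodes N) t)"

text \<open>The linear polynomial is \<open>t \<mapsto> \<mu>(t,\<theta>)\<close>.\<close>

lemma wint_mu:
  assumes \<theta>: "-1 < \<theta>" "\<theta> \<le> 1"
  shows "wint 1 (pcompose (p * p) [:(\<theta> - 1) / 2, (\<theta> + 1) / 2:]) \<le> 2 / (1 + \<theta>) * wint 1 (p * p)"
proof -
  define k c where "k = (\<theta> + 1) / 2" and "c = (\<theta> - 1) / 2"
  have k: "0 < k" using \<theta> by (simp add: k_def)
  have ck: "c - k = -1" "c + k = \<theta>" by (simp_all add: c_def k_def field_simps)
  define q where "q = p * p"
  define h where "h = (\<lambda>s. indicator {-1<..<\<theta>} s * poly q s)"
  have qn: "0 \<le> poly q s" for s by (simp add: q_def)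
  have "integral\<^sup>L lborel h = \<bar>k\<bar> *\<^sub>R (\<integral>x. h (c + k * x) \<partial>lborel)"
    by (rule lborel_integral_real_affine) (use k in auto)
  also have "(\<integral>x. h (c + k * x) \<partial>lborel) = wint 1 (pcompose q [:c, k:])"
    unfolding wint_1
  proof (rule Bochner_Integration.integral_cong)
    fix x :: real
    have "-1 < c + k * x \<longleftrightarrow> -1 < x"
    proof -
      have "c + k * x = -1 + k * (x + 1)" using ck by (simp add: algebra_simps)
      hence "-1 < c + k * x \<longleftrightarrow> 0 < x + 1" using k by (simp add: zero_less_mult_iff)
      thus ?thesis by linarith
    qed
    moreover have "c + k * x < \<theta> \<longleftrightarrow> x < 1"
    proof -
      have "c + k * x = \<theta> + k * (x - 1)" using ck by (simp add: algebra_simps)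
      thus ?thesis using k by (simp add: mult_less_0_iff)
    qed
    ultimately show "h (c + k * x) = indicator {-1<..<1} x * poly (pcompose q [:c, k:]) x"
      by (auto simp: h_def indicator_def poly_pcompose mult.commute)
  qed simp
  finally have "k * wint 1 (pcompose q [:c, k:]) = integral\<^sup>L lborel h" using k by simp
  also have "\<dots> \<le> wint 1 q" unfolding wint_1
  proof (rule integral_mono)
    have I: "integrable lborel (\<lambda>x. indicator {-1<..<1} x * poly q x)"
      using jw_poly_integrable[of 1 q]
      by (rule Bochner_Integration.integrable_cong[THEN iffD1, rotated -1])
        (auto simp: jw_def indicator_def sing_1)
    thus "integrable lborel (\<lambda>x. indicator {-1<..<1} x * poly q x)" .
    show "integrable lborel h"
      by (rule Bochner_Integration.integrable_bound[OF I])
        (use \<theta> in \<open>auto simp: h_def indicator_def\<close>)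
    show "h x \<le> indicator {-1<..<1} x * poly q x" for x
      using \<theta> qn by (auto simp: h_def indicator_def)
  qed
  finally have "wint 1 (pcompose q [:c, k:]) \<le> wint 1 q / k" using k by (simp add: field_simps)
  also have "\<dots> = 2 / (1 + \<theta>) * wint 1 q" by (simp add: k_def add.commute)
  finally show ?thesis by (simp add: q_def c_def k_def)
qed

lemma lgl_mu_bound:
  assumes "1 \<le> N" "degree p \<le> N" and x: "-1 < x" "x \<le> 1"
  shows "(\<Sum>t\<in>lgl_nodes N. lw N t * (poly p (mu t x))\<^sup>2) \<le> 6 / (1 + x) * wint 1 (p * p)"
proof -
  define m where "m = [:(x - 1) / 2, (x + 1) / 2:]"
  have m: "poly (pcompose p m) t = poly p (mu t x)" for t
    by (simp add: poly_pcompose m_def mu_def field_simps)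
  have "degree m \<le> 1" by (simp add: m_def)
  hence "degree p * degree m \<le> N * 1" by (intro mult_mono assms) auto
  hence "degree (pcompose p m) \<le> N"
    using degree_pcompose_le[of p m] by simp
  hence "leg.quad (lgl_nodes N) (\<lambda>t. (poly (pcompose p m) t)\<^sup>2) \<le> 3 * wint 1 (pcompose p m * pcompose p m)"
    using leg.lgl_norm_equiv(2)[OF assms(1)] by blast
  also have "wint 1 (pcompose p m * pcompose p m) \<le> 2 / (1 + x) * wint 1 (p * p)"
    using wint_mu[OF x, of p] by (simp add: pcompose_mult m_def)
  finally show ?thesis by (simp add: leg.quad_def m)
qed

text \<open>A discrete Hardy inequality. The measure \<open>\<nu>\<close> is the weight of the \<open>\<theta>\<close>-integration, continuous
  or discrete; the bound does not depend on \<open>N\<close>.\<close>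

lemma lgl_hardy:
  fixes \<nu> :: "real measure"
  assumes N: "1 \<le> N" and p: "degree p \<le> N"
    and id: "(\<lambda>\<theta>. \<theta>) \<in> borel_measurable \<nu>"
    and AE: "AE \<theta> in \<nu>. -1 < \<theta> \<and> \<theta> \<le> 1"
    and C: "(\<integral>\<^sup>+\<theta>. ennreal ((1 + \<theta>) powr (-1/2)) \<partial>\<nu>) \<le> C"
  shows "(\<Sum>t\<in>lgl_nodes N. ennreal (lw N t) * (\<integral>\<^sup>+\<theta>. ennreal \<bar>poly p (mu t \<theta>)\<bar> \<partial>\<nu>)\<^sup>2)
    \<le> 6 * C\<^sup>2 * ennreal (wint 1 (p * p))"
proof -
  note meas = measurable_compose[OF id]
  define W where "W = wint 1 (p * p)"
  have W: "0 \<le> W" unfolding W_def wint_1 by (intro Bochner_Integration.integral_nonneg) simp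
  have w: "0 \<le> lw N t" if "t \<in> lgl_nodes N" for t
    using leg.lgl_weight_pos[OF N that] by simp
  define G where "G t = (\<integral>\<^sup>+\<theta>. ennreal ((1 + \<theta>) powr (1/2) * (poly p (mu t \<theta>))\<^sup>2) \<partial>\<nu>)" for t
  have CS: "(\<integral>\<^sup>+\<theta>. ennreal \<bar>poly p (mu t \<theta>)\<bar> \<partial>\<nu>)\<^sup>2 \<le> C * G t" for t
  proof -
    define f g where "f \<theta> = ennreal ((1 + \<theta>) powr (-1/4))"
      and "g \<theta> = ennreal ((1 + \<theta>) powr (1/4) * \<bar>poly p (mu t \<theta>)\<bar>)" for \<theta>
    have [measurable]: "f \<in> borel_measurable \<nu>" "g \<in> borel_measurable \<nu>"
      unfolding f_def g_def mu_def by (rule meas; measurable)+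
    have "(\<integral>\<^sup>+\<theta>. ennreal \<bar>poly p (mu t \<theta>)\<bar> \<partial>\<nu>) = (\<integral>\<^sup>+\<theta>. f \<theta> * g \<theta> \<partial>\<nu>)"
    proof (rule nn_integral_cong_AE, use AE in eventually_elim)
      case (elim \<theta>)
      have "(1 + \<theta>) powr (-1/4) * ((1 + \<theta>) powr (1/4) * \<bar>poly p (mu t \<theta>)\<bar>) = \<bar>poly p (mu t \<theta>)\<bar>"
        using elim by (simp add: mult.assoc[symmetric] powr_add[symmetric])
      thus ?case by (simp add: f_def g_def ennreal_mult'[symmetric])
    qed
    also have "\<dots>\<^sup>2 \<le> (\<integral>\<^sup>+\<theta>. (f \<theta>)\<^sup>2 \<partial>\<nu>) * (\<integral>\<^sup>+\<theta>. (g \<theta>)\<^sup>2 \<partial>\<nu>)"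
      by (rule Cauchy_Schwarz_nn_integral) auto
    also have "(\<integral>\<^sup>+\<theta>. (f \<theta>)\<^sup>2 \<partial>\<nu>) = (\<integral>\<^sup>+\<theta>. ennreal ((1 + \<theta>) powr (-1/2)) \<partial>\<nu>)"
      by (intro nn_integral_cong) (simp add: f_def ennreal_power power2_eq_square powr_add[symmetric] ennreal_mult'[symmetric])
    also have "(\<integral>\<^sup>+\<theta>. (g \<theta>)\<^sup>2 \<partial>\<nu>) = G t"
    proof -
      have "((1 + \<theta>) powr (1/4) * \<bar>poly p (mu t \<theta>)\<bar>)\<^sup>2 = (1 + \<theta>) powr (1/2) * (poly p (mu t \<theta>))\<^sup>2" for \<theta>
        by (simp add: power_mult_distrib power2_eq_square[of "_ powr _"] powr_add[symmetric])
      thus ?thesis by (simp add: G_def g_def ennreal_power)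
    qed
    finally show ?thesis using C by (meson mult_right_mono order_trans zero_le)
  qed
  have "(\<Sum>t\<in>lgl_nodes N. ennreal (lw N t) * (\<integral>\<^sup>+\<theta>. ennreal \<bar>poly p (mu t \<theta>)\<bar> \<partial>\<nu>)\<^sup>2)
      \<le> (\<Sum>t\<in>lgl_nodes N. ennreal (lw N t) * (C * G t))"
    by (intro sum_mono mult_left_mono CS) auto
  also have "\<dots> = C * (\<Sum>t\<in>lgl_nodes N. ennreal (lw N t) * G t)"
    by (simp add: sum_distrib_left mult_ac)
  also have "(\<Sum>t\<in>lgl_nodes N. ennreal (lw N t) * G t) =
      (\<integral>\<^sup>+\<theta>. (\<Sum>t\<in>lgl_nodes N. ennreal (lw N t) * ennreal ((1 + \<theta>) powr (1/2) * (poly p (mu t \<theta>))\<^sup>2)) \<partial>\<nu>)"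
  proof -
    have M: "(\<lambda>\<theta>. ennreal ((1 + \<theta>) powr (1/2) * (poly p (mu t \<theta>))\<^sup>2)) \<in> borel_measurable \<nu>" for t
      unfolding mu_def by (rule meas) measurable
    show ?thesis unfolding G_def
      by (subst nn_integral_sum) (use M in \<open>auto simp: nn_integral_cmult\<close>)
  qed
  also have "\<dots> \<le> (\<integral>\<^sup>+\<theta>. ennreal (6 * W) * ennreal ((1 + \<theta>) powr (-1/2)) \<partial>\<nu>)"
  proof (rule nn_integral_mono_AE, use AE in eventually_elim)
    case (elim \<theta>)
    have "(\<Sum>t\<in>lgl_nodes N. ennreal (lw N t) * ennreal ((1 + \<theta>) powr (1/2) * (poly p (mu t \<theta>))\<^sup>2)) =
        (\<Sum>t\<in>lgl_nodes N. ennreal ((1 + \<theta>) powr (1/2) * (lw N t * (poly p (mu t \<theta>))\<^sup>2)))"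
      by (intro sum.cong) (auto simp: ennreal_mult''[symmetric] mult_ac)
    also have "\<dots> = ennreal ((1 + \<theta>) powr (1/2) * (\<Sum>t\<in>lgl_nodes N. lw N t * (poly p (mu t \<theta>))\<^sup>2))"
      unfolding sum_distrib_left by (rule sum_ennreal) (use w in auto)
    also have "\<dots> \<le> ennreal ((1 + \<theta>) powr (1/2) * (6 / (1 + \<theta>) * W))"
      unfolding W_def using elim by (intro ennreal_leI mult_left_mono lgl_mu_bound N p) auto
    also have "(1 + \<theta>) powr (1/2) * (6 / (1 + \<theta>) * W) = 6 * W * (1 + \<theta>) powr (-1/2)"
    proof -
      have "(1 + \<theta>) powr (1/2) = (1 + \<theta>) powr (-1/2 + 1)" by simp
      also have "\<dots> = (1 + \<theta>) powr (-1/2) * (1 + \<theta>)" using elim by (subst powr_add) simp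
      finally show ?thesis using elim by simp
    qed
    finally show ?case using W by (simp add: ennreal_mult')
  qed
  also have "\<dots> = ennreal (6 * W) * (\<integral>\<^sup>+\<theta>. ennreal ((1 + \<theta>) powr (-1/2)) \<partial>\<nu>)"
    by (rule nn_integral_cmult, rule meas) measurable
  also have "\<dots> \<le> ennreal (6 * W) * C" by (intro mult_left_mono C) auto
  finally have "(\<Sum>t\<in>lgl_nodes N. ennreal (lw N t) * (\<integral>\<^sup>+\<theta>. ennreal \<bar>poly p (mu t \<theta>)\<bar> \<partial>\<nu>)\<^sup>2)
    \<le> C * (ennreal (6 * W) * C)" by (meson mult_left_mono order_trans zero_le)
  also have "\<dots> = 6 * C\<^sup>2 * ennreal W" using W by (simp add: ennreal_mult' power2_eq_square mult_ac)
  finally show ?thesis by (simp add: W_def)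
qed

lemma lgl_hardy_integral:
  assumes N: "1 \<le> N" and p: "degree p \<le> N" and \<beta>: "0 < \<beta>"
  shows "(\<Sum>t\<in>lgl_nodes N. ennreal (lw N t) * (\<integral>\<^sup>+x. ennreal (jw \<beta> x * \<bar>poly p (mu t x)\<bar>) \<partial>lborel)\<^sup>2)
    \<le> 6 * (hardy_const \<beta>)\<^sup>2 * ennreal (wint 1 (p * p))"
proof -
  define \<nu> where "\<nu> = density lborel (\<lambda>x. ennreal (jw \<beta> x))"
  have nn: "(\<integral>\<^sup>+x. ennreal (g x) \<partial>\<nu>) = (\<integral>\<^sup>+x. ennreal (jw \<beta> x * g x) \<partial>lborel)"
    if [measurable]: "g \<in> borel_measurable borel" for g
    unfolding \<nu>_def by (subst nn_integral_density) (auto simp: ennreal_mult')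
  have "(\<Sum>t\<in>lgl_nodes N. ennreal (lw N t) * (\<integral>\<^sup>+x. ennreal \<bar>poly p (mu t x)\<bar> \<partial>\<nu>)\<^sup>2)
    \<le> 6 * (hardy_const \<beta>)\<^sup>2 * ennreal (wint 1 (p * p))"
  proof (rule lgl_hardy[OF N p])
    show "(\<lambda>x. x) \<in> borel_measurable \<nu>" by (simp add: \<nu>_def)
    have "-1 < x \<and> x \<le> 1" if "0 < ennreal (jw \<beta> x)" for x
      using that jw_outside[of x \<beta>] by (cases "x \<in> {-1<..<1}") auto
    thus "AE x in \<nu>. -1 < x \<and> x \<le> 1"
      unfolding \<nu>_def by (subst AE_density) auto
    show "(\<integral>\<^sup>+x. ennreal ((1 + x) powr (-1/2)) \<partial>\<nu>) \<le> hardy_const \<beta>"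
      by (subst nn) (auto simp: hardy_const_def)
  qed
  thus ?thesis by (subst (asm) nn) (auto simp: mu_def)
qed

lemma lgl_hardy_gauss:
  assumes N: "1 \<le> N" and p: "degree p \<le> N" and \<beta>: "0 < \<beta>"
    and P: "P \<noteq> 0" "degree P = Suc n"
    and orth: "\<And>q. degree q < Suc n \<Longrightarrow> wint \<beta> (P * q) = 0"
  defines "X \<equiv> {x. poly P x = 0}"
  shows "(\<Sum>t\<in>lgl_nodes N. ennreal (lw N t) *
      (ennreal (\<Sum>x\<in>X. wint \<beta> (lagrange X x) * \<bar>poly p (mu t x)\<bar>))\<^sup>2)
    \<le> 6 * (hardy_const \<beta>)\<^sup>2 * ennreal (wint 1 (p * p))"
proof -
  interpret pos_functional "wint \<beta>" by (rule pos_functional_wint[OF \<beta>])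
  have gauss: "finite X" "X \<subseteq> {-1<..<1}" "\<And>x. x \<in> X \<Longrightarrow> 0 < wint \<beta> (lagrange X x)"
    using gauss_quad[OF P] orth unfolding X_def by blast+
  define \<nu> where "\<nu> = point_measure X (\<lambda>x. ennreal (wint \<beta> (lagrange X x)))"
  have nn: "(\<integral>\<^sup>+x. ennreal (g x) \<partial>\<nu>) = ennreal (\<Sum>x\<in>X. wint \<beta> (lagrange X x) * g x)"
    if "\<And>x. 0 \<le> g x" for g
    unfolding \<nu>_def using gauss(1,3) that
    by (subst nn_integral_point_measure_finite)
      (auto simp: ennreal_mult'[symmetric] less_imp_le intro!: sum_ennreal)
  have "(\<Sum>t\<in>lgl_nodes N. ennreal (lw N t) * (\<integral>\<^sup>+x. ennreal \<bar>poly p (mu t x)\<bar> \<partial>\<nu>)\<^sup>2)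
    \<le> 6 * (hardy_const \<beta>)\<^sup>2 * ennreal (wint 1 (p * p))"
  proof (rule lgl_hardy[OF N p])
    show "(\<lambda>x. x) \<in> borel_measurable \<nu>" by (simp add: \<nu>_def)
    show "AE x in \<nu>. -1 < x \<and> x \<le> 1"
      unfolding \<nu>_def AE_point_measure using gauss(2) by auto
    have "(\<integral>\<^sup>+x. ennreal ((1 + x) powr (-1/2)) \<partial>\<nu>) =
        (\<Sum>x\<in>X. ennreal (wint \<beta> (lagrange X x) * (1 + x) powr (-1/2)))"
      using gauss(3) by (subst nn) (auto simp: less_imp_le sum_ennreal)
    also have "\<dots> \<le> hardy_const \<beta>"
      unfolding X_def by (rule gauss_sum_inverse_sqrt[OF \<beta> P orth])
    finally show "(\<integral>\<^sup>+x. ennreal ((1 + x) powr (-1/2)) \<partial>\<nu>) \<le> hardy_const \<beta>" .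
  qed
  thus ?thesis by (subst (asm) nn) auto
qed

section \<open>Weighted estimates for Abel convolutions\<close>

text \<open>The mass on \<open>(0, 2]\<close> of the Abel kernel with an exponential weight; it tends to zero as
  \<open>l\<close> grows.\<close>

definition volterra_const :: "real \<Rightarrow> real \<Rightarrow> ennreal" where
  "volterra_const \<beta> l = (\<integral>\<^sup>+\<tau>. ennreal (sing \<beta> \<tau> * exp (- l * \<tau>)) * indicator {..2} \<tau> \<partial>lborel)"

lemma volterra_const_0: "0 < \<beta> \<Longrightarrow> volterra_const \<beta> 0 = ennreal (2 powr \<beta> / \<beta>)"
  using nn_integral_sing[of \<beta> 2] by (simp add: volterra_const_def)

lemma volterra_const_le:
  assumes "0 < \<beta>" "\<beta> \<le> 1" "0 < l"
  shows "volterra_const \<beta> l \<le> ennreal (l powr (-(\<beta>/2)) * (2 powr (\<beta>/2) / (\<beta>/2)))"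
proof -
  have "volterra_const \<beta> l \<le> (\<integral>\<^sup>+\<tau>. ennreal (l powr (-(\<beta>/2))) * (ennreal (sing (\<beta>/2) \<tau>) * indicator {..2} \<tau>) \<partial>lborel)"
    unfolding volterra_const_def
  proof (rule nn_integral_mono)
    fix \<tau> :: real
    have "sing \<beta> \<tau> * exp (- l * \<tau>) \<le> l powr (-(\<beta>/2)) * sing (\<beta>/2) \<tau>"
    proof (cases "0 < \<tau>")
      case True
      define x where "x = l * \<tau>"
      have x: "0 < x" using True assms by (simp add: x_def)
      have "x powr (\<beta>/2) \<le> exp x"
      proof (cases "x \<le> 1")
        case True
        hence "x powr (\<beta>/2) \<le> 1 powr (\<beta>/2)" using x assms by (intro powr_mono2) auto
        also have "\<dots> \<le> exp x" using x by simp
        finally show ?thesis .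
      next
        case False
        hence "x powr (\<beta>/2) \<le> x powr 1" using assms by (intro powr_mono) auto
        also have "\<dots> = x" using x by simp
        also have "\<dots> \<le> exp x" using exp_ge_add_one_self[of x] by linarith
        finally show ?thesis .
      qed
      hence "exp (- x) \<le> x powr (-(\<beta>/2))"
        using x by (simp add: exp_minus powr_minus le_imp_inverse_le)
      also have "\<dots> = l powr (-(\<beta>/2)) * \<tau> powr (-(\<beta>/2))"
        using True assms by (simp add: x_def powr_mult)
      finally have "\<tau> powr (\<beta> - 1) * exp (- x) \<le> \<tau> powr (\<beta> - 1) * (l powr (-(\<beta>/2)) * \<tau> powr (-(\<beta>/2)))"
        by (intro mult_left_mono) auto
      also have "\<dots> = l powr (-(\<beta>/2)) * \<tau> powr (\<beta>/2 - 1)"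
        using powr_add[of \<tau> "\<beta> - 1" "-(\<beta>/2)"] by (simp add: algebra_simps)
      finally show ?thesis using True by (simp add: sing_def x_def)
    qed (simp add: sing_def)
    hence "ennreal (sing \<beta> \<tau> * exp (- l * \<tau>)) \<le> ennreal (l powr (-(\<beta>/2)) * sing (\<beta>/2) \<tau>)"
      by (rule ennreal_leI)
    also have "\<dots> = ennreal (l powr (-(\<beta>/2))) * ennreal (sing (\<beta>/2) \<tau>)" by (simp add: ennreal_mult)
    finally show "ennreal (sing \<beta> \<tau> * exp (- l * \<tau>)) * indicator {..2} \<tau> \<le>
        ennreal (l powr (-(\<beta>/2))) * (ennreal (sing (\<beta>/2) \<tau>) * indicator {..2} \<tau>)"
      by (simp add: mult.assoc[symmetric] mult_right_mono)
  qed
  also have "\<dots> = ennreal (l powr (-(\<beta>/2))) * ennreal (2 powr (\<beta>/2) / (\<beta>/2))"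
    using assms nn_integral_sing[of "\<beta>/2" 2] by (subst nn_integral_cmult) auto
  also have "\<dots> = ennreal (l powr (-(\<beta>/2)) * (2 powr (\<beta>/2) / (\<beta>/2)))"
    using assms by (subst ennreal_mult'') auto
  finally show ?thesis .
qed

lemma volterra_const_small:
  assumes "0 < \<beta>" "\<beta> \<le> 1" "0 < e"
  shows "\<exists>l>0. volterra_const \<beta> l \<le> ennreal e"
proof -
  have "((\<lambda>l. l powr (-(\<beta>/2)) * (2 powr (\<beta>/2) / (\<beta>/2))) \<longlongrightarrow> 0 * (2 powr (\<beta>/2) / (\<beta>/2))) at_top"
    using assms by (intro tendsto_mult tendsto_neg_powr filterlim_ident tendsto_const) auto
  hence "\<forall>\<^sub>F l in at_top. l powr (-(\<beta>/2)) * (2 powr (\<beta>/2) / (\<beta>/2)) < e"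
    using assms(3) by (intro order_tendstoD(2)) auto
  hence "\<forall>\<^sub>F l in at_top. l powr (-(\<beta>/2)) * (2 powr (\<beta>/2) / (\<beta>/2)) < e \<and> 0 < l"
    using eventually_gt_at_top by (rule eventually_conj)
  then obtain l where l: "l powr (-(\<beta>/2)) * (2 powr (\<beta>/2) / (\<beta>/2)) < e" "0 < l"
    using eventually_happens' trivial_limit_at_top_linorder by blast
  thus ?thesis using volterra_const_le[OF assms(1,2) l(2)]
    by (intro exI[of _ l]) (meson ennreal_leI less_imp_le order_trans)
qed

text \<open>The Abel integral of the absolute value on the reference interval.\<close>

definition abint :: "real \<Rightarrow> (real \<Rightarrow> real) \<Rightarrow> real \<Rightarrow> ennreal" where
  "abint \<beta> v t = (\<integral>\<^sup>+s\<in>{-1..1}. ennreal (sing \<beta> (t - s) * \<bar>v s\<bar>) \<partial>lborel)"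

lemma abint_measurable [measurable]:
  assumes [measurable]: "v \<in> borel_measurable borel"
  shows "abint \<beta> v \<in> borel_measurable borel"
  unfolding abint_def by measurable

text \<open>The squared \<open>L\<^sup>2\<close> norm with weight \<open>e\<^bsup>-2lt\<^esup>\<close>.\<close>

definition wn2 :: "real \<Rightarrow> (real \<Rightarrow> real) \<Rightarrow> ennreal" where
  "wn2 l u = (\<integral>\<^sup>+t\<in>{-1..1}. ennreal (exp (- 2 * l * t) * (u t)\<^sup>2) \<partial>lborel)"

text \<open>Young's inequality for the convolution with \<open>\<tau>\<^sup>\<beta>\<^sup>-\<^sup>1 e\<^sup>-\<^sup>l\<^sup>\<tau>\<close>.\<close>

lemma abel_young:
  assumes "0 < \<beta>" and [measurable]: "v \<in> borel_measurable borel"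
  shows "(\<integral>\<^sup>+t\<in>{-1..1}. ennreal (exp (- 2 * l * t)) * (abint \<beta> v t)\<^sup>2 \<partial>lborel)
    \<le> (volterra_const \<beta> l)\<^sup>2 * wn2 l v"
proof -
  define k where "k t s = ennreal (sing \<beta> (t - s) * exp (- l * (t - s)))" for t s
  have [measurable]: "(\<lambda>(t, s). k t s) \<in> borel_measurable (borel \<Otimes>\<^sub>M borel)"
    "(\<lambda>(t, s). k s t) \<in> borel_measurable (borel \<Otimes>\<^sub>M borel)"
    "k t \<in> borel_measurable borel" "(\<lambda>s. k s t) \<in> borel_measurable borel" for t
    unfolding k_def by measurable
  have row: "(\<integral>\<^sup>+s\<in>{-1..1}. k t s \<partial>lborel) \<le> volterra_const \<beta> l" if "t \<le> 1" for t
  proof -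
    have "volterra_const \<beta> l = (\<integral>\<^sup>+s. ennreal (sing \<beta> (t + (-1) * s) * exp (- l * (t + (-1) * s))) * indicator {..2} (t + (-1) * s) \<partial>lborel)"
      unfolding volterra_const_def by (subst nn_integral_real_affine[where c = "-1" and t = t]) auto
    also have "\<dots> \<ge> (\<integral>\<^sup>+s\<in>{-1..1}. k t s \<partial>lborel)"
      unfolding k_def by (intro nn_integral_mono) (use that in \<open>auto simp: indicator_def\<close>)
    finally show ?thesis .
  qed
  have col: "(\<integral>\<^sup>+t\<in>{-1..1}. k t s \<partial>lborel) \<le> volterra_const \<beta> l" if "-1 \<le> s" for s
  proof -
    have "volterra_const \<beta> l = (\<integral>\<^sup>+t. ennreal (sing \<beta> (- s + 1 * t) * exp (- l * (- s + 1 * t))) * indicator {..2} (- s + 1 * t) \<partial>lborel)"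
      unfolding volterra_const_def by (subst nn_integral_real_affine[where c = 1 and t = "- s"]) auto
    also have "\<dots> \<ge> (\<integral>\<^sup>+t\<in>{-1..1}. k t s \<partial>lborel)"
      unfolding k_def by (intro nn_integral_mono) (use that in \<open>auto simp: indicator_def\<close>)
    finally show ?thesis .
  qed
  define V where "V s = ennreal (exp (- 2 * l * s) * (v s)\<^sup>2) * indicator {-1..1} s" for s
  have [measurable]: "V \<in> borel_measurable borel" unfolding V_def by measurable
  have pt: "ennreal (exp (- 2 * l * t)) * (abint \<beta> v t)\<^sup>2 * indicator {-1..1} t
     \<le> volterra_const \<beta> l * ((\<integral>\<^sup>+s. k t s * V s \<partial>lborel) * indicator {-1..1} t)" for t
  proof (cases "t \<in> {-1..1}")
    case True
    define f g where "f s = ennreal (sqrt (sing \<beta> (t - s) * exp (- l * (t - s)))) * indicator {-1..1} s"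
      and "g s = ennreal (sqrt (sing \<beta> (t - s) * exp (- l * (t - s))) * (exp (- l * s) * \<bar>v s\<bar>)) * indicator {-1..1} s" for s
    have [measurable]: "f \<in> borel_measurable lborel" "g \<in> borel_measurable lborel"
      unfolding f_def g_def by measurable
    have fg: "f s * g s = ennreal (exp (- l * t)) * (ennreal (sing \<beta> (t - s) * \<bar>v s\<bar>) * indicator {-1..1} s)" for s
    proof -
      define x where "x = sing \<beta> (t - s)"
      have "sqrt (x * exp (- l * (t - s))) * (sqrt (x * exp (- l * (t - s))) * (exp (- l * s) * \<bar>v s\<bar>))
        = x * (exp (- l * (t - s)) * exp (- l * s)) * \<bar>v s\<bar>"
        by (simp add: mult.assoc[symmetric] x_def)
      also have "exp (- l * (t - s)) * exp (- l * s) = exp (- l * t)"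
        by (simp add: exp_add[symmetric] algebra_simps)
      finally have "sqrt (x * exp (- l * (t - s))) * (sqrt (x * exp (- l * (t - s))) * (exp (- l * s) * \<bar>v s\<bar>))
        = exp (- l * t) * (x * \<bar>v s\<bar>)" by (simp add: mult_ac)
      thus ?thesis by (auto simp: f_def g_def x_def indicator_def ennreal_mult'[symmetric])
    qed
    have f2: "(f s)\<^sup>2 = k t s * indicator {-1..1} s" for s
      by (auto simp: f_def k_def ennreal_power indicator_def)
    have g2: "(g s)\<^sup>2 = k t s * V s" for s
    proof -
      have "(sqrt (sing \<beta> (t - s) * exp (- l * (t - s))) * (exp (- l * s) * \<bar>v s\<bar>))\<^sup>2 =
          (sing \<beta> (t - s) * exp (- l * (t - s))) * (exp (- 2 * l * s) * (v s)\<^sup>2)"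
        by (simp add: power_mult_distrib exp_double[symmetric] mult_ac)
      thus ?thesis by (auto simp: g_def k_def V_def ennreal_power indicator_def ennreal_mult'[symmetric])
    qed
    have "ennreal (exp (- 2 * l * t)) * (abint \<beta> v t)\<^sup>2 =
        (ennreal (exp (- l * t)) * abint \<beta> v t)\<^sup>2"
      by (simp add: power_mult_distrib ennreal_power exp_double[symmetric] mult_ac)
    also have "\<dots> = (\<integral>\<^sup>+s. f s * g s \<partial>lborel)\<^sup>2" unfolding fg abint_def
      by (subst nn_integral_cmult) auto
    also have "\<dots> \<le> (\<integral>\<^sup>+s. (f s)\<^sup>2 \<partial>lborel) * (\<integral>\<^sup>+s. (g s)\<^sup>2 \<partial>lborel)"
      by (rule Cauchy_Schwarz_nn_integral) auto
    also have "\<dots> \<le> volterra_const \<beta> l * (\<integral>\<^sup>+s. k t s * V s \<partial>lborel)"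
      unfolding f2 g2 using row[of t] True by (intro mult_right_mono) auto
    finally show ?thesis using True by simp
  qed simp
  have "(\<integral>\<^sup>+t\<in>{-1..1}. ennreal (exp (- 2 * l * t)) * (abint \<beta> v t)\<^sup>2 \<partial>lborel)
     \<le> (\<integral>\<^sup>+t. volterra_const \<beta> l * ((\<integral>\<^sup>+s. k t s * V s \<partial>lborel) * indicator {-1..1} t) \<partial>lborel)"
    by (rule nn_integral_mono) (rule pt)
  also have "\<dots> = volterra_const \<beta> l * (\<integral>\<^sup>+t. (\<integral>\<^sup>+s. k t s * V s \<partial>lborel) * indicator {-1..1} t \<partial>lborel)"
    by (rule nn_integral_cmult) measurable
  also have "(\<integral>\<^sup>+t. (\<integral>\<^sup>+s. k t s * V s \<partial>lborel) * indicator {-1..1} t \<partial>lborel) =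
      (\<integral>\<^sup>+t. (\<integral>\<^sup>+s. V s * (k t s * indicator {-1..1} t) \<partial>lborel) \<partial>lborel)"
    by (subst nn_integral_multc[symmetric]) (auto simp: mult_ac)
  also have "\<dots> = (\<integral>\<^sup>+s. (\<integral>\<^sup>+t. V s * (k t s * indicator {-1..1} t) \<partial>lborel) \<partial>lborel)"
    by (rule lborel_pair.Fubini') measurable
  also have "\<dots> \<le> (\<integral>\<^sup>+s. volterra_const \<beta> l * V s \<partial>lborel)"
  proof (rule nn_integral_mono)
    fix s
    show "(\<integral>\<^sup>+t. V s * (k t s * indicator {-1..1} t) \<partial>lborel) \<le> volterra_const \<beta> l * V s"
    proof (cases "-1 \<le> s")
      case True
      have "(\<integral>\<^sup>+t. V s * (k t s * indicator {-1..1} t) \<partial>lborel) = V s * (\<integral>\<^sup>+t\<in>{-1..1}. k t s \<partial>lborel)"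
        by (rule nn_integral_cmult) measurable
      also have "\<dots> \<le> V s * volterra_const \<beta> l" by (intro mult_left_mono col True) auto
      finally show ?thesis by (simp add: mult.commute)
    qed (simp add: V_def)
  qed
  also have "\<dots> = volterra_const \<beta> l * (\<integral>\<^sup>+s. V s \<partial>lborel)"
    by (rule nn_integral_cmult) measurable
  finally have "(\<integral>\<^sup>+t\<in>{-1..1}. ennreal (exp (- 2 * l * t)) * (abint \<beta> v t)\<^sup>2 \<partial>lborel)
    \<le> volterra_const \<beta> l * (volterra_const \<beta> l * (\<integral>\<^sup>+s. V s \<partial>lborel))"
    by (simp add: mult_left_mono order_trans)
  thus ?thesis by (simp add: V_def wn2_def power2_eq_square mult.assoc)
qed

section \<open>The interpolation operators\<close>

lemma lgl_interp_eq:
  assumes "1 \<le> N"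
  shows "lgl_interp N u = (\<Sum>t\<in>lgl_nodes N. smult (u t) (lagrange (lgl_nodes N) t))"
  unfolding lgl_interp_def using leg.lgl_nodes[OF assms] by (intro interp_poly_eq_lagrange)

lemma degree_lgl_interp:
  assumes "1 \<le> N" shows "degree (lgl_interp N u) \<le> N"
  using degree_sum_lagrange[of "lgl_nodes N" u] leg.lgl_nodes[OF assms] leg.lgl_nodes_nonempty[OF assms]
  unfolding lgl_interp_eq[OF assms] by simp

lemma poly_lgl_interp:
  assumes "1 \<le> N" "t \<in> lgl_nodes N" shows "poly (lgl_interp N u) t = u t"
  using poly_sum_lagrange[of "lgl_nodes N" t u] leg.lgl_nodes[OF assms(1)] assms(2)
  unfolding lgl_interp_eq[OF assms(1)] by simp

lemma lgl_interp_poly: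
  assumes "1 \<le> N" "degree p \<le> N" shows "lgl_interp N (poly p) = p"
  using leg.lgl_nodes[OF assms(1)] degree_lgl_interp[OF assms(1), of "poly p"] assms
  by (intro poly_eq_on_nodes[of "lgl_nodes N"]) (auto simp: poly_lgl_interp)

lemma lgl_interp_diff:
  assumes "1 \<le> N" shows "lgl_interp N u - lgl_interp N v = lgl_interp N (\<lambda>t. u t - v t)"
  unfolding lgl_interp_eq[OF assms] by (simp add: smult_diff_left sum_subtractf)

lemma lgl_interp_cmult:
  assumes "1 \<le> N" shows "smult c (lgl_interp N u) = lgl_interp N (\<lambda>t. c * u t)"
  unfolding lgl_interp_eq[OF assms]
  by (rule poly_ext) (simp add: poly_sum sum_distrib_left mult.assoc)

lemma lgl_interp_cong:
  assumes "1 \<le> N" "\<And>t. t \<in> {-1..1} \<Longrightarrow> u t = v t"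
  shows "lgl_interp N u = lgl_interp N v"
  unfolding lgl_interp_eq[OF assms(1)]
  by (rule sum.cong) (use assms(2) leg.lgl_nodes(3)[OF assms(1)] in auto)

lemma lgl_interp_stable:
  assumes "1 \<le> N"
  shows "wint 1 (lgl_interp N u * lgl_interp N u) \<le> (\<Sum>t\<in>lgl_nodes N. lw N t * (u t)\<^sup>2)"
proof -
  have "wint 1 (lgl_interp N u * lgl_interp N u) \<le> leg.quad (lgl_nodes N) (\<lambda>t. (poly (lgl_interp N u) t)\<^sup>2)"
    by (rule leg.lgl_norm_equiv(1)[OF assms degree_lgl_interp[OF assms]])
  also have "\<dots> = (\<Sum>t\<in>lgl_nodes N. lw N t * (u t)\<^sup>2)"
    unfolding leg.quad_def by (rule sum.cong) (auto simp: poly_lgl_interp[OF assms])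
  finally show ?thesis .
qed

lemma lgl_weights_nonneg: "1 \<le> N \<Longrightarrow> t \<in> lgl_nodes N \<Longrightarrow> 0 \<le> lw N t"
  using leg.lgl_weight_pos by (simp add: less_imp_le)

lemma lgl_weights_sum:
  assumes "1 \<le> N" shows "(\<Sum>t\<in>lgl_nodes N. lw N t) = 2"
proof -
  have "leg.quad (lgl_nodes N) (poly [:1:]) = wint 1 [:1:]"
    by (rule leg.lgl_exact) (use assms in auto)
  also have "wint 1 [:1:] = 2"
    using leg.I_pderiv[of "[:0, 1:]"] by (simp add: pderiv_pCons)
  finally show ?thesis by (simp add: leg.quad_def)
qed

lemma jacobi_integrand:
  "(LBINT x:{-1<..<1}. jacobi_weight (\<beta> - 1) 0 x * poly p x * poly q x) = wint \<beta> (p * q)"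
  unfolding wint_def set_lebesgue_integral_def
  by (intro Bochner_Integration.integral_cong)
    (auto simp: jw_def sing_def jacobi_weight_def indicator_def)

lemma jacobi_properties:
  assumes "0 < \<beta>"
  shows "jacobi (\<beta> - 1) 0 n \<noteq> 0" "degree (jacobi (\<beta> - 1) 0 n) = n"
    and "degree q < n \<Longrightarrow> wint \<beta> (jacobi (\<beta> - 1) 0 n * q) = 0"
proof -
  interpret pos_functional "wint \<beta>" by (rule pos_functional_wint[OF assms])
  have fam: "jacobi_family (\<beta> - 1) 0 J \<longleftrightarrow> (\<forall>n. J n \<noteq> 0 \<and> degree (J n) = n) \<and>
      (\<forall>m n. m \<noteq> n \<longrightarrow> wint \<beta> (J m * J n) = 0)" for J
    unfolding jacobi_family_def jacobi_integrand ..
  have "jacobi_family (\<beta> - 1) 0 (jacobi (\<beta> - 1) 0)"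
    unfolding jacobi_def using orthogonal_family_exists[folded fam] by (rule someI_ex)
  hence J: "\<And>n. jacobi (\<beta> - 1) 0 n \<noteq> 0 \<and> degree (jacobi (\<beta> - 1) 0 n) = n"
    "\<And>m n. m \<noteq> n \<Longrightarrow> wint \<beta> (jacobi (\<beta> - 1) 0 m * jacobi (\<beta> - 1) 0 n) = 0"
    unfolding fam by auto
  show "jacobi (\<beta> - 1) 0 n \<noteq> 0" "degree (jacobi (\<beta> - 1) 0 n) = n" using J(1) by auto
  show "degree q < n \<Longrightarrow> wint \<beta> (jacobi (\<beta> - 1) 0 n * q) = 0"
    by (rule orthogonal_family_lower_degree[OF J])
qed

text \<open>The nodes and the weights of the Gauss-Jacobi rule with \<open>N + 1\<close> nodes.\<close>

abbreviation gnodes :: "real \<Rightarrow> nat \<Rightarrow> real set" where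
  "gnodes \<beta> N \<equiv> jacobi_gauss_nodes (\<beta> - 1) 0 N"

abbreviation gw :: "real \<Rightarrow> nat \<Rightarrow> real \<Rightarrow> real" where
  "gw \<beta> N \<theta> \<equiv> wint \<beta> (lagrange (gnodes \<beta> N) \<theta>)"

lemma jacobi_nodes:
  assumes "0 < \<beta>"
  shows "finite (gnodes \<beta> N)" "card (gnodes \<beta> N) = Suc N"
    and "gnodes \<beta> N \<subseteq> {-1<..<1}"
    and "degree p < 2 * Suc N \<Longrightarrow> (\<Sum>x\<in>gnodes \<beta> N. gw \<beta> N x * poly p x) = wint \<beta> p"
    and "x \<in> gnodes \<beta> N \<Longrightarrow> 0 < gw \<beta> N x"
proof -
  interpret pos_functional "wint \<beta>" by (rule pos_functional_wint[OF assms])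
  have orth: "wint \<beta> (jacobi (\<beta> - 1) 0 (N + 1) * q) = 0" if "degree q < Suc N" for q
    using jacobi_properties(3)[OF assms, of q "N + 1"] that by simp
  have deg: "degree (jacobi (\<beta> - 1) 0 (N + 1)) = Suc N" using jacobi_properties(2)[OF assms] by simp
  note g = gauss_quad[OF jacobi_properties(1)[OF assms] deg orth]
  show "finite (gnodes \<beta> N)" "card (gnodes \<beta> N) = Suc N"
    "gnodes \<beta> N \<subseteq> {-1<..<1}"
    "x \<in> gnodes \<beta> N \<Longrightarrow> 0 < gw \<beta> N x"
    using g unfolding jacobi_gauss_nodes_def by blast+
  show "(\<Sum>x\<in>gnodes \<beta> N. gw \<beta> N x * poly p x) = wint \<beta> p"
    if "degree p < 2 * Suc N"
    using g(4)[OF _ that] unfolding jacobi_gauss_nodes_def quad_def by blast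
qed

lemma jacobi_interp_integral:
  assumes "0 < \<beta>"
  shows "(LBINT \<theta>:{-1..1}. (1 - \<theta>) powr (\<beta> - 1) * poly (jacobi_interp (\<beta> - 1) 0 N g) \<theta>) =
    (\<Sum>\<theta>\<in>gnodes \<beta> N. gw \<beta> N \<theta> * g \<theta>)"
proof -
  interpret pos_functional "wint \<beta>" by (rule pos_functional_wint[OF assms])
  note X = jacobi_nodes[where N = N, OF assms]
  define p where "p = jacobi_interp (\<beta> - 1) 0 N g"
  have "(LBINT \<theta>:{-1..1}. (1 - \<theta>) powr (\<beta> - 1) * poly p \<theta>) = wint \<beta> p"
    unfolding wint_def set_lebesgue_integral_def
  proof (rule integral_cong_AE)
    show "AE x in lborel. indicator {-1..1} x *\<^sub>R ((1 - x) powr (\<beta> - 1) * poly p x) = jw \<beta> x * poly p x"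
      using AE_not_endpoints by eventually_elim (auto simp: jw_def sing_def indicator_def)
  qed auto
  also have "\<dots> = quad (gnodes \<beta> N) g"
    unfolding p_def jacobi_interp_def interp_poly_eq_lagrange[OF X(1,2)] by (rule quad_interp)
  finally show ?thesis by (simp add: quad_def p_def)
qed

section \<open>Polynomial approximation of the kernel\<close>

text \<open>Polynomials in two real variables are represented by \<open>real poly poly\<close>: the value at
  \<open>(t, s)\<close> substitutes the constant polynomial \<open>t\<close> first and \<open>s\<close> second.\<close>

abbreviation poly2 :: "real poly poly \<Rightarrow> real \<Rightarrow> real \<Rightarrow> real" where
  "poly2 K t s \<equiv> poly (poly K [:t:]) s"

lemma real_polynomial_function_poly2:
  fixes g :: "real \<times> real \<Rightarrow> real"
  assumes "real_polynomial_function g"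
  shows "\<exists>K. \<forall>t s. g (t, s) = poly2 K t s"
  using assms
proof induction
  case (linear f)
  then interpret bounded_linear f .
  have "f (t, s) = poly2 [:[:0, f (0, 1):], [:f (1, 0):]:] t s" for t s
  proof -
    have "(t, s) = t *\<^sub>R (1, 0) + s *\<^sub>R (0, 1)" by simp
    hence "f (t, s) = t * f (1, 0) + s * f (0, 1)" by (metis add scaleR real_scaleR_def)
    thus ?thesis by simp
  qed
  thus ?case by blast
next
  case (const c)
  have "c = poly2 [:[:c:]:] t s" for t s by simp
  thus ?case by blast
next
  case (add f g)
  then obtain K L where "\<forall>t s. f (t, s) = poly2 K t s" "\<forall>t s. g (t, s) = poly2 L t s" by blast
  hence "\<forall>t s. f (t, s) + g (t, s) = poly2 (K + L) t s" by simp
  thus ?case by blast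
next
  case (mult f g)
  then obtain K L where "\<forall>t s. f (t, s) = poly2 K t s" "\<forall>t s. g (t, s) = poly2 L t s" by blast
  hence "\<forall>t s. f (t, s) * g (t, s) = poly2 (K * L) t s" by simp
  thus ?case by blast
qed

lemma poly2_approximation:
  fixes f :: "real \<Rightarrow> real \<Rightarrow> real"
  assumes "continuous_on ({-1..1} \<times> {-1..1}) (\<lambda>(t, s). f t s)" "0 < e"
  shows "\<exists>K. \<forall>t\<in>{-1..1}. \<forall>s\<in>{-1..1}. \<bar>f t s - poly2 K t s\<bar> \<le> e"
proof -
  have "compact ({-1..1::real} \<times> {-1..1::real})" by (intro compact_Times compact_Icc)
  from Stone_Weierstrass_real_polynomial_function[OF this assms]
  obtain g where g: "real_polynomial_function g"
    "\<And>x. x \<in> {-1..1} \<times> {-1..1} \<Longrightarrow> \<bar>(case x of (t, s) \<Rightarrow> f t s) - g x\<bar> < e" by blast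
  obtain K where "\<forall>t s. g (t, s) = poly2 K t s" using real_polynomial_function_poly2[OF g(1)] by blast
  thus ?thesis using g(2) by (intro exI[of _ K]) (force intro: less_imp_le)
qed

lemma poly_approximation:
  fixes f :: "real \<Rightarrow> real"
  assumes "continuous_on {-1..1} f" "0 < e"
  shows "\<exists>p. \<forall>t\<in>{-1..1}. \<bar>f t - poly p t\<bar> \<le> e"
proof -
  have "continuous_on ({-1..1} \<times> {-1..1}) (\<lambda>x. f (snd x))"
    by (rule continuous_on_compose2[OF assms(1)]) (auto intro: continuous_intros)
  hence "continuous_on ({-1..1} \<times> {-1..1}) (\<lambda>(t::real, s). f s)"
    by (simp add: case_prod_unfold)
  from poly2_approximation[OF this assms(2)] obtain K
    where "\<forall>t\<in>{-1..1}. \<forall>s\<in>{-1..1}. \<bar>f s - poly2 K t s\<bar> \<le> e" by blast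
  hence "\<forall>s\<in>{-1..1}. \<bar>f s - poly2 K 0 s\<bar> \<le> e" by (rule bspec) simp
  thus ?thesis by blast
qed

text \<open>An integral operator with polynomial kernel maps into polynomials of bounded degree.\<close>

lemma poly2_integral:
  "\<exists>q. degree q \<le> degree K \<and> (\<forall>t. poly q t = wint 1 (poly K [:t:] * U))"
proof -
  define q where "q = (\<Sum>i\<le>degree K. monom (wint 1 (coeff K i * U)) i)"
  have pw: "[:t:] ^ i = [:t ^ i:]" for t :: real and i
    by (induction i) auto
  have "poly K [:t:] * U = (\<Sum>i\<le>degree K. smult (t ^ i) (coeff K i * U))" for t
    by (simp add: poly_altdef pw sum_distrib_right)
  hence "poly q t = wint 1 (poly K [:t:] * U)" for t
    by (simp add: q_def leg.I_sum leg.I_smult poly_sum poly_monom mult.commute)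
  moreover have "degree q \<le> degree K" unfolding q_def
    by (intro degree_sum_le) (auto intro: order_trans[OF degree_monom_le])
  ultimately show ?thesis by blast
qed

text \<open>A continuous truncation of the Abel kernel at distance \<open>d\<close> from the diagonal; half of the
  exponent is spent to make the truncation error small.\<close>

lemma sing_truncation:
  assumes \<alpha>: "0 < \<alpha>" "\<alpha> < 1" and d: "0 < d"
  shows "\<exists>h. continuous_on UNIV h \<and> (\<forall>\<tau>. \<bar>sing \<alpha> \<tau> - h \<tau>\<bar> \<le> d powr (\<alpha>/2) * sing (\<alpha>/2) \<tau>)"
proof -
  \<comment> \<open>Linear on \<open>[0, d]\<close> and equal to the Abel kernel beyond \<open>d\<close>.\<close>
  define h where "h \<tau> = (max \<tau> d) powr (\<alpha> - 1) * min 1 (max 0 (\<tau> / d))" for \<tau>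
  have "continuous_on UNIV h" unfolding h_def
    using d by (intro continuous_intros) auto
  moreover have "\<bar>sing \<alpha> \<tau> - h \<tau>\<bar> \<le> d powr (\<alpha>/2) * sing (\<alpha>/2) \<tau>" for \<tau>
  proof -
    consider "\<tau> \<le> 0" | "0 < \<tau>" "\<tau> < d" | "d \<le> \<tau>" by linarith
    thus ?thesis
    proof cases
      case 1
      hence "\<tau> / d \<le> 0" using d by (simp add: divide_nonpos_pos)
      hence "h \<tau> = 0" by (simp add: h_def max_def)
      thus ?thesis using 1 by (simp add: sing_def)
    next
      case 2
      have r: "0 \<le> \<tau> / d" "\<tau> / d \<le> 1" using 2 d by auto
      have h: "h \<tau> = d powr (\<alpha> - 1) * (\<tau> / d)" using 2 r by (simp add: h_def max_def min_def)
      have "d powr (\<alpha> - 1) \<le> \<tau> powr (\<alpha> - 1)"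
        using 2 \<alpha> by (intro powr_mono2') auto
      hence "d powr (\<alpha> - 1) * (\<tau> / d) \<le> \<tau> powr (\<alpha> - 1) * 1"
        using r by (intro mult_mono) auto
      moreover have "0 \<le> d powr (\<alpha> - 1) * (\<tau> / d)" using r by (intro mult_nonneg_nonneg) auto
      ultimately have "\<bar>sing \<alpha> \<tau> - h \<tau>\<bar> \<le> \<tau> powr (\<alpha> - 1)"
        using 2 unfolding h by (simp add: sing_def)
      also have "\<tau> powr (\<alpha> - 1) = \<tau> powr (\<alpha>/2) * \<tau> powr (\<alpha>/2 - 1)"
        by (simp add: powr_add[symmetric])
      also have "\<dots> \<le> d powr (\<alpha>/2) * \<tau> powr (\<alpha>/2 - 1)"
        using 2 \<alpha> by (intro mult_right_mono powr_mono2) auto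
      finally show ?thesis using 2 by (simp add: sing_def)
    next
      case 3
      hence "1 \<le> \<tau> / d" using d by simp
      hence "h \<tau> = sing \<alpha> \<tau>" using 3 d by (simp add: h_def sing_def max_def)
      thus ?thesis by simp
    qed
  qed
  ultimately show ?thesis by blast
qed

lemma kernel_approximation:
  assumes \<alpha>: "0 < \<alpha>" "\<alpha> < 1" and A: "continuous_on {-1..1} A" and B: "continuous_on {-1..1} B"
    and e: "0 < e"
  shows "\<exists>K. \<forall>t\<in>{-1..1}. \<forall>s\<in>{-1..1}.
    \<bar>A t * (sing \<alpha> (t - s) * B s) - poly2 K t s\<bar> \<le> e * (1 + sing (\<alpha>/2) (t - s))"
proof -
  obtain MA where MA: "0 \<le> MA" "\<And>t. t \<in> {-1..1} \<Longrightarrow> norm (A t) \<le> MA"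
    using continuous_on_compact_bound[OF compact_Icc A] by blast
  obtain MB where MB: "0 \<le> MB" "\<And>t. t \<in> {-1..1} \<Longrightarrow> norm (B t) \<le> MB"
    using continuous_on_compact_bound[OF compact_Icc B] by blast
  define d where "d = (e / (MA * MB + 1)) powr (2/\<alpha>)"
  have pos: "0 < MA * MB + 1" using MA MB by (simp add: add_nonneg_pos)
  have d: "0 < d" using e pos by (simp add: d_def)
  have "d powr (\<alpha>/2) = e / (MA * MB + 1)" using e pos \<alpha> by (simp add: d_def powr_powr)
  hence "MA * MB * d powr (\<alpha>/2) = MA * MB / (MA * MB + 1) * e" by simp
  also have "\<dots> \<le> 1 * e" using pos e by (intro mult_right_mono) auto
  finally have dM: "MA * MB * d powr (\<alpha>/2) \<le> e" by simp
  obtain h where h: "continuous_on UNIV h" "\<And>\<tau>. \<bar>sing \<alpha> \<tau> - h \<tau>\<bar> \<le> d powr (\<alpha>/2) * sing (\<alpha>/2) \<tau>"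
    using sing_truncation[OF \<alpha> d] by blast
  have "continuous_on ({-1..1} \<times> {-1..1}) (\<lambda>x. A (fst x) * (h (fst x - snd x) * B (snd x)))"
    by (intro continuous_intros continuous_on_compose2[OF A] continuous_on_compose2[OF B]
        continuous_on_compose2[OF h(1)]) auto
  hence "continuous_on ({-1..1} \<times> {-1..1}) (\<lambda>(t, s). A t * (h (t - s) * B s))"
    by (simp add: case_prod_unfold)
  from poly2_approximation[OF this e] obtain K where
    K: "\<And>t s. t \<in> {-1..1} \<Longrightarrow> s \<in> {-1..1} \<Longrightarrow> \<bar>A t * (h (t - s) * B s) - poly2 K t s\<bar> \<le> e" by blast
  have "\<bar>A t * (sing \<alpha> (t - s) * B s) - poly2 K t s\<bar> \<le> e * (1 + sing (\<alpha>/2) (t - s))"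
    if t: "t \<in> {-1..1}" "s \<in> {-1..1}" for t s
  proof -
    have "\<bar>A t * (sing \<alpha> (t - s) * B s) - A t * (h (t - s) * B s)\<bar> =
        \<bar>A t\<bar> * \<bar>B s\<bar> * \<bar>sing \<alpha> (t - s) - h (t - s)\<bar>"
      by (simp add: abs_mult[symmetric] algebra_simps)
    also have "\<dots> \<le> MA * MB * (d powr (\<alpha>/2) * sing (\<alpha>/2) (t - s))"
      using MA MB t h(2) by (intro mult_mono) auto
    also have "\<dots> \<le> e * sing (\<alpha>/2) (t - s)"
      using mult_right_mono[OF dM, of "sing (\<alpha>/2) (t - s)"] by (simp add: mult_ac)
    finally show ?thesis using K[OF t] by (simp add: distrib_left)
  qed
  thus ?thesis by blast
qed

section \<open>The integral operator\<close>

lemma sing_integrable: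
  assumes "0 < \<beta>" and [measurable]: "g \<in> borel_measurable borel"
    and g: "\<And>s. s \<in> {-1..1} \<Longrightarrow> \<bar>g s\<bar> \<le> C"
  shows "integrable lborel (\<lambda>s. indicator {-1..1} s * (sing \<beta> (t - s) * g s))"
proof (cases "-1 \<le> t")
  case True
  have "0 \<le> C" using g[of 0] by simp
  have "(\<integral>\<^sup>+s. ennreal (norm (indicator {-1..1} s * (sing \<beta> (t - s) * g s))) \<partial>lborel) \<le>
      (\<integral>\<^sup>+s. ennreal C * (ennreal (sing \<beta> (t - s)) * indicator {-1..} s) \<partial>lborel)"
  proof (rule nn_integral_mono)
    fix s :: real
    have "s \<in> {-1..1} \<Longrightarrow> sing \<beta> (t - s) * \<bar>g s\<bar> \<le> C * sing \<beta> (t - s)"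
      using mult_left_mono[OF g[of s], of "sing \<beta> (t - s)"] by (simp add: mult.commute)
    thus "ennreal (norm (indicator {-1..1} s * (sing \<beta> (t - s) * g s))) \<le>
        ennreal C * (ennreal (sing \<beta> (t - s)) * indicator {-1..} s)"
      using \<open>0 \<le> C\<close> by (auto simp: indicator_def abs_mult ennreal_mult'[symmetric] intro!: ennreal_leI)
  qed
  also have "\<dots> = ennreal C * ennreal ((t + 1) powr \<beta> / \<beta>)"
    using nn_integral_sing_reflect[OF assms(1) True] by (subst nn_integral_cmult) auto
  also have "\<dots> < \<infinity>" by (simp add: ennreal_mult_less_top)
  finally show ?thesis by (intro integrableI_bounded) auto
next
  case False
  hence "(\<lambda>s. indicator {-1..1} s * (sing \<beta> (t - s) * g s)) = (\<lambda>s. 0)"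
    by (auto simp: sing_def indicator_def)
  thus ?thesis by simp
qed

lemma sing_scale:
  assumes "0 < k"
  shows "k * sing \<beta> (k * x) = k powr \<beta> * sing \<beta> x"
proof -
  have "k * k powr (\<beta> - 1) = k powr \<beta>" using assms by (simp add: powr_diff)
  thus ?thesis using assms
    by (auto simp: sing_def powr_mult zero_less_mult_iff mult.assoc[symmetric])
qed

text \<open>The change of variables \<open>s = \<mu>(t,\<theta>)\<close>. It fails at the single point \<open>\<theta> = -1\<close>, where \<open>jw\<close> vanishes
  by definition.\<close>

lemma mu_kernel:
  assumes "-1 < t" "t \<le> 1" "\<theta> \<noteq> -1"
  shows "indicator {-1..1} (mu t \<theta>) * sing \<beta> (t - mu t \<theta>) * ((t + 1) / 2) = ((t + 1) / 2) powr \<beta> * jw \<beta> \<theta>"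
proof -
  define k where "k = (t + 1) / 2"
  have k: "0 < k" "k \<le> 1" using assms by (auto simp: k_def)
  have e: "t - mu t \<theta> = k * (1 - \<theta>)" and e': "mu t \<theta> = -1 + k * (1 + \<theta>)"
    by (simp_all add: mu_def k_def field_simps)
  show ?thesis
  proof (cases "\<theta> \<in> {-1<..<1}")
    case True
    have "-1 \<le> mu t \<theta>" unfolding e' using k True by simp
    moreover have "mu t \<theta> \<le> 1"
    proof -
      have "k * (1 + \<theta>) \<le> 1 * 2" using k True by (intro mult_mono) auto
      thus ?thesis unfolding e' by simp
    qed
    ultimately show ?thesis using sing_scale[OF k(1), of \<beta> "1 - \<theta>"] True
      by (simp add: e k_def[symmetric] jw_def mult.commute)
  next
    case False
    then consider "\<theta> < -1" | "1 \<le> \<theta>" using assms(3) by force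
    thus ?thesis
    proof cases
      case 1
      hence "k * (1 + \<theta>) < 0" using k by (simp add: mult_pos_neg)
      hence "mu t \<theta> < -1" unfolding e' by simp
      thus ?thesis using False by (simp add: jw_outside)
    next
      case 2
      hence "k * (1 - \<theta>) \<le> 0" using k by (simp add: mult_nonneg_nonpos)
      thus ?thesis using False unfolding e by (simp add: jw_outside sing_def)
    qed
  qed
qed

lemma abel_integral_mu:
  assumes "-1 \<le> t" "t \<le> 1" and [measurable]: "g \<in> borel_measurable borel"
  shows "(\<integral>s. indicator {-1..1} s * (sing \<beta> (t - s) * g s) \<partial>lborel) =
    ((t + 1) / 2) powr \<beta> * (\<integral>x. jw \<beta> x * g (mu t x) \<partial>lborel)"
proof (cases "t = -1")
  case True
  hence "(\<lambda>s. indicator {-1..1} s * (sing \<beta> (t - s) * g s)) = (\<lambda>s. 0)"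
    by (auto simp: sing_def indicator_def fun_eq_iff)
  thus ?thesis using True by simp
next
  case False
  hence t: "-1 < t" using assms by simp
  define k where "k = (t + 1) / 2"
  have k: "0 < k" using t by (simp add: k_def)
  have m: "(t - 1) / 2 + k * x = mu t x" for x by (simp add: k_def mu_def)
  have "(\<integral>s. indicator {-1..1} s * (sing \<beta> (t - s) * g s) \<partial>lborel) =
      \<bar>k\<bar> *\<^sub>R (\<integral>x. indicator {-1..1} (mu t x) * (sing \<beta> (t - mu t x) * g (mu t x)) \<partial>lborel)"
    unfolding m[symmetric] by (rule lborel_integral_real_affine) (use k in auto)
  also have "\<dots> = (\<integral>x. (indicator {-1..1} (mu t x) * sing \<beta> (t - mu t x) * k) * g (mu t x) \<partial>lborel)"
    using k by (simp add: Bochner_Integration.integral_mult_right_zero[symmetric] mult_ac del: Bochner_Integration.integral_mult_right_zero)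
  also have "\<dots> = (\<integral>x. k powr \<beta> * (jw \<beta> x * g (mu t x)) \<partial>lborel)"
  proof (rule integral_cong_AE)
    show "AE x in lborel. (indicator {-1..1} (mu t x) * sing \<beta> (t - mu t x) * k) * g (mu t x) =
        k powr \<beta> * (jw \<beta> x * g (mu t x))"
      using AE_not_endpoints
    proof eventually_elim
      case (elim x)
      thus ?case using mu_kernel[OF t assms(2), of x \<beta>] by (simp add: k_def mult.assoc[symmetric])
    qed
  qed (auto simp: mu_def)
  finally show ?thesis by (simp add: k_def)
qed

lemma abint_le_mu:
  assumes "-1 \<le> t" "t \<le> 1" "0 < \<beta>" and [measurable]: "v \<in> borel_measurable borel"
  shows "abint \<beta> v t \<le> (\<integral>\<^sup>+x. ennreal (jw \<beta> x * \<bar>v (mu t x)\<bar>) \<partial>lborel)"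
proof (cases "t = -1")
  case True
  hence "(\<lambda>s. ennreal (sing \<beta> (t - s) * \<bar>v s\<bar>) * indicator {-1..1} s) = (\<lambda>s. 0)"
    by (auto simp: sing_def indicator_def fun_eq_iff)
  thus ?thesis by (simp add: abint_def)
next
  case False
  hence t: "-1 < t" using assms by simp
  define g where "g s = \<bar>v s\<bar>" for s
  have [measurable]: "g \<in> borel_measurable borel" and g: "0 \<le> g s" for s
    unfolding g_def by measurable
  define k where "k = (t + 1) / 2"
  have k: "0 < k" "k \<le> 1" using t assms by (auto simp: k_def)
  have kb: "k powr \<beta> \<le> 1" using k assms(3) powr_mono2[of \<beta> k 1] by simp
  have m: "(t - 1) / 2 + k * x = mu t x" for x by (simp add: k_def mu_def)
  have "(\<integral>\<^sup>+s\<in>{-1..1}. ennreal (sing \<beta> (t - s) * g s) \<partial>lborel) =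
      ennreal \<bar>k\<bar> * (\<integral>\<^sup>+x. ennreal (sing \<beta> (t - mu t x) * g (mu t x)) * indicator {-1..1} (mu t x) \<partial>lborel)"
    unfolding m[symmetric] by (rule nn_integral_real_affine) (use k in auto)
  also have "\<dots> = (\<integral>\<^sup>+x. ennreal \<bar>k\<bar> * (ennreal (sing \<beta> (t - mu t x) * g (mu t x)) * indicator {-1..1} (mu t x)) \<partial>lborel)"
    by (subst nn_integral_cmult) (auto simp: mu_def)
  also have "\<dots> \<le> (\<integral>\<^sup>+x. ennreal (jw \<beta> x * g (mu t x)) \<partial>lborel)"
  proof (rule nn_integral_mono_AE)
    show "AE x in lborel. ennreal \<bar>k\<bar> * (ennreal (sing \<beta> (t - mu t x) * g (mu t x)) * indicator {-1..1} (mu t x)) \<le>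
        ennreal (jw \<beta> x * g (mu t x))"
      using AE_not_endpoints
    proof eventually_elim
      case (elim x)
      have "ennreal \<bar>k\<bar> * (ennreal (sing \<beta> (t - mu t x) * g (mu t x)) * indicator {-1..1} (mu t x)) =
          ennreal ((indicator {-1..1} (mu t x) * sing \<beta> (t - mu t x) * k) * g (mu t x))"
        using k g by (auto simp: indicator_def ennreal_mult'[symmetric] mult_ac)
      also have "\<dots> = ennreal (k powr \<beta> * jw \<beta> x * g (mu t x))"
        using mu_kernel[OF t assms(2), of x \<beta>] elim by (simp add: k_def)
      also have "\<dots> \<le> ennreal (1 * jw \<beta> x * g (mu t x))"
        using kb g by (intro ennreal_leI mult_right_mono) auto
      finally show ?case by simp
    qed
  qed
  finally show ?thesis by (simp add: abint_def g_def)
qed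

section \<open>Consistency of the collocation operator\<close>

lemma ennreal_power2_add3_le: "(a + b + c)\<^sup>2 \<le> 3 * (a\<^sup>2 + b\<^sup>2 + c\<^sup>2)" for a b c :: ennreal
proof (cases a; cases b; cases c)
  fix x y z :: real
  assume nn: "0 \<le> x" "0 \<le> y" "0 \<le> z" and eq: "a = ennreal x" "b = ennreal y" "c = ennreal z"
  have "0 \<le> (x - y)\<^sup>2 + (y - z)\<^sup>2 + (x - z)\<^sup>2" by simp
  hence "(x + y + z)\<^sup>2 \<le> 3 * (x\<^sup>2 + y\<^sup>2 + z\<^sup>2)"
    by (simp add: power2_eq_square algebra_simps)
  hence "ennreal ((x + y + z)\<^sup>2) \<le> ennreal (3 * (x\<^sup>2 + y\<^sup>2 + z\<^sup>2))" by (rule ennreal_leI)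
  thus ?thesis using nn by (simp add: eq ennreal_power[symmetric] ennreal_mult)
qed (auto simp: power2_eq_square ennreal_top_mult ennreal_mult_top)

lemma ennreal_power2_add_le: "(a + b)\<^sup>2 \<le> 2 * (a\<^sup>2 + b\<^sup>2)" for a b :: ennreal
proof (cases a; cases b)
  fix x y :: real
  assume nn: "0 \<le> x" "0 \<le> y" and eq: "a = ennreal x" "b = ennreal y"
  have "0 \<le> (x - y)\<^sup>2" by simp
  hence "(x + y)\<^sup>2 \<le> 2 * (x\<^sup>2 + y\<^sup>2)"
    by (simp add: power2_eq_square algebra_simps)
  hence "ennreal ((x + y)\<^sup>2) \<le> ennreal (2 * (x\<^sup>2 + y\<^sup>2))" by (rule ennreal_leI)
  thus ?thesis using nn by (simp add: eq ennreal_power[symmetric] ennreal_mult)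
qed (auto simp: power2_eq_square ennreal_top_mult ennreal_mult_top)

lemma ennreal_power2_abs: "ennreal (x\<^sup>2) = (ennreal \<bar>x\<bar>)\<^sup>2"
  by (simp add: ennreal_power)

lemma ennreal_abs_triangle: "ennreal \<bar>x + y\<bar> \<le> ennreal \<bar>x\<bar> + ennreal \<bar>y\<bar>"
  by (simp add: ennreal_plus[symmetric] del: ennreal_plus)

lemma abs_integral_le_nn_integral: "ennreal \<bar>\<integral>x. f x \<partial>M\<bar> \<le> (\<integral>\<^sup>+x. ennreal \<bar>f x\<bar> \<partial>M)"
  for f :: "_ \<Rightarrow> real"
  using integral_norm_bound_ennreal[of M f] by (cases "integrable M f") (auto simp: not_integrable_integral_eq)

lemma nn_integral_reference_mono:
  fixes f h :: "real \<Rightarrow> real"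
  assumes c: "0 \<le> c" and [measurable]: "h \<in> borel_measurable borel"
    and le: "\<And>s. s \<in> {-1..1} \<Longrightarrow> f s \<le> c * h s"
  shows "(\<integral>\<^sup>+s\<in>{-1..1::real}. ennreal (f s) \<partial>lborel) \<le> ennreal c * (\<integral>\<^sup>+s\<in>{-1..1}. ennreal (h s) \<partial>lborel)"
proof -
  have "(\<integral>\<^sup>+s\<in>{-1..1}. ennreal (f s) \<partial>lborel) \<le> (\<integral>\<^sup>+s. ennreal c * (ennreal (h s) * indicator {-1..1} s) \<partial>lborel)"
  proof (rule nn_integral_mono)
    fix s :: real
    show "ennreal (f s) * indicator {-1..1} s \<le> ennreal c * (ennreal (h s) * indicator {-1..1} s)"
      using le[of s] c by (auto simp: indicator_def ennreal_mult'[symmetric] intro: ennreal_leI)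
  qed
  also have "\<dots> = ennreal c * (\<integral>\<^sup>+s\<in>{-1..1}. ennreal (h s) \<partial>lborel)" by (rule nn_integral_cmult) measurable
  finally show ?thesis .
qed

lemma abs_integral_le_reference:
  fixes f h :: "real \<Rightarrow> real"
  assumes "0 \<le> c" "h \<in> borel_measurable borel" "\<And>s. s \<in> {-1..1} \<Longrightarrow> \<bar>f s\<bar> \<le> c * h s"
  shows "ennreal \<bar>\<integral>s. indicator {-1..1} s * f s \<partial>lborel\<bar> \<le> ennreal c * (\<integral>\<^sup>+s\<in>{-1..1}. ennreal (h s) \<partial>lborel)"
proof -
  have "ennreal \<bar>\<integral>s. indicator {-1..1} s * f s \<partial>lborel\<bar> \<le> (\<integral>\<^sup>+s. ennreal \<bar>indicator {-1..1} s * f s\<bar> \<partial>lborel)"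
    by (rule abs_integral_le_nn_integral)
  also have "\<dots> = (\<integral>\<^sup>+s\<in>{-1..1}. ennreal \<bar>f s\<bar> \<partial>lborel)"
    by (intro nn_integral_cong) (auto simp: indicator_def)
  also have "\<dots> \<le> ennreal c * (\<integral>\<^sup>+s\<in>{-1..1}. ennreal (h s) \<partial>lborel)"
    by (rule nn_integral_reference_mono) (use assms in auto)
  finally show ?thesis .
qed

text \<open>The squared \<open>L\<^sup>2\<close> norm on the reference interval.\<close>

definition n2 :: "(real \<Rightarrow> real) \<Rightarrow> ennreal" where
  "n2 u = (\<integral>\<^sup>+t\<in>{-1..1}. ennreal ((u t)\<^sup>2) \<partial>lborel)"

lemma n2_add_le:
  assumes [measurable]: "u \<in> borel_measurable borel" "v \<in> borel_measurable borel"
  shows "n2 (\<lambda>t. u t + v t) \<le> 2 * (n2 u + n2 v)"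
proof -
  have "n2 (\<lambda>t. u t + v t) \<le> ennreal 2 * (\<integral>\<^sup>+t\<in>{-1..1}. ennreal ((u t)\<^sup>2 + (v t)\<^sup>2) \<partial>lborel)"
    unfolding n2_def
  proof (rule nn_integral_reference_mono)
    fix t
    have "0 \<le> (u t - v t)\<^sup>2" by simp
    thus "(u t + v t)\<^sup>2 \<le> 2 * ((u t)\<^sup>2 + (v t)\<^sup>2)" by (simp add: power2_eq_square algebra_simps)
  qed auto
  also have "\<dots> = 2 * (n2 u + n2 v)"
    unfolding n2_def by (subst nn_integral_add[symmetric]) (auto simp: distrib_right)
  finally show ?thesis .
qed

lemma n2_minus: "n2 (\<lambda>t. u t - v t) = n2 (\<lambda>t. v t - u t)"
  by (simp add: n2_def power2_commute)

lemma n2_le: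
  assumes "\<And>t. t \<in> {-1..1} \<Longrightarrow> \<bar>u t\<bar> \<le> c"
  shows "n2 u \<le> 2 * ennreal (c\<^sup>2)"
proof -
  have "n2 u \<le> ennreal (c\<^sup>2) * (\<integral>\<^sup>+t\<in>{-1..1::real}. ennreal 1 \<partial>lborel)"
    unfolding n2_def
  proof (rule nn_integral_reference_mono)
    fix t :: real assume "t \<in> {-1..1}"
    hence "\<bar>u t\<bar>\<^sup>2 \<le> c\<^sup>2" using assms by (intro power_mono) auto
    thus "(u t)\<^sup>2 \<le> c\<^sup>2 * 1" by simp
  qed auto
  also have "\<dots> = 2 * ennreal (c\<^sup>2)" by (simp add: mult.commute)
  finally show ?thesis .
qed

lemma wint_1_Icc: "wint 1 p = (\<integral>x. indicator {-1..1} x * poly p x \<partial>lborel)"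
  unfolding wint_1
proof (rule integral_cong_AE)
  show "AE x in lborel. indicator {-1<..<1} x * poly p x = indicator {-1..1} x * poly p x"
    using AE_not_endpoints by eventually_elim (auto simp: indicator_def)
qed auto

lemma n2_poly: "n2 (poly p) = ennreal (wint 1 (p * p))"
proof -
  have "n2 (poly p) = (\<integral>\<^sup>+x. ennreal (jw 1 x * poly (p * p) x) \<partial>lborel)"
    unfolding n2_def
  proof (rule nn_integral_cong_AE)
    show "AE x in lborel. ennreal ((poly p x)\<^sup>2) * indicator {-1..1} x = ennreal (jw 1 x * poly (p * p) x)"
      using AE_not_endpoints by eventually_elim (auto simp: indicator_def jw_def sing_1 power2_eq_square)
  qed
  also have "\<dots> = ennreal (wint 1 (p * p))" by (rule nn_integral_wint) auto
  finally show ?thesis .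
qed

lemma n2_lgl_interp_le:
  assumes "1 \<le> N"
  shows "n2 (poly (lgl_interp N u)) \<le> (\<Sum>t\<in>lgl_nodes N. ennreal (lw N t) * (ennreal \<bar>u t\<bar>)\<^sup>2)"
proof -
  have "n2 (poly (lgl_interp N u)) \<le> ennreal (\<Sum>t\<in>lgl_nodes N. lw N t * (u t)\<^sup>2)"
    unfolding n2_poly by (intro ennreal_leI lgl_interp_stable assms)
  also have "\<dots> = (\<Sum>t\<in>lgl_nodes N. ennreal (lw N t * (u t)\<^sup>2))"
    using lgl_weights_nonneg[OF assms] by (intro sum_ennreal[symmetric]) auto
  also have "\<dots> = (\<Sum>t\<in>lgl_nodes N. ennreal (lw N t) * (ennreal \<bar>u t\<bar>)\<^sup>2)"
    by (intro sum.cong refl) (simp add: ennreal_mult''  ennreal_power2_abs[symmetric])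
  finally show ?thesis .
qed

lemma L1_le_n2:
  assumes [measurable]: "u \<in> borel_measurable borel"
  shows "(\<integral>\<^sup>+s\<in>{-1..1}. ennreal \<bar>u s\<bar> \<partial>lborel)\<^sup>2 \<le> 2 * n2 u"
proof -
  have "(\<integral>\<^sup>+s\<in>{-1..1}. ennreal \<bar>u s\<bar> \<partial>lborel)\<^sup>2 =
      (\<integral>\<^sup>+s. indicator {-1..1} s * (ennreal \<bar>u s\<bar> * indicator {-1..1} s) \<partial>lborel)\<^sup>2"
    by (intro arg_cong[where f = "\<lambda>x. x\<^sup>2"] nn_integral_cong) (auto simp: indicator_def)
  also have "\<dots> \<le> (\<integral>\<^sup>+s. (indicator {-1..1::real} s)\<^sup>2 \<partial>lborel) * (\<integral>\<^sup>+s. (ennreal \<bar>u s\<bar> * indicator {-1..1} s)\<^sup>2 \<partial>lborel)"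
    by (rule Cauchy_Schwarz_nn_integral) auto
  also have "(\<integral>\<^sup>+s. (indicator {-1..1::real} s)\<^sup>2 \<partial>lborel) = (\<integral>\<^sup>+s. indicator {-1..1::real} s \<partial>lborel)"
    by (intro nn_integral_cong) (auto simp: indicator_def)
  also have "\<dots> = 2" by simp
  also have "(\<integral>\<^sup>+s. (ennreal \<bar>u s\<bar> * indicator {-1..1} s)\<^sup>2 \<partial>lborel) = n2 u"
    unfolding n2_def by (intro nn_integral_cong) (auto simp: indicator_def ennreal_power2_abs)
  finally show ?thesis .
qed

lemma mu_in_reference:
  assumes "t \<in> {-1..1}" "\<theta> \<in> {-1..1}" shows "mu t \<theta> \<in> {-1..1}"
proof -
  have "mu t \<theta> = -1 + (t + 1) * (1 + \<theta>) / 2" by (simp add: mu_def field_simps)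
  moreover have "0 \<le> (t + 1) * (1 + \<theta>)" using assms by simp
  moreover have "(t + 1) * (1 + \<theta>) \<le> 2 * 2" using assms by (intro mult_mono) auto
  ultimately show ?thesis by auto
qed

text \<open>The Volterra operator, in the variable \<open>s = \<mu>(t,\<theta>)\<close>. The constant factor of the equation is
  part of the coefficient \<open>A\<close>.\<close>

definition abel :: "real \<Rightarrow> (real \<Rightarrow> real) \<Rightarrow> (real \<Rightarrow> real) \<Rightarrow> (real \<Rightarrow> real) \<Rightarrow> real \<Rightarrow> real" where
  "abel \<alpha> A B v t = A t * (\<integral>s. indicator {-1..1} s * (sing \<alpha> (t - s) * (B s * v s)) \<partial>lborel)"

text \<open>The same operator with the \<open>\<theta>\<close>-integral evaluated by the Gauss-Jacobi rule; the scheme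
  interpolates it at the Lobatto nodes.\<close>

definition colloc :: "real \<Rightarrow> (real \<Rightarrow> real) \<Rightarrow> (real \<Rightarrow> real) \<Rightarrow> nat \<Rightarrow> real poly \<Rightarrow> real \<Rightarrow> real" where
  "colloc \<alpha> A B N U t = ((t + 1) / 2) powr \<alpha> * A t *
     (\<Sum>\<theta>\<in>gnodes \<alpha> N. gw \<alpha> N \<theta> * (B (mu t \<theta>) * poly U (mu t \<theta>)))"

text \<open>The Gauss-Jacobi sum of the absolute value, the discrete counterpart of \<open>abint\<close>.\<close>

definition absum :: "real \<Rightarrow> nat \<Rightarrow> real poly \<Rightarrow> real \<Rightarrow> ennreal" where
  "absum \<alpha> N U t = ennreal (\<Sum>\<theta>\<in>gnodes \<alpha> N. gw \<alpha> N \<theta> * \<bar>poly U (mu t \<theta>)\<bar>)"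

lemma bounded_on_reference:
  assumes "continuous_on UNIV (f :: real \<Rightarrow> real)"
  shows "\<exists>M\<ge>0. \<forall>t\<in>{-1..1}. \<bar>f t\<bar> \<le> M"
proof -
  have "continuous_on {-1..1} f" using assms continuous_on_subset by blast
  from continuous_on_compact_bound[OF compact_Icc this] show ?thesis by (metis real_norm_def)
qed

lemma abel_integrable:
  assumes "0 < \<beta>" "continuous_on UNIV g"
  shows "integrable lborel (\<lambda>s. indicator {-1..1} s * (sing \<beta> (t - s) * g s))"
proof -
  obtain M where "\<forall>t\<in>{-1..1}. \<bar>g t\<bar> \<le> M" using bounded_on_reference[OF assms(2)] by blast
  thus ?thesis using assms borel_measurable_continuous_onI by (intro sing_integrable[of _ _ M]) auto
qed

text \<open>Distances on the reference interval are at most \<open>2\<close>.\<close>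

lemma sing_half:
  assumes "0 < \<alpha>" "\<alpha> < 1" "\<tau> \<le> 2"
  shows "sing \<alpha> \<tau> \<le> 2 * sing (\<alpha>/2) \<tau>"
proof (cases "0 < \<tau>")
  case True
  have "\<tau> powr (\<alpha>/2) \<le> 2 powr (\<alpha>/2)" using True assms by (intro powr_mono2) auto
  also have "\<dots> \<le> 2 powr 1" using assms by (intro powr_mono) auto
  finally have "\<tau> powr (\<alpha>/2) * \<tau> powr (\<alpha>/2 - 1) \<le> 2 * \<tau> powr (\<alpha>/2 - 1)"
    by (intro mult_right_mono) auto
  thus ?thesis using True by (simp add: sing_def powr_add[symmetric])
qed (simp add: sing_def)

lemma abint_half:
  assumes "0 < \<alpha>" "\<alpha> < 1" "t \<le> 1" and [measurable]: "v \<in> borel_measurable borel"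
  shows "abint \<alpha> v t \<le> 2 * abint (\<alpha>/2) v t"
proof -
  have "abint \<alpha> v t \<le> ennreal 2 * abint (\<alpha>/2) v t"
    unfolding abint_def
  proof (rule nn_integral_reference_mono)
    fix s :: real assume "s \<in> {-1..1}"
    thus "sing \<alpha> (t - s) * \<bar>v s\<bar> \<le> 2 * (sing (\<alpha>/2) (t - s) * \<bar>v s\<bar>)"
      using mult_right_mono[OF sing_half[OF assms(1,2), of "t - s"], of "\<bar>v s\<bar>"] assms(3) by simp
  qed auto
  thus ?thesis by simp
qed

lemma abel_le_abint:
  assumes MA: "\<And>t. t \<in> {-1..1} \<Longrightarrow> \<bar>A t\<bar> \<le> MA" and MB: "\<And>t. t \<in> {-1..1} \<Longrightarrow> \<bar>B t\<bar> \<le> MB"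
    and [measurable]: "v \<in> borel_measurable borel" and t: "t \<in> {-1..1}"
  shows "ennreal \<bar>abel \<alpha> A B v t\<bar> \<le> ennreal (MA * MB) * abint \<alpha> v t"
proof -
  have nn: "0 \<le> MA" "0 \<le> MB" using MA[of 0] MB[of 0] by auto
  have "ennreal \<bar>abel \<alpha> A B v t\<bar> =
      ennreal \<bar>A t\<bar> * ennreal \<bar>\<integral>s. indicator {-1..1} s * (sing \<alpha> (t - s) * (B s * v s)) \<partial>lborel\<bar>"
    by (simp add: abel_def abs_mult ennreal_mult)
  also have "\<dots> \<le> ennreal MA * (ennreal MB * abint \<alpha> v t)"
    unfolding abint_def
  proof (intro mult_mono abs_integral_le_reference nn ennreal_leI MA t)
    fix s :: real assume "s \<in> {-1..1}"
    hence "\<bar>B s\<bar> * (sing \<alpha> (t - s) * \<bar>v s\<bar>) \<le> MB * (sing \<alpha> (t - s) * \<bar>v s\<bar>)"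
      using MB by (intro mult_right_mono) auto
    thus "\<bar>sing \<alpha> (t - s) * (B s * v s)\<bar> \<le> MB * (sing \<alpha> (t - s) * \<bar>v s\<bar>)"
      by (simp add: abs_mult mult_ac)
  qed auto
  finally show ?thesis using nn by (simp add: ennreal_mult mult.assoc)
qed

lemma abel_diff:
  assumes "0 < \<alpha>" "continuous_on UNIV B" "continuous_on UNIV u" "continuous_on UNIV B'" "continuous_on UNIV u'"
    and eq: "\<And>s. B s * u s - B' s * u' s = D s * v s"
  shows "abel \<alpha> A B u t - abel \<alpha> A B' u' t = abel \<alpha> A D v t"
proof -
  have i: "integrable lborel (\<lambda>s. indicator {-1..1} s * (sing \<alpha> (t - s) * (B s * u s)))"
    "integrable lborel (\<lambda>s. indicator {-1..1} s * (sing \<alpha> (t - s) * (B' s * u' s)))"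
    by (intro abel_integrable assms continuous_intros)+
  have "(\<integral>s. indicator {-1..1} s * (sing \<alpha> (t - s) * (D s * v s)) \<partial>lborel) =
      (\<integral>s. indicator {-1..1} s * (sing \<alpha> (t - s) * (B s * u s)) -
        indicator {-1..1} s * (sing \<alpha> (t - s) * (B' s * u' s)) \<partial>lborel)"
    unfolding eq[symmetric]
    by (rule Bochner_Integration.integral_cong) (simp_all add: right_diff_distrib)
  also have "\<dots> = (\<integral>s. indicator {-1..1} s * (sing \<alpha> (t - s) * (B s * u s)) \<partial>lborel) -
      (\<integral>s. indicator {-1..1} s * (sing \<alpha> (t - s) * (B' s * u' s)) \<partial>lborel)"
    using i by (rule Bochner_Integration.integral_diff)
  finally show ?thesis by (simp only: abel_def right_diff_distrib)
qed

text \<open>The error of replacing the kernel by a polynomial kernel.\<close>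

lemma kernel_difference:
  assumes \<alpha>: "0 < \<alpha>" and AB: "continuous_on UNIV B"
    and K: "\<forall>t\<in>{-1..1}. \<forall>s\<in>{-1..1}. \<bar>A t * (sing \<alpha> (t - s) * B s) - poly2 K t s\<bar> \<le> e * (1 + sing (\<alpha>/2) (t - s))"
    and e: "0 < e" and t: "t \<in> {-1..1}"
  shows "ennreal \<bar>abel \<alpha> A B (poly U) t - wint 1 (poly K [:t:] * U)\<bar> \<le>
    ennreal e * ((\<integral>\<^sup>+s\<in>{-1..1}. ennreal \<bar>poly U s\<bar> \<partial>lborel) + abint (\<alpha>/2) (poly U) t)"
proof -
  have i1: "integrable lborel (\<lambda>s. A t * (indicator {-1..1} s * (sing \<alpha> (t - s) * (B s * poly U s))))"
    by (intro integrable_mult_right abel_integrable \<alpha> continuous_intros AB)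
  have i2: "integrable lborel (\<lambda>s. indicator {-1..1} s * poly (poly K [:t:] * U) s)"
  proof -
    have "continuous_on {-1..1} (poly (poly K [:t:] * U))" by (intro continuous_intros)
    from borel_integrable_atLeastAtMost'[OF this] show ?thesis
      unfolding set_integrable_def by simp
  qed
  have "abel \<alpha> A B (poly U) t - wint 1 (poly K [:t:] * U) =
      (\<integral>s. A t * (indicator {-1..1} s * (sing \<alpha> (t - s) * (B s * poly U s))) - indicator {-1..1} s * poly (poly K [:t:] * U) s \<partial>lborel)"
    unfolding abel_def wint_1_Icc using i1 i2 by (subst Bochner_Integration.integral_diff) auto
  also have "\<dots> = (\<integral>s. indicator {-1..1} s * ((A t * (sing \<alpha> (t - s) * B s) - poly2 K t s) * poly U s) \<partial>lborel)"
    by (intro Bochner_Integration.integral_cong) (auto simp: algebra_simps)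
  finally have eq: "abel \<alpha> A B (poly U) t - wint 1 (poly K [:t:] * U) =
      (\<integral>s. indicator {-1..1} s * ((A t * (sing \<alpha> (t - s) * B s) - poly2 K t s) * poly U s) \<partial>lborel)" .
  have "ennreal \<bar>abel \<alpha> A B (poly U) t - wint 1 (poly K [:t:] * U)\<bar> \<le>
      ennreal e * (\<integral>\<^sup>+s\<in>{-1..1}. ennreal (\<bar>poly U s\<bar> + sing (\<alpha>/2) (t - s) * \<bar>poly U s\<bar>) \<partial>lborel)"
    unfolding eq
  proof (rule abs_integral_le_reference)
    fix s :: real assume "s \<in> {-1..1}"
    hence "\<bar>A t * (sing \<alpha> (t - s) * B s) - poly2 K t s\<bar> * \<bar>poly U s\<bar> \<le> e * (1 + sing (\<alpha>/2) (t - s)) * \<bar>poly U s\<bar>"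
      using K t by (intro mult_right_mono) auto
    thus "\<bar>(A t * (sing \<alpha> (t - s) * B s) - poly2 K t s) * poly U s\<bar> \<le>
        e * (\<bar>poly U s\<bar> + sing (\<alpha>/2) (t - s) * \<bar>poly U s\<bar>)"
      unfolding abs_mult by (simp add: algebra_simps)
  qed (use e in auto)
  moreover have "(\<integral>\<^sup>+s\<in>{-1..1}. ennreal (\<bar>poly U s\<bar> + sing (\<alpha>/2) (t - s) * \<bar>poly U s\<bar>) \<partial>lborel) =
      (\<integral>\<^sup>+s\<in>{-1..1}. ennreal \<bar>poly U s\<bar> \<partial>lborel) + abint (\<alpha>/2) (poly U) t"
    unfolding abint_def by (subst nn_integral_add[symmetric]) (auto simp: distrib_right)
  ultimately show ?thesis by (simp only:)
qed

text \<open>The error of the Gauss-Jacobi rule. The intermediate term \<open>S\<close> is the rule with \<open>B\<close> replaced by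
  a polynomial \<open>b\<close>; there the integrand has degree at most \<open>2 N\<close> in \<open>\<theta>\<close> and the rule is exact.\<close>

lemma colloc_difference:
  assumes \<alpha>: "0 < \<alpha>" "\<alpha> < 1" and B: "continuous_on UNIV B"
    and M: "0 \<le> M" "\<forall>t\<in>{-1..1}. \<bar>A t\<bar> \<le> M"
    and b: "\<forall>t\<in>{-1..1}. \<bar>B t - poly b t\<bar> \<le> e" and e: "0 < e"
    and N: "degree b \<le> N" "degree U \<le> N" and t: "t \<in> {-1..1}"
  shows "ennreal \<bar>colloc \<alpha> A B N U t - abel \<alpha> A B (poly U) t\<bar> \<le>
    ennreal (e * M) * (absum \<alpha> N U t + 2 * abint (\<alpha>/2) (poly U) t)"
proof -
  define X where "X = gnodes \<alpha> N"
  define w where "w \<theta> = gw \<alpha> N \<theta>" for \<theta>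
  define c where "c = ((t + 1) / 2) powr \<alpha>"
  note X = jacobi_nodes[where N = N, OF \<alpha>(1), folded X_def]
  have w: "0 < w \<theta>" if "\<theta> \<in> X" for \<theta> using X(5) that unfolding w_def X_def by blast
  have c: "0 \<le> c" "c \<le> 1" using t \<alpha> powr_mono2[of \<alpha> "(t + 1) / 2" 1] by (auto simp: c_def)
  have muX: "mu t \<theta> \<in> {-1..1}" if "\<theta> \<in> X" for \<theta>
    using X(3) that t by (intro mu_in_reference) auto
  define S where "S = (\<Sum>\<theta>\<in>X. w \<theta> * (poly b (mu t \<theta>) * poly U (mu t \<theta>)))"
  have "ennreal \<bar>colloc \<alpha> A B N U t - c * A t * S\<bar> \<le> ennreal (e * M) * absum \<alpha> N U t"
  proof -
    have "colloc \<alpha> A B N U t - c * A t * S =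
        c * A t * (\<Sum>\<theta>\<in>X. w \<theta> * ((B (mu t \<theta>) - poly b (mu t \<theta>)) * poly U (mu t \<theta>)))"
      unfolding colloc_def S_def X_def w_def c_def
      by (simp add: right_diff_distrib left_diff_distrib sum_subtractf)
    also have "\<bar>\<dots>\<bar> \<le> 1 * M * (\<Sum>\<theta>\<in>X. e * (w \<theta> * \<bar>poly U (mu t \<theta>)\<bar>))"
      unfolding abs_mult
    proof (intro mult_mono, goal_cases)
      case 5
      show ?case
      proof (rule order_trans[OF sum_abs], rule sum_mono)
        fix \<theta> assume \<theta>: "\<theta> \<in> X"
        have "w \<theta> * (\<bar>B (mu t \<theta>) - poly b (mu t \<theta>)\<bar> * \<bar>poly U (mu t \<theta>)\<bar>) \<le> w \<theta> * (e * \<bar>poly U (mu t \<theta>)\<bar>)"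
          using w[OF \<theta>] muX[OF \<theta>] b by (intro mult_left_mono mult_right_mono) auto
        thus "\<bar>w \<theta> * ((B (mu t \<theta>) - poly b (mu t \<theta>)) * poly U (mu t \<theta>))\<bar> \<le> e * (w \<theta> * \<bar>poly U (mu t \<theta>)\<bar>)"
          using w[OF \<theta>] by (simp add: abs_mult mult_ac)
      qed
    qed (use c M t in auto)
    finally have "\<bar>colloc \<alpha> A B N U t - c * A t * S\<bar> \<le> e * M * (\<Sum>\<theta>\<in>X. w \<theta> * \<bar>poly U (mu t \<theta>)\<bar>)"
      by (simp add: sum_distrib_left[symmetric] mult_ac)
    hence "ennreal \<bar>colloc \<alpha> A B N U t - c * A t * S\<bar> \<le> ennreal (e * M * (\<Sum>\<theta>\<in>X. w \<theta> * \<bar>poly U (mu t \<theta>)\<bar>))"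
      by (rule ennreal_leI)
    also have "\<dots> = ennreal (e * M) * absum \<alpha> N U t"
      unfolding absum_def X_def w_def using e M by (intro ennreal_mult') simp
    finally show ?thesis .
  qed
  moreover have "ennreal \<bar>c * A t * S - abel \<alpha> A B (poly U) t\<bar> \<le> ennreal (e * M) * (2 * abint (\<alpha>/2) (poly U) t)"
  proof -
    define m where "m = [:(t - 1) / 2, (t + 1) / 2:]"
    have m: "poly m \<theta> = mu t \<theta>" for \<theta> by (simp add: m_def mu_def)
    have "degree m \<le> 1" by (simp add: m_def)
    hence "degree (b * U) * degree m \<le> (2 * N) * 1"
      using degree_mult_le[of b U] N by (intro mult_mono) auto
    hence "degree (pcompose (b * U) m) < 2 * Suc N"
      by (intro le_less_trans[OF degree_pcompose_le]) simp
    hence "S = wint \<alpha> (pcompose (b * U) m)"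
      using X(4)[of "pcompose (b * U) m"] by (simp add: S_def w_def X_def poly_pcompose m)
    also have "\<dots> = (\<integral>\<theta>. jw \<alpha> \<theta> * poly (b * U) (mu t \<theta>) \<partial>lborel)"
      by (simp add: wint_def poly_pcompose m)
    finally have "c * S = (\<integral>s. indicator {-1..1} s * (sing \<alpha> (t - s) * poly (b * U) s) \<partial>lborel)"
      using t by (subst abel_integral_mu) (auto simp: c_def)
    hence "c * A t * S = abel \<alpha> A (poly b) (poly U) t" by (simp add: abel_def mult_ac)
    hence "c * A t * S - abel \<alpha> A B (poly U) t = abel \<alpha> A (\<lambda>s. poly b s - B s) (poly U) t"
      using abel_diff[OF \<alpha>(1), of "poly b" "poly U" B "poly U" "\<lambda>s. poly b s - B s" "poly U"] B
      by (simp add: left_diff_distrib continuous_intros)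
    also have "ennreal \<bar>\<dots>\<bar> \<le> ennreal (M * e) * abint \<alpha> (poly U) t"
      using M b t by (intro abel_le_abint) (auto simp: abs_minus_commute)
    also have "\<dots> \<le> ennreal (M * e) * (2 * abint (\<alpha>/2) (poly U) t)"
      using t by (intro mult_left_mono abint_half \<alpha>) auto
    finally show ?thesis by (simp add: mult.commute)
  qed
  ultimately have "ennreal \<bar>colloc \<alpha> A B N U t - c * A t * S\<bar> + ennreal \<bar>c * A t * S - abel \<alpha> A B (poly U) t\<bar>
    \<le> ennreal (e * M) * absum \<alpha> N U t + ennreal (e * M) * (2 * abint (\<alpha>/2) (poly U) t)"
    by (rule add_mono)
  moreover have "ennreal \<bar>colloc \<alpha> A B N U t - abel \<alpha> A B (poly U) t\<bar> \<le>
     ennreal \<bar>colloc \<alpha> A B N U t - c * A t * S\<bar> + ennreal \<bar>c * A t * S - abel \<alpha> A B (poly U) t\<bar>"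
    using ennreal_abs_triangle[of "colloc \<alpha> A B N U t - c * A t * S" "c * A t * S - abel \<alpha> A B (poly U) t"] by simp
  ultimately show ?thesis by (simp add: distrib_left)
qed

lemma abel_measurable [measurable]:
  assumes [measurable]: "A \<in> borel_measurable borel" "B \<in> borel_measurable borel" "v \<in> borel_measurable borel"
  shows "abel \<alpha> A B v \<in> borel_measurable borel"
  unfolding abel_def by measurable

lemma abint_discrete_bound:
  assumes "1 \<le> N" "degree U \<le> N" "0 < \<beta>"
  shows "(\<Sum>t\<in>lgl_nodes N. ennreal (lw N t) * (abint \<beta> (poly U) t)\<^sup>2) \<le> 6 * (hardy_const \<beta>)\<^sup>2 * n2 (poly U)"
proof -
  have "(\<Sum>t\<in>lgl_nodes N. ennreal (lw N t) * (abint \<beta> (poly U) t)\<^sup>2) \<le>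
      (\<Sum>t\<in>lgl_nodes N. ennreal (lw N t) * (\<integral>\<^sup>+\<theta>. ennreal (jw \<beta> \<theta> * \<bar>poly U (mu t \<theta>)\<bar>) \<partial>lborel)\<^sup>2)"
    by (intro sum_mono mult_left_mono power_mono abint_le_mu)
      (use leg.lgl_nodes(3)[OF assms(1)] assms(3) in auto)
  also have "\<dots> \<le> 6 * (hardy_const \<beta>)\<^sup>2 * n2 (poly U)"
    unfolding n2_poly by (rule lgl_hardy_integral[OF assms])
  finally show ?thesis .
qed

lemma absum_discrete_bound:
  assumes "1 \<le> N" "degree U \<le> N" "0 < \<beta>"
  shows "(\<Sum>t\<in>lgl_nodes N. ennreal (lw N t) * (absum \<beta> N U t)\<^sup>2) \<le> 6 * (hardy_const \<beta>)\<^sup>2 * n2 (poly U)"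
proof -
  have d: "degree (jacobi (\<beta> - 1) 0 (N + 1)) = Suc N" using jacobi_properties(2)[OF assms(3)] by simp
  have o: "wint \<beta> (jacobi (\<beta> - 1) 0 (N + 1) * q) = 0" if "degree q < Suc N" for q
    using jacobi_properties(3)[OF assms(3), of q "N + 1"] that by simp
  show ?thesis unfolding absum_def n2_poly jacobi_gauss_nodes_def
    by (rule lgl_hardy_gauss[OF assms jacobi_properties(1)[OF assms(3)] d o])
qed

lemma abint_n2_bound:
  assumes "0 < \<beta>" and [measurable]: "v \<in> borel_measurable borel"
  shows "(\<integral>\<^sup>+t\<in>{-1..1}. (abint \<beta> v t)\<^sup>2 \<partial>lborel) \<le> (volterra_const \<beta> 0)\<^sup>2 * n2 v"
  using abel_young[OF assms, of 0] by (simp add: n2_def wn2_def)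

text \<open>The squared norm of \<open>p\<^sub>N K\<^sub>N U - K U\<close>.\<close>

abbreviation consistency_error where
  "consistency_error \<alpha> A B N U \<equiv> n2 (\<lambda>t. poly (lgl_interp N (colloc \<alpha> A B N U)) t - abel \<alpha> A B (poly U) t)"

text \<open>The consistency error is small relative to the norm of the polynomial, uniformly over all
  polynomials of degree at most \<open>N\<close>. Everything is compared with the integral operator whose
  kernel is a polynomial in both variables: it maps into polynomials of bounded degree, which the
  interpolation reproduces.\<close>

lemma consistency:
  assumes \<alpha>: "0 < \<alpha>" "\<alpha> < 1" and A: "continuous_on UNIV A" and B: "continuous_on UNIV B"
  shows "\<exists>C<\<infinity>. \<forall>e>0. \<exists>N0. \<forall>N\<ge>N0. \<forall>U. degree U \<le> N \<longrightarrow>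
    consistency_error \<alpha> A B N U \<le> C * ennreal (e\<^sup>2) * n2 (poly U)"
proof -
  obtain M where M: "0 \<le> M" "\<forall>t\<in>{-1..1}. \<bar>A t\<bar> \<le> M" using bounded_on_reference[OF A] by blast
  have [measurable]: "A \<in> borel_measurable borel" "B \<in> borel_measurable borel"
    using A B by (auto intro: borel_measurable_continuous_onI)
  define h1 h2 k where "h1 = 6 * (hardy_const \<alpha>)\<^sup>2" and "h2 = 6 * (hardy_const (\<alpha>/2))\<^sup>2" and "k = (volterra_const (\<alpha>/2) 0)\<^sup>2"
  define m1 m2 where "m1 = (ennreal M)\<^sup>2" and "m2 = (ennreal (2 * M + 1))\<^sup>2"
  define C1 where "C1 = 3 * (m1 * h1 + m2 * h2 + 4)"
  define C2 where "C2 = 2 * (4 + k)"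
  have fin: "h1 < \<infinity>" "h2 < \<infinity>" "k < \<infinity>"
    using hardy_const_finite[of \<alpha>] hardy_const_finite[of "\<alpha>/2"] volterra_const_0[of "\<alpha>/2"] \<alpha>
    by (auto simp: h1_def h2_def k_def ennreal_mult_less_top power_less_top_ennreal)
  have "2 * (C1 + C2) < \<infinity>"
    unfolding C1_def C2_def m1_def m2_def using fin by (auto simp: ennreal_mult_less_top power_less_top_ennreal)
  moreover have "\<exists>N0. \<forall>N\<ge>N0. \<forall>U. degree U \<le> N \<longrightarrow>
      consistency_error \<alpha> A B N U \<le> 2 * (C1 + C2) * ennreal (e\<^sup>2) * n2 (poly U)"
    if e: "0 < e" for e
  proof -
    have cont: "continuous_on {-1..1} A" "continuous_on {-1..1} B" using A B continuous_on_subset by blast+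
    obtain K where K: "\<forall>t\<in>{-1..1}. \<forall>s\<in>{-1..1}.
        \<bar>A t * (sing \<alpha> (t - s) * B s) - poly2 K t s\<bar> \<le> e * (1 + sing (\<alpha>/2) (t - s))"
      using kernel_approximation[OF \<alpha> cont e] by blast
    obtain b where b: "\<forall>t\<in>{-1..1}. \<bar>B t - poly b t\<bar> \<le> e" using poly_approximation[OF cont(2) e] by blast
    have "consistency_error \<alpha> A B N U \<le> 2 * (C1 + C2) * ennreal (e\<^sup>2) * n2 (poly U)"
      if N: "1 \<le> N" "degree K \<le> N" "degree b \<le> N" and U: "degree U \<le> N" for N U
    proof -
      obtain q where q: "degree q \<le> degree K" "\<And>t. poly q t = wint 1 (poly K [:t:] * U)"
        using poly2_integral by blast
      define L where "L = (\<integral>\<^sup>+s\<in>{-1..1}. ennreal \<bar>poly U s\<bar> \<partial>lborel)"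
      define H where "H = abint (\<alpha>/2) (poly U)"
      define G where "G = absum \<alpha> N U"
      define W where "W = n2 (poly U)"
      have L2: "L\<^sup>2 \<le> 2 * W" unfolding L_def W_def by (rule L1_le_n2) measurable
      have kd: "ennreal \<bar>abel \<alpha> A B (poly U) t - poly q t\<bar> \<le> ennreal e * (L + H t)" if "t \<in> {-1..1}" for t
        unfolding q(2) L_def H_def by (rule kernel_difference[OF \<alpha>(1) B K e that])
      have cd: "ennreal \<bar>colloc \<alpha> A B N U t - abel \<alpha> A B (poly U) t\<bar> \<le> ennreal (e * M) * (G t + 2 * H t)"
        if "t \<in> {-1..1}" for t
        unfolding G_def H_def by (rule colloc_difference[OF \<alpha> B M b e N(3) U that])
      have node: "(ennreal \<bar>colloc \<alpha> A B N U t - poly q t\<bar>)\<^sup>2 \<le>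
          ennreal (e\<^sup>2) * (3 * (m1 * (G t)\<^sup>2 + m2 * (H t)\<^sup>2 + L\<^sup>2))"
        if t: "t \<in> {-1..1}" for t
      proof -
        have "ennreal \<bar>colloc \<alpha> A B N U t - poly q t\<bar> \<le>
            ennreal \<bar>colloc \<alpha> A B N U t - abel \<alpha> A B (poly U) t\<bar> + ennreal \<bar>abel \<alpha> A B (poly U) t - poly q t\<bar>"
          using ennreal_abs_triangle[of "colloc \<alpha> A B N U t - abel \<alpha> A B (poly U) t" "abel \<alpha> A B (poly U) t - poly q t"]
          by simp
        also have "\<dots> \<le> ennreal (e * M) * (G t + 2 * H t) + ennreal e * (L + H t)"
          by (intro add_mono cd kd t)
        also have "\<dots> = ennreal e * (ennreal M * G t + ennreal (2 * M + 1) * H t + L)"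
          using e M(1) by (simp add: ennreal_mult algebra_simps)
        finally have "(ennreal \<bar>colloc \<alpha> A B N U t - poly q t\<bar>)\<^sup>2 \<le>
            (ennreal e * (ennreal M * G t + ennreal (2 * M + 1) * H t + L))\<^sup>2"
          by (intro power_mono) auto
        also have "\<dots> = ennreal (e\<^sup>2) * (ennreal M * G t + ennreal (2 * M + 1) * H t + L)\<^sup>2"
          using e by (simp add: power_mult_distrib ennreal_power)
        also have "\<dots> \<le> ennreal (e\<^sup>2) * (3 * ((ennreal M * G t)\<^sup>2 + (ennreal (2 * M + 1) * H t)\<^sup>2 + L\<^sup>2))"
          by (intro mult_left_mono ennreal_power2_add3_le) auto
        finally show ?thesis by (simp only: power_mult_distrib m1_def m2_def)
      qed
      have "n2 (\<lambda>t. poly (lgl_interp N (colloc \<alpha> A B N U)) t - poly q t) =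
          n2 (poly (lgl_interp N (\<lambda>t. colloc \<alpha> A B N U t - poly q t)))"
        using lgl_interp_diff[OF N(1), of "colloc \<alpha> A B N U" "poly q"] lgl_interp_poly[OF N(1), of q] q(1) N(2)
        by (metis order_trans poly_diff)
      also have "\<dots> \<le> (\<Sum>t\<in>lgl_nodes N. ennreal (lw N t) * (ennreal \<bar>colloc \<alpha> A B N U t - poly q t\<bar>)\<^sup>2)"
        by (rule n2_lgl_interp_le[OF N(1)])
      also have "\<dots> \<le> (\<Sum>t\<in>lgl_nodes N. ennreal (lw N t) *
          (ennreal (e\<^sup>2) * (3 * (m1 * (G t)\<^sup>2 + m2 * (H t)\<^sup>2 + L\<^sup>2))))"
        by (intro sum_mono mult_left_mono node) (use leg.lgl_nodes(3)[OF N(1)] in auto)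
      also have "\<dots> = ennreal (e\<^sup>2) * (3 * (m1 * (\<Sum>t\<in>lgl_nodes N. ennreal (lw N t) * (G t)\<^sup>2) +
          m2 * (\<Sum>t\<in>lgl_nodes N. ennreal (lw N t) * (H t)\<^sup>2) + (\<Sum>t\<in>lgl_nodes N. ennreal (lw N t)) * L\<^sup>2))"
        by (simp add: sum_distrib_left sum_distrib_right sum.distrib distrib_left mult_ac)
      also have "(\<Sum>t\<in>lgl_nodes N. ennreal (lw N t)) = 2"
        using lgl_weights_sum[OF N(1)] lgl_weights_nonneg[OF N(1)] by (subst sum_ennreal) auto
      also have "ennreal (e\<^sup>2) * (3 * (m1 * (\<Sum>t\<in>lgl_nodes N. ennreal (lw N t) * (G t)\<^sup>2) +
          m2 * (\<Sum>t\<in>lgl_nodes N. ennreal (lw N t) * (H t)\<^sup>2) + 2 * L\<^sup>2)) \<le>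
          ennreal (e\<^sup>2) * (3 * (m1 * (h1 * W) + m2 * (h2 * W) + 2 * (2 * W)))"
        unfolding G_def H_def h1_def h2_def W_def
        using \<alpha> L2 by (intro mult_left_mono add_mono absum_discrete_bound abint_discrete_bound N U) (auto simp: W_def)
      also have "\<dots> = C1 * ennreal (e\<^sup>2) * W"
        by (simp add: C1_def algebra_simps)
      finally have 1: "n2 (\<lambda>t. poly (lgl_interp N (colloc \<alpha> A B N U)) t - poly q t) \<le> C1 * ennreal (e\<^sup>2) * W" .
      have "n2 (\<lambda>t. poly q t - abel \<alpha> A B (poly U) t) \<le>
          (\<integral>\<^sup>+t. ennreal (e\<^sup>2) * (2 * (L\<^sup>2 * indicator {-1..1} t + (H t)\<^sup>2 * indicator {-1..1} t)) \<partial>lborel)"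
        unfolding n2_def
      proof (rule nn_integral_mono)
        fix t :: real
        show "ennreal ((poly q t - abel \<alpha> A B (poly U) t)\<^sup>2) * indicator {-1..1} t \<le>
           ennreal (e\<^sup>2) * (2 * (L\<^sup>2 * indicator {-1..1} t + (H t)\<^sup>2 * indicator {-1..1} t))"
        proof (cases "t \<in> {-1..1}")
          case True
          have "ennreal ((poly q t - abel \<alpha> A B (poly U) t)\<^sup>2) = (ennreal \<bar>abel \<alpha> A B (poly U) t - poly q t\<bar>)\<^sup>2"
            by (simp add: ennreal_power2_abs abs_minus_commute)
          also have "\<dots> \<le> (ennreal e * (L + H t))\<^sup>2" using kd[OF True] by (intro power_mono) auto
          also have "\<dots> = ennreal (e\<^sup>2) * (L + H t)\<^sup>2" using e by (simp add: power_mult_distrib ennreal_power)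
          also have "\<dots> \<le> ennreal (e\<^sup>2) * (2 * (L\<^sup>2 + (H t)\<^sup>2))"
            by (intro mult_left_mono ennreal_power2_add_le) auto
          finally show ?thesis using True by simp
        qed simp
      qed
      also have "\<dots> = ennreal (e\<^sup>2) * (2 * (L\<^sup>2 * 2 + (\<integral>\<^sup>+t\<in>{-1..1}. (H t)\<^sup>2 \<partial>lborel)))"
        unfolding H_def by (simp add: nn_integral_cmult nn_integral_add)
      also have "\<dots> \<le> ennreal (e\<^sup>2) * (2 * ((2 * W) * 2 + k * W))"
        unfolding k_def H_def W_def using \<alpha> L2
        by (intro mult_left_mono add_mono mult_right_mono abint_n2_bound) (auto simp: W_def)
      also have "\<dots> = C2 * ennreal (e\<^sup>2) * W" by (simp add: C2_def algebra_simps)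
      finally have 2: "n2 (\<lambda>t. poly q t - abel \<alpha> A B (poly U) t) \<le> C2 * ennreal (e\<^sup>2) * W" .
      have "consistency_error \<alpha> A B N U =
          n2 (\<lambda>t. (poly (lgl_interp N (colloc \<alpha> A B N U)) t - poly q t) + (poly q t - abel \<alpha> A B (poly U) t))"
        by simp
      also have "\<dots> \<le> 2 * (n2 (\<lambda>t. poly (lgl_interp N (colloc \<alpha> A B N U)) t - poly q t) + n2 (\<lambda>t. poly q t - abel \<alpha> A B (poly U) t))"
        by (rule n2_add_le) measurable
      also have "\<dots> \<le> 2 * (C1 * ennreal (e\<^sup>2) * W + C2 * ennreal (e\<^sup>2) * W)"
        by (intro mult_left_mono add_mono 1 2) auto
      also have "\<dots> = 2 * (C1 + C2) * ennreal (e\<^sup>2) * n2 (poly U)"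
        by (simp add: W_def algebra_simps)
      finally show ?thesis .
    qed
    thus ?thesis by (intro exI[of _ "max 1 (max (degree K) (degree b))"]) auto
  qed
  ultimately show ?thesis by blast
qed

section \<open>Stability of the Volterra equation\<close>

lemma n2_finite:
  assumes "continuous_on UNIV u" shows "n2 u < \<infinity>"
proof -
  obtain M where "\<forall>t\<in>{-1..1}. \<bar>u t\<bar> \<le> M" using bounded_on_reference[OF assms] by blast
  hence "n2 u \<le> 2 * ennreal (M\<^sup>2)" by (intro n2_le) auto
  also have "\<dots> < \<infinity>" by (simp add: ennreal_mult_less_top)
  finally show ?thesis .
qed

lemma wn2_le_n2:
  assumes "0 \<le> l" and [measurable]: "u \<in> borel_measurable borel"
  shows "wn2 l u \<le> ennreal (exp (2 * l)) * n2 u"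
  unfolding wn2_def n2_def
proof (rule nn_integral_reference_mono)
  fix t :: real assume "t \<in> {-1..1}"
  thus "exp (- 2 * l * t) * (u t)\<^sup>2 \<le> exp (2 * l) * (u t)\<^sup>2"
    using mult_left_mono[of "- t" 1 l] assms(1) by (intro mult_right_mono) auto
qed auto

lemma n2_le_wn2:
  assumes "0 \<le> l" and [measurable]: "u \<in> borel_measurable borel"
  shows "n2 u \<le> ennreal (exp (2 * l)) * wn2 l u"
  unfolding wn2_def n2_def
proof (rule nn_integral_reference_mono)
  fix t :: real assume t: "t \<in> {-1..1}"
  have "0 \<le> 2 * l + - 2 * l * t" using mult_left_mono[of t 1 l] assms(1) t by simp
  hence "1 \<le> exp (2 * l + - 2 * l * t)" by simp
  hence "1 * (u t)\<^sup>2 \<le> exp (2 * l + - 2 * l * t) * (u t)\<^sup>2" by (intro mult_right_mono) auto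
  thus "(u t)\<^sup>2 \<le> exp (2 * l) * (exp (- 2 * l * t) * (u t)\<^sup>2)"
    unfolding exp_add by (simp add: mult.assoc)
qed auto

text \<open>An exponential weight makes the integral operator a contraction, by \<open>abel_young\<close>. The constant
  \<open>C\<close> absorbs the comparison of the weighted with the unweighted norm.\<close>

lemma volterra_stability:
  assumes \<alpha>: "0 < \<alpha>" "\<alpha> \<le> 1" and A: "continuous_on UNIV A" and B: "continuous_on UNIV B"
  shows "\<exists>C<\<infinity>. \<forall>v r. continuous_on UNIV v \<longrightarrow> r \<in> borel_measurable borel \<longrightarrow>
    (\<forall>t\<in>{-1..1}. v t = abel \<alpha> A B v t + r t) \<longrightarrow> n2 v \<le> C * n2 r"
proof -
  obtain MA where MA: "0 \<le> MA" "\<And>t. t \<in> {-1..1} \<Longrightarrow> \<bar>A t\<bar> \<le> MA" using bounded_on_reference[OF A] by blast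
  obtain MB where MB: "0 \<le> MB" "\<And>t. t \<in> {-1..1} \<Longrightarrow> \<bar>B t\<bar> \<le> MB" using bounded_on_reference[OF B] by blast
  define M where "M = MA * MB"
  have M: "0 \<le> M" using MA MB by (simp add: M_def)
  \<comment> \<open>Bounding \<open>volterra_const\<close> by \<open>d\<close> leaves the factor \<open>2 (M d)\<^sup>2 \<le> 1/2\<close> in front of the weighted norm.\<close>
  define d where "d = 1 / (2 * (M + 1))"
  have d: "0 < d" "2 * (M * d)\<^sup>2 \<le> 1 / 2"
  proof -
    show "0 < d" using M by (simp add: d_def)
    have "M * d \<le> 1 / 2" "0 \<le> M * d" using M by (auto simp: d_def field_simps)
    hence "(M * d)\<^sup>2 \<le> (1 / 2)\<^sup>2" by (intro power_mono)
    thus "2 * (M * d)\<^sup>2 \<le> 1 / 2" by (simp add: power2_eq_square)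
  qed
  obtain l where l: "0 < l" "volterra_const \<alpha> l \<le> ennreal d"
    using volterra_const_small[OF \<alpha> d(1)] by blast
  define C where "C = ennreal (4 * exp (4 * l))"
  have "n2 v \<le> C * n2 r" if v: "continuous_on UNIV v" and [measurable]: "r \<in> borel_measurable borel"
    and eq: "\<forall>t\<in>{-1..1}. v t = abel \<alpha> A B v t + r t" for v r
  proof (cases "n2 r = \<infinity>")
    case True
    thus ?thesis by (simp add: C_def ennreal_mult_top)
  next
    case False
    then obtain R where R: "0 \<le> R" "n2 r = ennreal R" by (cases "n2 r") auto
    have [measurable]: "v \<in> borel_measurable borel" using v by (rule borel_measurable_continuous_onI)
    have "wn2 l v \<le> (\<integral>\<^sup>+t. ennreal (2 * M\<^sup>2) * (ennreal (exp (- 2 * l * t)) * (abint \<alpha> v t)\<^sup>2 * indicator {-1..1} t) +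
        2 * (ennreal (exp (- 2 * l * t) * (r t)\<^sup>2) * indicator {-1..1} t) \<partial>lborel)"
      unfolding wn2_def
    proof (rule nn_integral_mono)
      fix t :: real
      show "ennreal (exp (- 2 * l * t) * (v t)\<^sup>2) * indicator {-1..1} t \<le>
          ennreal (2 * M\<^sup>2) * (ennreal (exp (- 2 * l * t)) * (abint \<alpha> v t)\<^sup>2 * indicator {-1..1} t) +
          2 * (ennreal (exp (- 2 * l * t) * (r t)\<^sup>2) * indicator {-1..1} t)"
      proof (cases "t \<in> {-1..1}")
        case True
        have "ennreal \<bar>v t\<bar> \<le> ennreal \<bar>abel \<alpha> A B v t\<bar> + ennreal \<bar>r t\<bar>"
          using eq True ennreal_abs_triangle[of "abel \<alpha> A B v t" "r t"] by simp
        also have "\<dots> \<le> ennreal M * abint \<alpha> v t + ennreal \<bar>r t\<bar>"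
          unfolding M_def using MA(2) MB(2) True by (intro add_mono abel_le_abint) auto
        finally have "(ennreal \<bar>v t\<bar>)\<^sup>2 \<le> (ennreal M * abint \<alpha> v t + ennreal \<bar>r t\<bar>)\<^sup>2"
          by (intro power_mono) auto
        also have "\<dots> \<le> 2 * ((ennreal M * abint \<alpha> v t)\<^sup>2 + (ennreal \<bar>r t\<bar>)\<^sup>2)"
          by (rule ennreal_power2_add_le)
        also have "\<dots> = ennreal (2 * M\<^sup>2) * (abint \<alpha> v t)\<^sup>2 + 2 * ennreal ((r t)\<^sup>2)"
          using M by (simp add: power_mult_distrib ennreal_power ennreal_mult distrib_left mult.assoc ennreal_power2_abs[symmetric])
        finally have "ennreal (exp (- 2 * l * t)) * ennreal ((v t)\<^sup>2) \<le> ennreal (exp (- 2 * l * t)) *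
            (ennreal (2 * M\<^sup>2) * (abint \<alpha> v t)\<^sup>2 + 2 * ennreal ((r t)\<^sup>2))"
          unfolding ennreal_power2_abs by (intro mult_left_mono) auto
        thus ?thesis using True by (simp add: ennreal_mult distrib_left mult_ac)
      qed simp
    qed
    also have "\<dots> = ennreal (2 * M\<^sup>2) * (\<integral>\<^sup>+t\<in>{-1..1}. ennreal (exp (- 2 * l * t)) * (abint \<alpha> v t)\<^sup>2 \<partial>lborel) + 2 * wn2 l r"
      unfolding wn2_def by (subst nn_integral_add, measurable, subst nn_integral_cmult, measurable, subst nn_integral_cmult, measurable)
    also have "\<dots> \<le> ennreal (2 * M\<^sup>2) * ((ennreal d)\<^sup>2 * wn2 l v) + 2 * (ennreal (exp (2 * l)) * n2 r)"
    proof (intro add_mono mult_left_mono)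
      have "(\<integral>\<^sup>+t\<in>{-1..1}. ennreal (exp (- 2 * l * t)) * (abint \<alpha> v t)\<^sup>2 \<partial>lborel) \<le> (volterra_const \<alpha> l)\<^sup>2 * wn2 l v"
        by (rule abel_young[OF \<alpha>(1)]) measurable
      also have "\<dots> \<le> (ennreal d)\<^sup>2 * wn2 l v" using l(2) by (intro mult_right_mono power_mono) auto
      finally show "(\<integral>\<^sup>+t\<in>{-1..1}. ennreal (exp (- 2 * l * t)) * (abint \<alpha> v t)\<^sup>2 \<partial>lborel) \<le> (ennreal d)\<^sup>2 * wn2 l v" .
    qed (use l(1) in \<open>auto intro!: wn2_le_n2\<close>)
    also have "ennreal (2 * M\<^sup>2) * ((ennreal d)\<^sup>2 * wn2 l v) = ennreal (2 * (M * d)\<^sup>2) * wn2 l v"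
      using M d(1) by (simp add: ennreal_power ennreal_mult power_mult_distrib mult.assoc)
    also have "\<dots> \<le> ennreal (1 / 2) * wn2 l v" using d(2) by (intro mult_right_mono ennreal_leI) auto
    also have "2 * (ennreal (exp (2 * l)) * n2 r) = ennreal (2 * exp (2 * l)) * n2 r"
      by (simp add: ennreal_mult mult.assoc)
    finally have E: "wn2 l v \<le> ennreal (1 / 2) * wn2 l v + ennreal (2 * exp (2 * l)) * n2 r"
      by (simp add: add_right_mono)
    have "wn2 l v \<le> ennreal (exp (2 * l)) * n2 v" using l(1) by (intro wn2_le_n2) auto
    also have "\<dots> < \<infinity>" using n2_finite[OF v] by (simp add: ennreal_mult_less_top)
    \<comment> \<open>Only a finite weighted norm can be absorbed.\<close>
    finally obtain x where x: "0 \<le> x" "wn2 l v = ennreal x" by (cases "wn2 l v") auto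
    have p: "0 \<le> 1 / 2 * x" "0 \<le> 2 * exp (2 * l) * R" using x R(1) by auto
    have "ennreal (1 / 2 * x) = ennreal (1 / 2) * ennreal x"
      "ennreal (2 * exp (2 * l) * R) = ennreal (2 * exp (2 * l)) * ennreal R"
      using x(1) R(1) by (intro ennreal_mult; simp)+
    hence "ennreal x \<le> ennreal (1 / 2 * x + 2 * exp (2 * l) * R)"
      using E unfolding x(2) R(2) by (simp only: ennreal_plus[OF p])
    moreover have "0 \<le> 1 / 2 * x + 2 * exp (2 * l) * R" using x R(1) by simp
    ultimately have "x \<le> 1 / 2 * x + 2 * exp (2 * l) * R" by (simp only: ennreal_le_iff)
    hence x4: "x \<le> 4 * exp (2 * l) * R" by simp
    have "n2 v \<le> ennreal (exp (2 * l)) * wn2 l v" using l(1) by (intro n2_le_wn2) auto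
    also have "\<dots> = ennreal (exp (2 * l) * x)" using x by (simp add: ennreal_mult)
    also have "\<dots> \<le> ennreal (exp (2 * l) * (4 * exp (2 * l) * R))" using x4 by (intro ennreal_leI mult_left_mono) auto
    also have "exp (2 * l) * (4 * exp (2 * l) * R) = 4 * exp (4 * l) * R"
      by (simp add: exp_add[symmetric] mult.left_commute[of _ 4] mult.assoc[symmetric])
    also have "ennreal \<dots> = C * n2 r" using R by (simp add: C_def ennreal_mult)
    finally show ?thesis .
  qed
  moreover have "C < \<infinity>" by (simp add: C_def)
  ultimately show ?thesis by blast
qed

section \<open>Convergence on the reference interval\<close>

lemma lgl_interp_convergence:
  assumes F: "continuous_on UNIV F" and \<eta>: "0 < \<eta>"
  shows "\<forall>\<^sub>F N in sequentially. n2 (\<lambda>t. F t - poly (lgl_interp N F) t) \<le> ennreal \<eta>"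
proof -
  define e where "e = sqrt (\<eta> / 8)"
  have e: "0 < e" "8 * e\<^sup>2 = \<eta>" using \<eta> by (auto simp: e_def)
  have [measurable]: "F \<in> borel_measurable borel" using F by (rule borel_measurable_continuous_onI)
  have "continuous_on {-1..1} F" using F continuous_on_subset by blast
  then obtain f where f: "\<forall>t\<in>{-1..1}. \<bar>F t - poly f t\<bar> \<le> e" using poly_approximation[OF _ e(1)] by blast
  have "n2 (\<lambda>t. F t - poly (lgl_interp N F) t) \<le> ennreal \<eta>" if N: "1 \<le> N" "degree f \<le> N" for N
  proof -
    have "n2 (\<lambda>t. F t - poly (lgl_interp N F) t) =
        n2 (\<lambda>t. (F t - poly f t) + poly (lgl_interp N (\<lambda>t. poly f t - F t)) t)"
      unfolding lgl_interp_diff[OF N(1), symmetric] lgl_interp_poly[OF N] by simp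
    also have "\<dots> \<le> 2 * (n2 (\<lambda>t. F t - poly f t) + n2 (poly (lgl_interp N (\<lambda>t. poly f t - F t))))"
      by (rule n2_add_le) measurable
    also have "\<dots> \<le> 2 * (2 * ennreal (e\<^sup>2) + 2 * ennreal (e\<^sup>2))"
    proof (intro mult_left_mono add_mono)
      show "n2 (\<lambda>t. F t - poly f t) \<le> 2 * ennreal (e\<^sup>2)" using f by (intro n2_le) auto
      have "n2 (poly (lgl_interp N (\<lambda>t. poly f t - F t))) \<le>
          (\<Sum>t\<in>lgl_nodes N. ennreal (lw N t) * (ennreal \<bar>poly f t - F t\<bar>)\<^sup>2)"
        by (rule n2_lgl_interp_le[OF N(1)])
      also have "\<dots> \<le> (\<Sum>t\<in>lgl_nodes N. ennreal (lw N t) * (ennreal e)\<^sup>2)"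
      proof (intro sum_mono mult_left_mono power_mono ennreal_leI)
        fix t assume "t \<in> lgl_nodes N"
        hence "t \<in> {-1..1}" using leg.lgl_nodes(3)[OF N(1)] by blast
        thus "\<bar>poly f t - F t\<bar> \<le> e" using f by (simp add: abs_minus_commute)
      qed auto
      also have "\<dots> = (\<Sum>t\<in>lgl_nodes N. ennreal (lw N t)) * (ennreal e)\<^sup>2" by (simp add: sum_distrib_right)
      also have "(\<Sum>t\<in>lgl_nodes N. ennreal (lw N t)) = 2"
        using lgl_weights_sum[OF N(1)] lgl_weights_nonneg[OF N(1)] by (subst sum_ennreal) auto
      finally show "n2 (poly (lgl_interp N (\<lambda>t. poly f t - F t))) \<le> 2 * ennreal (e\<^sup>2)"
        using e by (simp add: ennreal_power)
    qed auto
    also have "\<dots> = 8 * ennreal (e\<^sup>2)" by (simp add: mult.assoc[symmetric] distrib_right[symmetric] mult_2[symmetric])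
    also have "\<dots> = ennreal \<eta>" unfolding e(2)[symmetric] by (simp add: ennreal_mult)
    finally show ?thesis .
  qed
  thus ?thesis by (intro eventually_sequentiallyI[of "max 1 (degree f)"]) auto
qed

lemma collocation_convergence:
  assumes \<alpha>: "0 < \<alpha>" "\<alpha> < 1"
    and cont: "continuous_on UNIV A" "continuous_on UNIV B" "continuous_on UNIV F" "continuous_on UNIV Y"
    and Y: "\<forall>t\<in>{-1..1}. Y t = abel \<alpha> A B Y t + F t"
    and U: "\<forall>\<^sub>F N in sequentially. degree (U N) \<le> N \<and> (\<forall>t\<in>{-1..1}.
      poly (U N) t = poly (lgl_interp N (colloc \<alpha> A B N (U N))) t + poly (lgl_interp N F) t)"
    and \<eta>: "0 < \<eta>"
  shows "\<forall>\<^sub>F N in sequentially. n2 (\<lambda>t. Y t - poly (U N) t) \<le> ennreal \<eta>"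
proof -
  have [measurable]: "A \<in> borel_measurable borel" "B \<in> borel_measurable borel"
    "F \<in> borel_measurable borel" "Y \<in> borel_measurable borel"
    using cont by (auto intro: borel_measurable_continuous_onI)
  obtain C1' where C1': "C1' < \<infinity>" and cons': "\<forall>e>0. \<exists>N0. \<forall>N\<ge>N0. \<forall>U. degree U \<le> N \<longrightarrow>
    consistency_error \<alpha> A B N U \<le> C1' * ennreal (e\<^sup>2) * n2 (poly U)"
    using consistency[OF \<alpha> cont(1,2)] by blast
  obtain C2' where C2': "C2' < \<infinity>" and stab': "\<forall>v r. continuous_on UNIV v \<longrightarrow> r \<in> borel_measurable borel \<longrightarrow>
    (\<forall>t\<in>{-1..1}. v t = abel \<alpha> A B v t + r t) \<longrightarrow> n2 v \<le> C2' * n2 r"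
    using volterra_stability[OF \<alpha>(1) less_imp_le[OF \<alpha>(2)] cont(1,2)] by blast
  obtain C1 C2 where C: "0 \<le> C1" "C1' = ennreal C1" "0 \<le> C2" "C2' = ennreal C2"
    using C1' C2' by (cases C1'; cases C2') auto
  obtain y where y: "0 \<le> y" "n2 Y = ennreal y" using n2_finite[OF cont(4)] by (cases "n2 Y") auto
  define k where "k = 4 * C1 * C2 + 1"
  have k: "0 < k" using C by (simp add: k_def add_nonneg_pos)
  \<comment> \<open>The error \<open>x\<close> will satisfy \<open>x \<le> m (y + x) + 2 C2 z\<close>; the choices of \<open>m\<close> and \<open>z\<close> make the
    right-hand side at most \<open>\<eta>/2 + x/2\<close>.\<close>
  define m where "m = min (1/2) (\<eta> / (4 * (y + 1)))"
  have m: "0 < m" "m \<le> 1/2" "m * y \<le> \<eta> / 4"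
  proof -
    show m0: "0 < m" using \<eta> y by (simp add: m_def)
    show "m \<le> 1/2" unfolding m_def by (rule min.cobounded1)
    have "m * y \<le> m * (y + 1)" using m0 by simp
    also have "\<dots> \<le> \<eta> / (4 * (y + 1)) * (y + 1)" using y by (intro mult_right_mono) (auto simp: m_def)
    also have "\<dots> = \<eta> / 4" using y by (simp add: field_simps)
    finally show "m * y \<le> \<eta> / 4" .
  qed
  define e where "e = sqrt (m / k)"
  have e: "0 < e" "e\<^sup>2 = m / k" using m k by (auto simp: e_def)
  have ke: "4 * C1 * C2 * e\<^sup>2 \<le> m"
  proof -
    have "4 * C1 * C2 * e\<^sup>2 \<le> k * e\<^sup>2" by (intro mult_right_mono) (auto simp: k_def)
    thus ?thesis using k e by simp
  qed
  define z where "z = \<eta> / (8 * (C2 + 1))"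
  have z: "0 < z" "2 * C2 * z \<le> \<eta> / 4"
  proof -
    show "0 < z" using C \<eta> by (simp add: z_def)
    have "C2 + 1 \<noteq> 0" using C by linarith
    hence "2 * C2 * z = \<eta> / 4 * (C2 / (C2 + 1))" by (simp add: z_def divide_simps)
    also have "\<dots> \<le> \<eta> / 4 * 1" using C \<eta> by (intro mult_left_mono) auto
    finally show "2 * C2 * z \<le> \<eta> / 4" by simp
  qed
  obtain N0 where cons: "\<And>N U. N \<ge> N0 \<Longrightarrow> degree U \<le> N \<Longrightarrow>
    consistency_error \<alpha> A B N U \<le> ennreal C1 * ennreal (e\<^sup>2) * n2 (poly U)"
    using cons' e(1) C(2) by blast
  show ?thesis
    using U lgl_interp_convergence[OF cont(3) z(1)] eventually_ge_at_top[of N0]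
  proof eventually_elim
    case (elim N)
    define v where "v t = Y t - poly (U N) t" for t
    define r1 r2 where "r1 t = abel \<alpha> A B (poly (U N)) t - poly (lgl_interp N (colloc \<alpha> A B N (U N))) t"
      and "r2 t = F t - poly (lgl_interp N F) t" for t
    have [measurable]: "r1 \<in> borel_measurable borel" "r2 \<in> borel_measurable borel" "v \<in> borel_measurable borel"
      unfolding r1_def r2_def v_def by measurable
    have cv: "continuous_on UNIV v" unfolding v_def by (intro continuous_intros cont(4))
    have "\<forall>t\<in>{-1..1}. v t = abel \<alpha> A B v t + (r1 t + r2 t)"
    proof
      fix t :: real assume t: "t \<in> {-1..1}"
      have "abel \<alpha> A B v t = abel \<alpha> A B Y t - abel \<alpha> A B (poly (U N)) t"
        unfolding v_def
      by (rule abel_diff[OF \<alpha>(1) cont(2,4) cont(2), symmetric]) (auto simp: right_diff_distrib intro: continuous_intros)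
      thus "v t = abel \<alpha> A B v t + (r1 t + r2 t)"
        using bspec[OF Y t] elim(1) t by (simp add: v_def r1_def r2_def)
    qed
    hence "n2 v \<le> ennreal C2 * n2 (\<lambda>t. r1 t + r2 t)" using stab' cv C(4) by auto
    also have "\<dots> \<le> ennreal C2 * (2 * (n2 r1 + n2 r2))"
      by (intro mult_left_mono n2_add_le) auto
    also have "\<dots> \<le> ennreal C2 * (2 * (ennreal C1 * ennreal (e\<^sup>2) * (2 * (ennreal y + n2 v)) + ennreal z))"
    proof (intro mult_left_mono add_mono)
      have "n2 r1 \<le> ennreal C1 * ennreal (e\<^sup>2) * n2 (poly (U N))"
        unfolding r1_def by (subst n2_minus) (use cons elim in auto)
      also have "n2 (poly (U N)) = n2 (\<lambda>t. Y t + - v t)" by (simp add: v_def)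
      also have "\<dots> \<le> 2 * (n2 Y + n2 (\<lambda>t. - v t))" by (rule n2_add_le) measurable
      also have "n2 (\<lambda>t. - v t) = n2 v" by (simp add: n2_def)
      finally show "n2 r1 \<le> ennreal C1 * ennreal (e\<^sup>2) * (2 * (ennreal y + n2 v))"
        by (simp add: y(2) mult_left_mono)
      show "n2 r2 \<le> ennreal z" unfolding r2_def using elim by simp
    qed auto
    finally have main: "n2 v \<le> ennreal C2 * (2 * (ennreal C1 * ennreal (e\<^sup>2) * (2 * (ennreal y + n2 v)) + ennreal z))" .
    obtain x where x: "0 \<le> x" "n2 v = ennreal x" using n2_finite[OF cv] by (cases "n2 v") auto
    have two: "2 * ennreal a = ennreal (2 * a)" if "0 \<le> a" for a
      using that by (simp add: ennreal_mult)
    have "ennreal x \<le> ennreal (C2 * (2 * (C1 * e\<^sup>2 * (2 * (y + x)) + z)))"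
      using main x(1) y(1) z(1) C e(1) unfolding x(2)
      by (simp add: ennreal_mult[symmetric] ennreal_plus[symmetric] two del: ennreal_plus)
    moreover have "0 \<le> C2 * (2 * (C1 * e\<^sup>2 * (2 * (y + x)) + z))"
      using x(1) y(1) z(1) C by simp
    ultimately have "x \<le> C2 * (2 * (C1 * e\<^sup>2 * (2 * (y + x)) + z))" by (simp only: ennreal_le_iff)
    also have "\<dots> = 4 * C1 * C2 * e\<^sup>2 * (y + x) + 2 * C2 * z" by (simp add: algebra_simps)
    also have "\<dots> \<le> m * (y + x) + \<eta> / 4" using ke z x y by (intro add_mono mult_right_mono) auto
    also have "\<dots> \<le> \<eta> / 4 + 1/2 * x + \<eta> / 4"
      using m mult_right_mono[OF m(2) x(1)] by (simp add: distrib_left)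
    finally have "x \<le> \<eta>" by simp
    thus ?case using x by (simp add: v_def[symmetric] ennreal_leI)
  qed
qed

section \<open>Transfer to the original equation\<close>

text \<open>The projection onto the reference interval; composing with it extends the data continuously to
  the whole line, without changing anything on the interval.\<close>

definition clamp1 :: "real \<Rightarrow> real" where
  "clamp1 t = max (-1) (min 1 t)"

lemma clamp1_id [simp]: "t \<in> {-1..1} \<Longrightarrow> clamp1 t = t"
  by (simp add: clamp1_def)

lemma continuous_to_ref_clamp1:
  assumes "continuous_on {0..T} u" "0 < T"
  shows "continuous_on UNIV (\<lambda>t. to_ref T u (clamp1 t))"
  unfolding to_ref_def
proof (rule continuous_on_compose2[OF assms(1)])
  show "continuous_on UNIV (\<lambda>t. T / 2 * (clamp1 t + 1))"
    unfolding clamp1_def by (intro continuous_intros)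
  show "range (\<lambda>t. T / 2 * (clamp1 t + 1)) \<subseteq> {0..T}"
  proof clarify
    fix t
    have "0 \<le> clamp1 t + 1" "clamp1 t + 1 \<le> 2" by (auto simp: clamp1_def)
    hence "0 \<le> T / 2 * (clamp1 t + 1)" "T / 2 * (clamp1 t + 1) \<le> T / 2 * 2"
      using assms(2) by (auto intro!: mult_nonneg_nonneg mult_left_mono simp del: mult_le_cancel_left_pos)
    thus "T / 2 * (clamp1 t + 1) \<in> {0..T}" by simp
  qed
qed

lemma fractional_integral_to_ref:
  assumes T: "0 < T" and t: "t \<in> {-1..1}"
  shows "(LBINT s:{0..T / 2 * (t + 1)}. (T / 2 * (t + 1) - s) powr (\<alpha> - 1) * b s * y s) =
    (T / 2) powr \<alpha> * (\<integral>s. indicator {-1..1} s * (sing \<alpha> (t - s) * (to_ref T b s * to_ref T y s)) \<partial>lborel)"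
proof -
  define x where "x = T / 2 * (t + 1)"
  define g where "g s = indicator {0..x} s * ((x - s) powr (\<alpha> - 1) * b s * y s)" for s
  have "(LBINT s:{0..x}. (x - s) powr (\<alpha> - 1) * b s * y s) = integral\<^sup>L lborel g"
    by (simp add: set_lebesgue_integral_def g_def[abs_def])
  also have "\<dots> = \<bar>T / 2\<bar> *\<^sub>R (\<integral>s. g (T / 2 + T / 2 * s) \<partial>lborel)"
    by (rule lborel_integral_real_affine) (use T in auto)
  also have "(\<integral>s. g (T / 2 + T / 2 * s) \<partial>lborel) =
      (\<integral>s. (T / 2) powr (\<alpha> - 1) * (indicator {-1..1} s * (sing \<alpha> (t - s) * (to_ref T b s * to_ref T y s))) \<partial>lborel)"
  proof (rule Bochner_Integration.integral_cong)
    fix s :: real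
    have xs: "x - (T / 2 + T / 2 * s) = T / 2 * (t - s)" by (simp add: x_def algebra_simps)
    have "T / 2 + T / 2 * s \<le> x \<longleftrightarrow> 0 \<le> T / 2 * (t - s)" using xs by linarith
    also have "\<dots> \<longleftrightarrow> s \<le> t" using T by (simp add: zero_le_mult_iff)
    finally have le: "T / 2 + T / 2 * s \<le> x \<longleftrightarrow> s \<le> t" .
    have "0 \<le> T / 2 + T / 2 * s \<longleftrightarrow> 0 \<le> T / 2 * (1 + s)" by (simp add: distrib_left)
    also have "\<dots> \<longleftrightarrow> -1 \<le> s" using T by (auto simp: zero_le_mult_iff)
    finally have ge: "0 \<le> T / 2 + T / 2 * s \<longleftrightarrow> -1 \<le> s" .
    have rf: "to_ref T u s = u (T / 2 + T / 2 * s)" for u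
      by (simp add: to_ref_def distrib_left add.commute)
    consider "s < -1" | "-1 \<le> s" "s < t" | "s = t" | "-1 \<le> s" "t < s" using t by force
    thus "g (T / 2 + T / 2 * s) = (T / 2) powr (\<alpha> - 1) * (indicator {-1..1} s * (sing \<alpha> (t - s) * (to_ref T b s * to_ref T y s)))"
    proof cases
      case 1 thus ?thesis using ge by (simp add: g_def)
    next
      case 2
      have "(T / 2 * (t - s)) powr (\<alpha> - 1) = (T / 2) powr (\<alpha> - 1) * (t - s) powr (\<alpha> - 1)"
        using T 2 by (intro powr_mult)
      thus ?thesis unfolding g_def xs using 2 t le ge by (simp add: sing_def rf)
    next
      case 3 thus ?thesis unfolding g_def xs by (simp add: sing_def)
    next
      case 4 thus ?thesis using le by (simp add: g_def sing_def)
    qed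
  qed simp
  also have "\<bar>T / 2\<bar> *\<^sub>R \<dots> = (T / 2 * (T / 2) powr (\<alpha> - 1)) *
      (\<integral>s. indicator {-1..1} s * (sing \<alpha> (t - s) * (to_ref T b s * to_ref T y s)) \<partial>lborel)"
    using T by simp
  also have "T / 2 * (T / 2) powr (\<alpha> - 1) = (T / 2) powr \<alpha>" using T by (simp add: powr_diff)
  finally show ?thesis by (simp add: x_def)
qed

theorem theorem4p2:
  fixes \<alpha> T :: real and a b f y :: "real \<Rightarrow> real" and U :: "nat \<Rightarrow> real poly"
  assumes "0 < \<alpha>" and "\<alpha> < 1" and "0 < T"
    and "continuous_on {0..T} a" and "continuous_on {0..T} b" and "continuous_on {0..T} f"
    and "continuous_on {0..T} y"
    and "fractional_solution \<alpha> T a b f y"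
    and "eventually (\<lambda>N. collocation_solution \<alpha> T a b f N (U N)) sequentially"
  shows "(\<lambda>N. L2_norm (\<lambda>t. to_ref T y t - poly (U N) t)) \<longlonglongrightarrow> 0"
proof -
  note \<alpha> = assms(1,2) and T = assms(3) and cont = assms(4-7)
  define c where "c = (T / 2) powr \<alpha> / Gamma \<alpha>"
  define A B F Y where "A t = c * to_ref T a (clamp1 t)" and "B t = to_ref T b (clamp1 t)"
    and "F t = to_ref T f (clamp1 t)" and "Y t = to_ref T y (clamp1 t)" for t
  have ct: "continuous_on UNIV A" "continuous_on UNIV B" "continuous_on UNIV F" "continuous_on UNIV Y"
    unfolding A_def B_def F_def Y_def
    by (intro continuous_intros continuous_to_ref_clamp1 cont T)+
  have Y: "\<forall>t\<in>{-1..1}. Y t = abel \<alpha> A B Y t + F t"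
  proof
    fix t :: real assume t: "t \<in> {-1..1}"
    have "T / 2 * (t + 1) \<in> {0..T}"
      using continuous_to_ref_clamp1 t T mult_left_mono[of "t + 1" 2 "T / 2"] by auto
    hence "to_ref T y t = to_ref T a t / Gamma \<alpha> *
        (LBINT s:{0..T / 2 * (t + 1)}. (T / 2 * (t + 1) - s) powr (\<alpha> - 1) * b s * y s) + to_ref T f t"
      using assms(8) unfolding fractional_solution_def to_ref_def by blast
    also have "(LBINT s:{0..T / 2 * (t + 1)}. (T / 2 * (t + 1) - s) powr (\<alpha> - 1) * b s * y s) =
        (T / 2) powr \<alpha> * (\<integral>s. indicator {-1..1} s * (sing \<alpha> (t - s) * (B s * Y s)) \<partial>lborel)"
    proof -
      have "(\<integral>s. indicator {-1..1} s * (sing \<alpha> (t - s) * (to_ref T b s * to_ref T y s)) \<partial>lborel) =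
          (\<integral>s. indicator {-1..1} s * (sing \<alpha> (t - s) * (B s * Y s)) \<partial>lborel)"
        by (rule Bochner_Integration.integral_cong) (auto simp: B_def Y_def indicator_def)
      thus ?thesis unfolding fractional_integral_to_ref[OF T t] by simp
    qed
    finally show "Y t = abel \<alpha> A B Y t + F t" using t by (simp add: Y_def F_def A_def c_def abel_def)
  qed
  have U: "\<forall>\<^sub>F N in sequentially. degree (U N) \<le> N \<and> (\<forall>t\<in>{-1..1}.
      poly (U N) t = poly (lgl_interp N (colloc \<alpha> A B N (U N))) t + poly (lgl_interp N F) t)"
    using assms(9) eventually_ge_at_top[of 1]
  proof eventually_elim
    case (elim N)
    define d where "d = T powr \<alpha> / (4 powr \<alpha> * Gamma \<alpha>)"
    define h where "h \<tau> = (\<tau> + 1) powr \<alpha> * to_ref T a \<tau> *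
            (LBINT \<theta>:{-1..1}. (1 - \<theta>) powr (\<alpha> - 1) *
               poly (jacobi_interp (\<alpha> - 1) 0 N (\<lambda>\<theta>. to_ref T b (mu \<tau> \<theta>) * poly (U N) (mu \<tau> \<theta>))) \<theta>)" for \<tau>
    have N: "1 \<le> N" by (rule elim(2))
    have "smult d (lgl_interp N h) = lgl_interp N (\<lambda>\<tau>. d * h \<tau>)" by (rule lgl_interp_cmult[OF N])
    also have "\<dots> = lgl_interp N (colloc \<alpha> A B N (U N))"
    proof (rule lgl_interp_cong[OF N])
      fix \<tau> :: real assume \<tau>: "\<tau> \<in> {-1..1}"
      have "(\<Sum>\<theta>\<in>gnodes \<alpha> N. gw \<alpha> N \<theta> * (to_ref T b (mu \<tau> \<theta>) * poly (U N) (mu \<tau> \<theta>))) =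
          (\<Sum>\<theta>\<in>gnodes \<alpha> N. gw \<alpha> N \<theta> * (B (mu \<tau> \<theta>) * poly (U N) (mu \<tau> \<theta>)))"
      proof (rule sum.cong)
        fix \<theta> assume "\<theta> \<in> gnodes \<alpha> N"
        hence "\<theta> \<in> {-1..1}" using jacobi_nodes(3)[OF \<alpha>(1), of N] by auto
        hence "mu \<tau> \<theta> \<in> {-1..1}" by (rule mu_in_reference[OF \<tau>])
        thus "gw \<alpha> N \<theta> * (to_ref T b (mu \<tau> \<theta>) * poly (U N) (mu \<tau> \<theta>)) =
            gw \<alpha> N \<theta> * (B (mu \<tau> \<theta>) * poly (U N) (mu \<tau> \<theta>))" by (simp add: B_def)
      qed simp
      moreover have "d * (\<tau> + 1) powr \<alpha> = ((\<tau> + 1) / 2) powr \<alpha> * c"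
      proof -
        have "(4::real) powr \<alpha> = 2 powr \<alpha> * 2 powr \<alpha>" using powr_mult[of 2 2 \<alpha>] by simp
        moreover have "(T / 2) powr \<alpha> = T powr \<alpha> / 2 powr \<alpha>" by (rule powr_divide)
        moreover have "((\<tau> + 1) / 2) powr \<alpha> = (\<tau> + 1) powr \<alpha> / 2 powr \<alpha>" by (rule powr_divide)
        ultimately show ?thesis by (simp add: d_def c_def mult_ac)
      qed
      ultimately show "d * h \<tau> = colloc \<alpha> A B N (U N) \<tau>"
        using \<tau> unfolding h_def colloc_def jacobi_interp_integral[OF \<alpha>(1)]
        by (simp add: A_def mult.assoc[symmetric])
    qed
    finally have 1: "poly (lgl_interp N (colloc \<alpha> A B N (U N))) t = d * poly (lgl_interp N h) t" for t
      by (metis poly_smult)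
    have 2: "lgl_interp N (to_ref T f) = lgl_interp N F"
      by (rule lgl_interp_cong[OF N]) (simp add: F_def)
    show ?case using elim(1) unfolding collocation_solution_def 1 2 d_def h_def by blast
  qed
  have "\<forall>\<^sub>F N in sequentially. dist (L2_norm (\<lambda>t. to_ref T y t - poly (U N) t)) 0 < e" if e: "0 < e" for e
  proof -
    define \<eta> where "\<eta> = (e / 2)\<^sup>2"
    have \<eta>: "0 < \<eta>" using e by (simp add: \<eta>_def)
    show ?thesis using collocation_convergence[OF \<alpha> ct Y U \<eta>]
    proof eventually_elim
      case (elim N)
      define J where "J = (LBINT t:{-1<..<1}. (to_ref T y t - poly (U N) t)\<^sup>2)"
      have J0: "0 \<le> J" unfolding J_def set_lebesgue_integral_def
        by (intro Bochner_Integration.integral_nonneg) auto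
      have "J = (\<integral>t. indicator {-1<..<1} t * (Y t - poly (U N) t)\<^sup>2 \<partial>lborel)"
        unfolding J_def set_lebesgue_integral_def
        by (intro Bochner_Integration.integral_cong) (auto simp: Y_def indicator_def)
      hence "ennreal J \<le> (\<integral>\<^sup>+t. ennreal \<bar>indicator {-1<..<1} t * (Y t - poly (U N) t)\<^sup>2\<bar> \<partial>lborel)"
        using J0 abs_integral_le_nn_integral[of lborel "\<lambda>t. indicator {-1<..<1} t * (Y t - poly (U N) t)\<^sup>2"]
        by simp
      also have "\<dots> \<le> n2 (\<lambda>t. Y t - poly (U N) t)"
        unfolding n2_def by (intro nn_integral_mono) (auto simp: indicator_def)
      also have "\<dots> \<le> ennreal \<eta>" by (rule elim)
      finally have "J \<le> \<eta>" using \<eta> by (subst (asm) ennreal_le_iff) auto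
      hence "sqrt J \<le> e / 2" using e by (intro real_le_lsqrt) (auto simp: \<eta>_def J0)
      thus ?case using e J0 by (simp add: L2_norm_def J_def[symmetric])
    qed
  qed
  thus ?thesis by (rule tendstoI)
qed

end
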